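(* Let $0\le\tau\le 1$, fix a time $t$, and let $c_t>0$. Consider the nominal model $x_{t+1}=A_tx_t+B_tv_t$, $y_t=C_tx_t+D_tv_t$ with $x_t\in\mathbb{R}^n$, $y_t\in\mathbb{R}^p$, $v_t\in\mathbb{R}^{n+p}$ white Gaussian noise with identity covariance, and $\Gamma_t=\begin{bmatrix}B_t\\ D_t\end{bmatrix}$ square and invertible. Assume $\tilde f_t(x_t|Y_{t-1})$ is the Gaussian density $\mathcal N(\hat x_t,V_t)$ with $V_t$ symmetric positive definite, and let $\phi_t$, $\bar f_t$, $\mathcal B_{t,\tau}$, $\mathcal G_t$, $J_t$ be as defined in the context. Set $$G_t=(A_tV_tC_t^T+B_tD_t^T)(C_tV_tC_t^T+D_tD_t^T)^{-1},$$ $$P_{t+1}=A_tV_tA_t^T-G_t(C_tV_tC_t^T+D_tD_t^T)G_t^T+B_tB_t^T,$$ and let $L_{P_{t+1}}$ be a square matrix with $P_{t+1}=L_{P_{t+1}}L_{P_{t+1}}^T$. Then there is a unique $\theta_t>0$ with $\theta_t^{-1}>(1-\tau)\|P_{t+1}\|$ and $c_t=\gamma_\tau(P_{t+1},\theta_t)$. With this $\theta_t$ put $$V_{t+1}=\begin{cases}L_{P_{t+1}}\bigl(I_n-\theta_t(1-\tau)L_{P_{t+1}}^TL_{P_{t+1}}\bigr)^{\frac{1}{\tau-1}}L_{P_{t+1}}^T, & 0\le\tau<1,\\[2pt] L_{P_{t+1}}\exp\bigl(\theta_tL_{P_{t+1}}^TL_{P_{t+1}}\bigr)L_{P_{t+1}}^T,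 & \tau=1.\end{cases}$$ Then the minimax problem $$\min_{g_t\in\mathcal G_t}\ \max_{\tilde\phi_t\in\mathcal B_{t,\tau}}J_t(\tilde\phi_t,g_t)$$ has the following solution $(g_t^\circ,\tilde\phi_t^\circ)$. (i) The optimal estimator is $\hat x_{t+1}=g_t^\circ(y_t)=A_t\hat x_t+G_t(y_t-C_t\hat x_t)$. (ii) The least favorable conditional density of $z_t=[x_{t+1}^T\ y_t^T]^T$ given $Y_{t-1}$ is $$\tilde f_t^\circ(z_t|Y_{t-1})\sim\mathcal N\left(\begin{bmatrix}A_t\\ C_t\end{bmatrix}\hat x_t,\ \begin{bmatrix}\tilde K_{x_{t+1}} & K_{x_{t+1},y_t}\\ K_{y_t,x_{t+1}} & K_{y_t}\end{bmatrix}\right),$$ where $K_{x_{t+1},y_t}$, $K_{y_t,x_{t+1}}$, $K_{y_t}$ are the corresponding blocks of the covariance matrix of $\bar f_t$, and $\tilde K_{x_{t+1}}=V_{t+1}+K_{x_{t+1},y_t}K_{y_t}^{-1}K_{y_t,x_{t+1}}$. Thus $V_{t+1}$ is the least favorable conditional covariance of $x_{t+1}$ given $Y_t$. (iii) The matrix $\Phi_t=P_{t+1}^{-1}-V_{t+1}^{-1}$ is positive definite, and a least favorable transition density is $$\tilde\phi_t^\circ(z_t|x_t)=\frac{1}{M_t(\Phi_t)}\exp\left(\tfrac12(x_{t+1}-\hat x_{t+1})^T\Phi_t(x_{t+1}-\hat x_{t+1})\right)\phi_t(z_t|x_t),$$ where $\hat x_{t+1}=g_t^\circ(y_t)$ and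 the constant $M_t(\Phi_t)$ is such that $\int\int\tilde\phi_t^\circ(z_t|x_t)\tilde f_t(x_t|Y_{t-1})\,\mathrm dz_t\,\mathrm dx_t=1$.
   Context: Time $t$ and the past observations $Y_{t-1}=\{y_s:0\le s\le t-1\}$ are fixed. The vector $\hat x_t$ and the matrix $V_t$ are given (they depend only on $Y_{t-1}$ and the model). Write $z_t=[x_{t+1}^T\ y_t^T]^T\in\mathbb{R}^{n+p}$. **Nominal transition density.** $\phi_t(z_t|x_t)$ is the Gaussian density with mean $\begin{bmatrix}A_t\\ C_t\end{bmatrix}x_t$ and (positive definite) covariance $\Gamma_t\Gamma_t^T$. **Pseudo-nominal density.** $\bar f_t(z_t|Y_{t-1})=\int\phi_t(z_t|x_t)\tilde f_t(x_t|Y_{t-1})\,\mathrm dx_t$. It is Gaussian with mean $\begin{bmatrix}A_t\\ C_t\end{bmatrix}\hat x_t$ and covariance $$K_{z_t}=\begin{bmatrix}K_{x_{t+1}} & K_{x_{t+1},y_t}\\ K_{y_t,x_{t+1}} & K_{y_t}\end{bmatrix}=\begin{bmatrix}A_t\\ C_t\end{bmatrix}V_t\begin{bmatrix}A_t^T&C_t^T\end{bmatrix}+\Gamma_t\Gamma_t^T.$$ **$\tau$-divergence.** Let $f\sim\mathcal N(m,K)$ and $\tilde f\sim\mathcal N(\tilde m,\tilde K)$ be Gaussian densities on $\mathbb{R}^{N}$ with positive definite covariances. Let $K=LL^T$ with $L$ square, and $\Delta m=\tilde m-m$. Then $$\mathcal D_\tau(\tilde f\|f)=\begin{cases}\Delta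 m^TK^{-1}\Delta m+\operatorname{tr}\bigl(-\log(\tilde KK^{-1})+\tilde KK^{-1}-I_N\bigr),&\tau=0,\\ \frac1{1-\tau}\Delta m^TK^{-1}\Delta m+\operatorname{tr}\bigl(-\frac1{\tau(1-\tau)}(L^{-1}\tilde KL^{-T})^\tau+\frac1{1-\tau}\tilde KK^{-1}+\frac1\tau I_N\bigr),&0<\tau<1,\\ \delta_\infty(\Delta m)+\operatorname{tr}\bigl(L^{-1}\tilde KL^{-T}\log(L^{-1}\tilde KL^{-T})-\tilde KK^{-1}+I_N\bigr),&\tau=1,\end{cases}$$ where $\delta_\infty(v)=0$ if $v=0$ and $+\infty$ otherwise. Real powers, exponentials and logarithms of symmetric positive definite matrices are the usual matrix functions; $\operatorname{tr}\log(\tilde KK^{-1})=\log\det(\tilde KK^{-1})$. **Uncertainty ball.** $\mathcal B_{t,\tau}$ is the set of nonnegative measurable functions $\tilde\phi_t(z_t|x_t)$ such that $\tilde f_t(z_t|Y_{t-1}):=\int\tilde\phi_t(z_t|x_t)\tilde f_t(x_t|Y_{t-1})\,\mathrm dx_t$ is a Gaussian probability density with positive definite covariance and $\mathcal D_\tau(\tilde f_t\|\bar f_t)\le c_t$. The function $\tilde\phi_t(\cdot|x_t)$ is not required to integrate to $1$ for each $x_t$; only the joint normalization $\int\int\tilde\phi_t(z_t|x_t)\tilde f_t(x_t|Y_{t-1})\,\mathrm dz_t\,\mathrm dx_t=1$ is required. **Estimators and loss.** $\mathcal G_t$ is the set of measurable $g_t:\mathbb{R}^p\to\mathbb{R}^n$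 (dependence on $Y_{t-1}$ suppressed) with finite second moment $\int\int\|g_t(y_t)\|^2\tilde\phi_t(z_t|x_t)\tilde f_t(x_t|Y_{t-1})\,\mathrm dx_t\,\mathrm dz_t$ for every $\tilde\phi_t\in\mathcal B_{t,\tau}$. The loss is $$J_t(\tilde\phi_t,g_t)=\int\int\|x_{t+1}-g_t(y_t)\|^2\tilde\phi_t(z_t|x_t)\tilde f_t(x_t|Y_{t-1})\,\mathrm dx_t\,\mathrm dz_t.$$ **Solution of the minimax problem.** $(g_t^\circ,\tilde\phi_t^\circ)$ is a solution if $g_t^\circ\in\mathcal G_t$ minimizes $g_t\mapsto\sup_{\tilde\phi_t\in\mathcal B_{t,\tau}}J_t(\tilde\phi_t,g_t)$ over $\mathcal G_t$, and $\tilde\phi_t^\circ\in\mathcal B_{t,\tau}$ maximizes $\tilde\phi_t\mapsto J_t(\tilde\phi_t,g_t^\circ)$ over $\mathcal B_{t,\tau}$. The least favorable conditional density is $\tilde f_t^\circ(z_t|Y_{t-1})=\int\tilde\phi_t^\circ(z_t|x_t)\tilde f_t(x_t|Y_{t-1})\,\mathrm dx_t$. **The function $\gamma_\tau$.** For $P$ symmetric positive definite of size $n$, $P=L_PL_P^T$ with $L_P$ square, and $\theta>0$ with $\theta^{-1}>(1-\tau)\|P\|$: $$\gamma_\tau(P,\theta)=\begin{cases}-\log\det(I_n-\theta P)^{-1}+\operatorname{tr}\bigl((I_n-\theta P)^{-1}-I_n\bigr),&\tau=0,\\ \operatorname{tr}\bigl(-\frac1{\tau(1-\tau)}(I_n-\theta(1-\tau)L_P^TL_P)^{\frac{\tau}{\tau-1}}+\frac1{1-\tau}(I_n-\theta(1-\tau)L_P^TL_P)^{\frac1{\tau-1}}+\frac1\tau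 I_n\bigr),&0<\tau<1,\\ \operatorname{tr}\bigl(\exp(\theta L_P^TL_P)(\theta L_P^TL_P-I_n)+I_n\bigr),&\tau=1.\end{cases}$$ Here $\|P\|$ denotes the spectral norm of $P$; $\|\cdot\|$ on vectors is the Euclidean norm. *)

theory Defs
  imports "HOL-Analysis.Analysis"
begin

section \<open>Block vectors and block matrices\<close>

text \<open>A vector \<open>z = [x\<^sup>T y\<^sup>T]\<^sup>T\<close> with \<open>n + p\<close> entries is indexed by the sum type
  \<open>'n + 'p\<close>; \<open>Inl\<close> addresses the first block, \<open>Inr\<close> the second.\<close>

definition vec_join :: "real^'n::finite \<Rightarrow> real^'p::finite \<Rightarrow> real^('n + 'p)" where
  "vec_join x y = (\<chi> k. case k of Inl i \<Rightarrow> x $ i | Inr j \<Rightarrow> y $ j)"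

definition vec_upper :: "real^('n::finite + 'p::finite) \<Rightarrow> real^'n" where
  "vec_upper z = (\<chi> i. z $ Inl i)"

definition vec_lower :: "real^('n::finite + 'p::finite) \<Rightarrow> real^'p" where
  "vec_lower z = (\<chi> j. z $ Inr j)"

definition mat_stack :: "real^'k^'n::finite \<Rightarrow> real^'k^'p::finite \<Rightarrow> real^'k^('n + 'p)" where
  "mat_stack M N = (\<chi> k. case k of Inl i \<Rightarrow> M $ i | Inr j \<Rightarrow> N $ j)"

definition mat_blocks ::
  "real^'n^'n \<Rightarrow> real^'p^'n \<Rightarrow> real^'n^'p \<Rightarrow> real^'p^'p \<Rightarrow> real^('n::finite + 'p::finite)^('n + 'p)" where
  "mat_blocks M11 M12 M21 M22 =
     mat_stack (\<chi> i. vec_join (M11 $ i) (M12 $ i)) (\<chi> j. vec_join (M21 $ j) (M22 $ j))"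

section \<open>Positive definite matrices and matrix functions\<close>

definition pos_def :: "real^'n^'n::finite \<Rightarrow> bool" where
  "pos_def S \<longleftrightarrow> transpose S = S \<and> (\<forall>x. x \<noteq> 0 \<longrightarrow> x \<bullet> (S *v x) > 0)"

definition diag_mat :: "real^'n::finite \<Rightarrow> real^'n^'n" where
  "diag_mat d = (\<chi> i j. if i = j then d $ i else 0)"

text \<open>Spectral calculus: \<open>f\<close> acts on the eigenvalues of a symmetric matrix. The value does not
  depend on the chosen diagonalization, see \<open>mat_fun_eq\<close>. For a matrix
  that is not symmetric the result is unspecified.\<close>

definition mat_fun :: "(real \<Rightarrow> real) \<Rightarrow> real^'n^'n \<Rightarrow> real^'n::finite^'n" where
  "mat_fun f S = (THE M. \<exists>Q d. orthogonal_matrix Q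
      \<and> S = Q ** diag_mat d ** transpose Q
      \<and> M = Q ** diag_mat (\<chi> i. f (d $ i)) ** transpose Q)"

abbreviation mat_powr :: "real^'n^'n \<Rightarrow> real \<Rightarrow> real^'n::finite^'n" where
  "mat_powr S a \<equiv> mat_fun (\<lambda>x. x powr a) S"

abbreviation mat_exp :: "real^'n^'n \<Rightarrow> real^'n::finite^'n" where
  "mat_exp S \<equiv> mat_fun exp S"

abbreviation mat_ln :: "real^'n^'n \<Rightarrow> real^'n::finite^'n" where
  "mat_ln S \<equiv> mat_fun ln S"

lemma mat_mult_diag: "(U ** diag_mat d) $ i $ j = U $ i $ j * d $ j"
  by (simp add: matrix_matrix_mult_def diag_mat_def if_distrib cong: if_cong)

lemma diag_mult_mat: "(diag_mat d ** U) $ i $ j = d $ i * U $ i $ j"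
  by (simp add: matrix_matrix_mult_def diag_mat_def if_distrib if_distribR cong: if_cong)

lemma mat_fun_eq:
  assumes Q: "orthogonal_matrix Q"
  shows "mat_fun f (Q ** diag_mat d ** transpose Q)
           = Q ** diag_mat (\<chi> i. f (d $ i)) ** transpose Q"
  unfolding mat_fun_def
proof (rule the_equality)
  show "\<exists>Q' d'. orthogonal_matrix Q' \<and> Q ** diag_mat d ** transpose Q = Q' ** diag_mat d' ** transpose Q'
      \<and> Q ** diag_mat (\<chi> i. f (d $ i)) ** transpose Q = Q' ** diag_mat (\<chi> i. f (d' $ i)) ** transpose Q'"
    using Q by blast
next
  fix M
  assume "\<exists>R e. orthogonal_matrix R \<and> Q ** diag_mat d ** transpose Q = R ** diag_mat e ** transpose R
      \<and> M = R ** diag_mat (\<chi> i. f (e $ i)) ** transpose R"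
  then obtain R e where R: "orthogonal_matrix R"
    and eq: "Q ** diag_mat d ** transpose Q = R ** diag_mat e ** transpose R"
    and M: "M = R ** diag_mat (\<chi> i. f (e $ i)) ** transpose R" by blast
  have QQ: "transpose Q ** Q = mat 1" "Q ** transpose Q = mat 1"
    and RR: "transpose R ** R = mat 1" "R ** transpose R = mat 1"
    using Q R by (auto simp: orthogonal_matrix_def)
  define U where "U = transpose R ** Q"
  have "U ** diag_mat d = transpose R ** (Q ** diag_mat d ** transpose Q) ** Q"
    unfolding U_def using QQ by (simp add: matrix_mul_assoc[symmetric])
  also have "\<dots> = diag_mat e ** U"
    unfolding U_def eq using RR by (simp add: matrix_mul_assoc)
  finally have "U $ i $ j * d $ j = e $ i * U $ i $ j" for i j
    by (metis mat_mult_diag diag_mult_mat)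
  then have "U $ i $ j = 0 \<or> d $ j = e $ i" for i j
    by (metis mult.commute mult_cancel_right)
  then have "U $ i $ j * f (d $ j) = f (e $ i) * U $ i $ j" for i j
    by (metis mult.commute mult_zero_left)
  then have UF: "U ** diag_mat (\<chi> i. f (d $ i)) = diag_mat (\<chi> i. f (e $ i)) ** U"
    by (simp add: vec_eq_iff mat_mult_diag diag_mult_mat)
  have "R ** (U ** diag_mat (\<chi> i. f (d $ i))) ** transpose Q
      = (R ** transpose R) ** Q ** diag_mat (\<chi> i. f (d $ i)) ** transpose Q"
    unfolding U_def by (simp add: matrix_mul_assoc)
  moreover have "R ** (diag_mat (\<chi> i. f (e $ i)) ** U) ** transpose Q
      = R ** diag_mat (\<chi> i. f (e $ i)) ** transpose R ** (Q ** transpose Q)"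
    unfolding U_def by (simp add: matrix_mul_assoc)
  ultimately show "M = Q ** diag_mat (\<chi> i. f (d $ i)) ** transpose Q"
    using UF QQ RR by (simp add: M)
qed

text \<open>An arbitrary square \<open>L\<close> with \<open>K = L L\<^sup>T\<close>. The quantities below that use it depend on \<open>K\<close>
  only, because two such factors of a positive definite \<open>K\<close> differ by an orthogonal matrix on
  the right.\<close>

definition square_factor :: "real^'n^'n \<Rightarrow> real^'n::finite^'n" where
  "square_factor K = (SOME L. K = L ** transpose L)"

text \<open>In HOL-Analysis \<open>norm\<close> of a matrix is the Frobenius norm, so the spectral norm is
  expressed as an operator norm.\<close>

abbreviation spectral_norm :: "real^'n^'n \<Rightarrow> real" where
  "spectral_norm S \<equiv> onorm ((*v) S)"

section \<open>Gaussian densities\<close>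

definition gauss_density :: "real^'n \<Rightarrow> real^'n^'n \<Rightarrow> real^'n::finite \<Rightarrow> real" where
  "gauss_density m K z =
     exp (- ((z - m) \<bullet> (matrix_inv K *v (z - m))) / 2) / sqrt ((2 * pi) ^ CARD('n) * det K)"

text \<open>Densities are identified up to Lebesgue null sets.\<close>

definition is_gauss_density :: "(real^'n::finite \<Rightarrow> real) \<Rightarrow> bool" where
  "is_gauss_density f \<longleftrightarrow>
     (\<exists>m K. pos_def K \<and> (AE z in lborel. f z = gauss_density m K z))"

definition density_mean :: "(real^'n::finite \<Rightarrow> real) \<Rightarrow> real^'n" where
  "density_mean f = (LINT z|lborel. f z *\<^sub>R z)"

definition density_cov :: "(real^'n::finite \<Rightarrow> real) \<Rightarrow> real^'n^'n" where
  "density_cov f = (\<chi> i j. LINT z|lborel.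
      f z * ((z - density_mean f) $ i * (z - density_mean f) $ j))"

text \<open>Conditional density of the first block, at \<open>x\<close>, given that the second block equals \<open>y\<close>.\<close>

definition cond_density ::
  "(real^('n::finite + 'p::finite) \<Rightarrow> real) \<Rightarrow> real^'p \<Rightarrow> real^'n \<Rightarrow> real" where
  "cond_density f y x = f (vec_join x y) / (LINT x'|lborel. f (vec_join x' y))"

section \<open>The tau-divergence and the function gamma\<close>

definition delta_infty :: "real^'n::finite \<Rightarrow> ereal" where
  "delta_infty v = (if v = 0 then 0 else \<infinity>)"

text \<open>\<open>gauss_tau_div \<tau> m' K' m K\<close> is the divergence of \<open>N(m', K')\<close> from \<open>N(m, K)\<close>. In the case
  \<open>\<tau> = 0\<close> the trace of the logarithm is read as the logarithm of the determinant, because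
  \<open>K' K\<^sup>-\<^sup>1\<close> need not be symmetric. The last branch is meant for \<open>\<tau> = 1\<close>.\<close>

definition gauss_tau_div ::
  "real \<Rightarrow> real^'n::finite \<Rightarrow> real^'n^'n \<Rightarrow> real^'n \<Rightarrow> real^'n^'n \<Rightarrow> ereal" where
  "gauss_tau_div \<tau> m' K' m K =
    (let d = m' - m;
         L = square_factor K;
         S = matrix_inv L ** K' ** transpose (matrix_inv L);
         R = K' ** matrix_inv K
     in if \<tau> = 0 then
          ereal (d \<bullet> (matrix_inv K *v d) + (- ln (det R) + trace (R - mat 1)))
        else if \<tau> < 1 then
          ereal (1 / (1 - \<tau>) * (d \<bullet> (matrix_inv K *v d))
            + trace (- (1 / (\<tau> * (1 - \<tau>))) *\<^sub>R mat_powr S \<tau>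
                     + (1 / (1 - \<tau>)) *\<^sub>R R + (1 / \<tau>) *\<^sub>R mat 1))
        else
          delta_infty d + ereal (trace (S ** mat_ln S - R + mat 1)))"

text \<open>The divergence of Gaussian densities, which are determined by mean and covariance.\<close>

definition tau_div ::
  "real \<Rightarrow> (real^'n::finite \<Rightarrow> real) \<Rightarrow> (real^'n \<Rightarrow> real) \<Rightarrow> ereal" where
  "tau_div \<tau> f' f =
     gauss_tau_div \<tau> (density_mean f') (density_cov f') (density_mean f) (density_cov f)"

definition gamma_tau :: "real \<Rightarrow> real^'n^'n \<Rightarrow> real \<Rightarrow> real" where
  "gamma_tau \<tau> (P :: real^'n^'n::finite) \<theta> =
    (let L = square_factor P; S = transpose L ** L
     in if \<tau> = 0 then
          - ln (det (matrix_inv (mat 1 - \<theta> *\<^sub>R P))) + trace (matrix_inv (mat 1 - \<theta> *\<^sub>R P) - mat 1)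
        else if \<tau> < 1 then
          trace (- (1 / (\<tau> * (1 - \<tau>))) *\<^sub>R mat_powr (mat 1 - (\<theta> * (1 - \<tau>)) *\<^sub>R S) (\<tau> / (\<tau> - 1))
                 + (1 / (1 - \<tau>)) *\<^sub>R mat_powr (mat 1 - (\<theta> * (1 - \<tau>)) *\<^sub>R S) (1 / (\<tau> - 1))
                 + (1 / \<tau>) *\<^sub>R mat 1)
        else
          trace (mat_exp (\<theta> *\<^sub>R S) ** (\<theta> *\<^sub>R S - mat 1) + mat 1))"

section \<open>The minimax problem\<close>

text \<open>Transition densities are written \<open>\<phi> z x\<close> for \<open>\<phi>(z|x)\<close>. The law of the state given the past
  is \<open>N(xhat, V)\<close> throughout.

  Given the state \<open>x\<close>, the pair \<open>z\<close> of next state and observation in the nominal model is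
  \<open>[A; C] x + [B; D] v\<close> with \<open>v\<close> standard normal.\<close>

definition nominal_density ::
  "real^'n^'n \<Rightarrow> real^('n + 'p)^'n \<Rightarrow> real^'n^'p \<Rightarrow> real^('n + 'p)^'p
    \<Rightarrow> real^('n::finite + 'p::finite) \<Rightarrow> real^'n \<Rightarrow> real" where
  "nominal_density A B C D z x =
     gauss_density (mat_stack A C *v x) (mat_stack B D ** transpose (mat_stack B D)) z"

definition joint_density ::
  "real^'n \<Rightarrow> real^'n^'n \<Rightarrow> (real^('n::finite + 'p::finite) \<Rightarrow> real^'n \<Rightarrow> real)
    \<Rightarrow> real^('n + 'p) \<Rightarrow> real" where
  "joint_density xhat V \<phi> z = (LINT x|lborel. \<phi> z x * gauss_density xhat V x)"

text \<open>For positive definite \<open>V\<close> and invertible \<open>mat_stack B D\<close>, mean and covariance of \<open>joint_density xhat V (nominal_density A B C D)\<close> are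
  \<open>mat_stack A C *v xhat\<close> and \<open>nominal_cov A B C D V\<close>.\<close>

definition nominal_cov ::
  "real^'n^'n \<Rightarrow> real^('n + 'p)^'n \<Rightarrow> real^'n^'p \<Rightarrow> real^('n + 'p)^'p \<Rightarrow> real^'n^'n
    \<Rightarrow> real^('n::finite + 'p::finite)^('n + 'p)" where
  "nominal_cov A B C D V =
     mat_stack A C ** V ** transpose (mat_stack A C) + mat_stack B D ** transpose (mat_stack B D)"

text \<open>The requirement that the joint density is a Gaussian probability density comprises the joint
  normalization of \<open>\<phi>\<close>; no normalization for individual \<open>x\<close> is imposed. As the Gaussian density
  is positive, it also forces the Bochner integral in \<open>joint_density\<close> to exist almost everywhere.\<close>

definition uncertainty_ball ::
  "real \<Rightarrow> real \<Rightarrow> real^'n \<Rightarrow> real^'n^'n \<Rightarrow> (real^('n::finite + 'p::finite) \<Rightarrow> real^'n \<Rightarrow> real)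
    \<Rightarrow> (real^('n + 'p) \<Rightarrow> real^'n \<Rightarrow> real) set" where
  "uncertainty_ball \<tau> c xhat V \<phi>nom =
     {\<phi>. (\<forall>z x. \<phi> z x \<ge> 0) \<and> (\<lambda>(z, x). \<phi> z x) \<in> borel_measurable borel
        \<and> is_gauss_density (joint_density xhat V \<phi>)
        \<and> tau_div \<tau> (joint_density xhat V \<phi>) (joint_density xhat V \<phi>nom) \<le> ereal c}"

definition estimators ::
  "real^'n \<Rightarrow> real^'n^'n \<Rightarrow> (real^('n::finite + 'p::finite) \<Rightarrow> real^'n \<Rightarrow> real) set
    \<Rightarrow> (real^'p \<Rightarrow> real^'n) set" where
  "estimators xhat V \<B> =
     {g \<in> borel_measurable borel. \<forall>\<phi>\<in>\<B>.
        (\<integral>\<^sup>+z. \<integral>\<^sup>+x. ennreal ((norm (g (vec_lower z)))\<^sup>2 * \<phi> z x * gauss_density xhat V x)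
           \<partial>lborel \<partial>lborel) < \<infinity>}"

definition loss ::
  "real^'n \<Rightarrow> real^'n^'n \<Rightarrow> (real^('n::finite + 'p::finite) \<Rightarrow> real^'n \<Rightarrow> real)
    \<Rightarrow> (real^'p \<Rightarrow> real^'n) \<Rightarrow> ennreal" where
  "loss xhat V \<phi> g =
     (\<integral>\<^sup>+z. \<integral>\<^sup>+x. ennreal ((norm (vec_upper z - g (vec_lower z)))\<^sup>2 * \<phi> z x * gauss_density xhat V x)
        \<partial>lborel \<partial>lborel)"

definition is_minimax_solution ::
  "real^'n \<Rightarrow> real^'n^'n \<Rightarrow> (real^('n::finite + 'p::finite) \<Rightarrow> real^'n \<Rightarrow> real) set
    \<Rightarrow> (real^'p \<Rightarrow> real^'n) \<Rightarrow> (real^('n + 'p) \<Rightarrow> real^'n \<Rightarrow> real) \<Rightarrow> bool" where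
  "is_minimax_solution xhat V \<B> g0 \<phi>0 \<longleftrightarrow>
     g0 \<in> estimators xhat V \<B>
     \<and> (\<forall>g \<in> estimators xhat V \<B>. (SUP \<phi>\<in>\<B>. loss xhat V \<phi> g0) \<le> (SUP \<phi>\<in>\<B>. loss xhat V \<phi> g))
     \<and> \<phi>0 \<in> \<B>
     \<and> (\<forall>\<phi>\<in>\<B>. loss xhat V \<phi> g0 \<le> loss xhat V \<phi>0 g0)"

end

theory Submission
  imports Defs "HOL-Probability.Distributions"
begin

text \<open>Whitening by the nominal covariance \<open>K\<close> of \<open>z\<close> turns the divergence of a Gaussian into the sum of a
  scalar convex function \<open>h\<close> with minimum \<open>h 1 = 0\<close> over the eigenvalues of the whitened covariance, plus a
  multiple of the squared norm of the whitened mean shift. The error of the proposed estimator is a linear function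
  \<open>W z\<close> with nominal covariance \<open>P\<close>, so maximizing its variance over the ball is a convex problem with
  multiplier \<open>1/\<theta>\<close>. In an eigenbasis of \<open>P\<close> the tangent inequality for \<open>h\<close>, weighted by squared entries of
  a coisometry (at most 1 in total for every whitened eigenvalue, by Bessel), shows that the maximum is attained when each
  eigenvalue \<open>p\<close> of \<open>P\<close> is scaled by \<open>t\<close> with \<open>h' t = \<theta> p\<close>; monotonicity of \<open>h\<close> on
  \<open>[1, \<infinity>)\<close> makes \<open>\<theta>\<close> unique. Against this Gaussian the estimator is optimal because the residual is
  symmetric about 0 for every value of the observation.\<close>

section \<open>Spectral theorem for symmetric matrices\<close>

text \<open>The whitened covariance of a competitor need not commute with anything nominal, so no
  eigenbasis serves both it and \<open>P\<close>; the weights in the tangent inequality stand in for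
  a common one. Solving \<open>h' t = \<theta> * p\<close> gives \<open>t = (1 - (1 - \<tau>) *
  \<theta> * p) powr (1 / (\<tau> - 1))\<close>, or \<open>exp (\<theta> * p)\<close> for
  \<open>\<tau> = 1\<close>. This is the origin of the new covariance \<open>V'\<close>, and the
  bound on \<theta> says that the equation is solvable for every eigenvalue. The function
  \<open>gamma_tau\<close> is the entropy spent on these scalings, so the equation for \<theta> says
  that the budget is exhausted. Directions of the whitened space that the error does not see keep
  eigenvalue 1, which costs nothing; therefore the law of the observation stays nominal and only the
  error covariance is inflated from \<open>P\<close> to \<open>V'\<close>. The exponential factor of
  the least favorable transition density is the quotient of the two Gaussians; it depends on
  \<open>z\<close> only, so it passes through the integral over the state.\<close>

lemma symmetric_map_eigenvector:
  fixes f :: "'a::euclidean_space \<Rightarrow> 'a"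
  assumes lin: "linear f" and sym: "\<And>x y. f x \<bullet> y = x \<bullet> f y"
    and S: "subspace S" "f ` S \<subseteq> S" and nz: "S \<noteq> {0}"
  obtains x \<mu> where "x \<in> S" "norm x = 1" "f x = \<mu> *\<^sub>R x"
proof -
  obtain v where v: "v \<in> S" "v \<noteq> 0"
    using nz S(1) subspace_0 by blast
  have "compact (S \<inter> sphere 0 1)"
    by (intro closed_Int_compact closed_subspace S(1) compact_sphere)
  moreover have "v /\<^sub>R norm v \<in> S \<inter> sphere 0 1"
    using v S(1) by (auto simp: subspace_scale)
  moreover have "continuous_on (S \<inter> sphere 0 1) (\<lambda>x. x \<bullet> f x)"
    using linear_continuous_on[of f] lin
    by (intro continuous_on_inner continuous_on_id) (simp add: linear_conv_bounded_linear)
  ultimately obtain x where x: "x \<in> S \<inter> sphere 0 1"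
    and max: "\<And>y. y \<in> S \<inter> sphere 0 1 \<Longrightarrow> y \<bullet> f y \<le> x \<bullet> f x"
    using continuous_attains_sup[of "S \<inter> sphere 0 1" "\<lambda>x. x \<bullet> f x"] by blast
  define \<mu> where "\<mu> = x \<bullet> f x"
  have x1: "x \<bullet> x = 1" using x by (simp add: norm_eq_1)
  \<comment> \<open>Homogeneity extends maximality from the unit sphere to \<open>S\<close>: \<mu>
    times the identity minus \<open>f\<close> is positive semidefinite on \<open>S\<close>.\<close>
  have psd: "\<mu> * (y \<bullet> y) - y \<bullet> f y \<ge> 0" if "y \<in> S" for y
  proof (cases "y = 0")
    case False
    have "(y /\<^sub>R norm y) \<bullet> f (y /\<^sub>R norm y) \<le> \<mu>"
      unfolding \<mu>_def using that False S(1) by (intro max) (auto simp: subspace_scale)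
    then have "(y \<bullet> f y) / (norm y)\<^sup>2 \<le> \<mu>"
      by (simp add: linear_cmul[OF lin] power2_eq_square divide_simps)
    then show ?thesis using False by (simp add: dot_square_norm field_simps)
  qed (simp add: linear_0[OF lin])
  define w where "w = f x - \<mu> *\<^sub>R x"
  have wS: "w \<in> S" unfolding w_def using x S by (auto intro!: subspace_diff subspace_scale)
  have xw: "x \<bullet> w = 0" unfolding w_def \<mu>_def using x1 by (simp add: inner_diff_right)
  have fxw: "x \<bullet> f w = w \<bullet> w"
    using xw sym[of x w] by (simp add: w_def inner_diff_left inner_diff_right inner_commute)
  define k where "k = \<mu> * (w \<bullet> w) - w \<bullet> f w"
  \<comment> \<open>The semidefinite form along the line \<open>x + t *\<^sub>R w\<close>. It
    vanishes at \<open>t = 0\<close>, so a nonzero linear term would make it negative for some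
    \<open>t\<close>.\<close>
  have q: "- 2 * t * (w \<bullet> w) + t\<^sup>2 * k \<ge> 0" for t
  proof -
    have "x + t *\<^sub>R w \<in> S" using x wS S(1) by (auto intro!: subspace_add subspace_scale)
    from psd[OF this] have "0 \<le> \<mu> * ((x + t *\<^sub>R w) \<bullet> (x + t *\<^sub>R w)) - (x + t *\<^sub>R w) \<bullet> f (x + t *\<^sub>R w)" .
    also have "(x + t *\<^sub>R w) \<bullet> (x + t *\<^sub>R w) = 1 + t\<^sup>2 * (w \<bullet> w)"
      using x1 xw by (simp add: inner_add_left inner_add_right inner_commute power2_eq_square)
    also have "(x + t *\<^sub>R w) \<bullet> f (x + t *\<^sub>R w) = \<mu> + 2 * t * (w \<bullet> w) + t\<^sup>2 * (w \<bullet> f w)"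
      using fxw sym[of x w] by (simp add: linear_add[OF lin] linear_cmul[OF lin] inner_add_left inner_add_right
          \<mu>_def power2_eq_square inner_commute)
    finally show ?thesis by (simp add: k_def algebra_simps)
  qed
  have "w \<bullet> w = 0"
  proof (rule ccontr)
    assume "w \<bullet> w \<noteq> 0"
    then have pos: "w \<bullet> w > 0" by simp
    show False
    proof (cases "k \<le> 0")
      case True
      then show ?thesis using q[of 1] pos by simp
    next
      case False
      \<comment> \<open>The parameter \<open>(w \<bullet> w) / k\<close> minimizes the quadratic in
        \<open>q\<close>.\<close>
      have "- 2 * ((w \<bullet> w) / k) * (w \<bullet> w) + ((w \<bullet> w) / k)\<^sup>2 * k = - ((w \<bullet> w)\<^sup>2 / k)"
        using False by (simp add: power2_eq_square field_simps)
      with q[of "(w \<bullet> w) / k"] have "(w \<bullet> w)\<^sup>2 / k \<le> 0" by simp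
      then show False using False pos by (simp add: divide_le_0_iff)
    qed
  qed
  then have "f x = \<mu> *\<^sub>R x" by (simp add: w_def)
  then show ?thesis using that x by auto
qed

text \<open>Induction on the dimension: the orthogonal complement of an eigenvector \<open>x\<close>
  inside \<open>S\<close> is again invariant, because
  \<open>x \<bullet> f y = f x \<bullet> y\<close> is a multiple of
  \<open>x \<bullet> y\<close>.\<close>

lemma symmetric_map_eigenbasis:
  fixes f :: "'a::euclidean_space \<Rightarrow> 'a"
  assumes lin: "linear f" and sym: "\<And>x y. f x \<bullet> y = x \<bullet> f y"
    and S: "subspace S" "f ` S \<subseteq> S"
  shows "\<exists>B. B \<subseteq> S \<and> S \<subseteq> span B \<and> pairwise orthogonal B
    \<and> (\<forall>b\<in>B. norm b = 1 \<and> (\<exists>\<mu>. f b = \<mu> *\<^sub>R b))"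
  using S
proof (induction "dim S" arbitrary: S rule: less_induct)
  case less
  show ?case
  proof (cases "S = {0}")
    case True
    then show ?thesis by (intro exI[of _ "{}"]) (auto simp: pairwise_def)
  next
    case False
    obtain x \<mu> where x: "x \<in> S" "norm x = 1" "f x = \<mu> *\<^sub>R x"
      using symmetric_map_eigenvector[OF lin sym less.prems False] by blast
    define T where "T = S \<inter> {y. x \<bullet> y = 0}"
    have xx: "x \<bullet> x = 1" using x by (simp add: norm_eq_1)
    have sT: "subspace T"
      unfolding T_def using less.prems(1) by (intro subspace_inter subspace_hyperplane)
    have "x \<notin> T" using xx by (simp add: T_def)
    then have "T \<subset> S" using x(1) by (auto simp only: T_def)
    then have "dim T < dim S"
      using sT less.prems(1) by (intro dim_psubset) (simp add: span_eq_iff[THEN iffD2])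
    moreover have "f ` T \<subseteq> T"
      using less.prems(2) sym[of x, symmetric] x(3) by (auto simp: T_def)
    ultimately obtain B where B: "B \<subseteq> T" "T \<subseteq> span B" "pairwise orthogonal B"
      "\<forall>b\<in>B. norm b = 1 \<and> (\<exists>\<mu>. f b = \<mu> *\<^sub>R b)"
      using less.hyps[OF _ sT] by blast
    have "S \<subseteq> span (insert x B)"
    proof
      fix y assume y: "y \<in> S"
      have "y - (x \<bullet> y) *\<^sub>R x \<in> T"
        using y x less.prems(1) xx by (auto simp: T_def subspace_diff subspace_scale inner_diff_right)
      then show "y \<in> span (insert x B)"
        using B(2) by (subst span_insert) blast
    qed
    moreover have "pairwise orthogonal (insert x B)"
      using B(1,3) by (auto simp: pairwise_insert T_def orthogonal_def inner_commute)
    ultimately show ?thesis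
      using B x by (intro exI[of _ "insert x B"]) (auto simp: T_def)
  qed
qed

lemma symmetric_inner_mult:
  fixes S :: "real^'n^'n"
  assumes "transpose S = S"
  shows "(S *v x) \<bullet> y = x \<bullet> (S *v y)"
  by (metis assms dot_lmul_matrix vector_transpose_matrix)

lemma symmetric_diagonalization:
  fixes S :: "real^'n::finite^'n"
  assumes sym: "transpose S = S"
  obtains Q d where "orthogonal_matrix Q" "S = Q ** diag_mat d ** transpose Q"
proof -
  obtain B where B: "UNIV \<subseteq> span B" "pairwise orthogonal B"
      "\<And>b. b \<in> B \<Longrightarrow> norm b = 1" "\<And>b. b \<in> B \<Longrightarrow> \<exists>\<mu>. S *v b = \<mu> *\<^sub>R b"
    using symmetric_map_eigenbasis[of "(*v) S" UNIV, OF matrix_vector_mul_linear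
        symmetric_inner_mult[OF sym] subspace_UNIV subset_UNIV] by blast
  have ind: "independent B"
    using B(2) B(3)[of 0] by (intro pairwise_orthogonal_independent) auto
  have "card B = dim (UNIV :: (real^'n) set)"
    using B(1) ind by (intro dim_eq_card[symmetric]) auto
  then have card: "card B = CARD('n)" by (simp add: dim_UNIV)
  have fin: "finite B" using ind by (rule finiteI_independent)
  obtain b where b: "bij_betw b (UNIV :: 'n set) B"
    using finite_same_card_bij[OF finite[of UNIV] fin] card by auto
  have bB: "b i \<in> B" for i using b by (auto simp: bij_betw_def)
  then have "\<forall>i. \<exists>\<mu>. S *v b i = \<mu> *\<^sub>R b i" using B(4) by blast
  then obtain d where d: "\<And>i. S *v b i = d i *\<^sub>R b i" using choice[of "\<lambda>i \<mu>. S *v b i = \<mu> *\<^sub>R b i"] by blast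
  define Q :: "real^'n^'n" where "Q = (\<chi> i j. b j $ i)"
  have "b i \<bullet> b j = (if i = j then 1 else 0)" for i j
  proof (cases "i = j")
    case True
    then show ?thesis using B(3)[OF bB] by (simp add: norm_eq_1)
  next
    case False
    then have "b i \<noteq> b j" using b by (auto simp: bij_betw_def dest: injD)
    then show ?thesis using B(2) bB False by (auto simp: pairwise_def orthogonal_def)
  qed
  then have QQ: "transpose Q ** Q = mat 1"
    by (simp add: matrix_matrix_mult_def transpose_def mat_def Q_def vec_eq_iff inner_vec_def)
  then have QQ': "Q ** transpose Q = mat 1" using matrix_left_right_inverse by blast
  have "S ** Q = Q ** diag_mat (\<chi> i. d i)"
  proof -
    have "(S ** Q) $ i $ j = (S *v b j) $ i" for i j
      by (simp add: matrix_matrix_mult_def matrix_vector_mult_def Q_def)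
    then show ?thesis by (simp add: vec_eq_iff mat_mult_diag d Q_def mult.commute)
  qed
  then have "S ** (Q ** transpose Q) = Q ** diag_mat (\<chi> i. d i) ** transpose Q"
    by (simp add: matrix_mul_assoc)
  then have "S = Q ** diag_mat (\<chi> i. d i) ** transpose Q"
    by (simp add: QQ')
  with QQ QQ' that show ?thesis by (auto simp: orthogonal_matrix_def)
qed

section \<open>Positive definite matrices\<close>

lemma matrix_inv_right:
  fixes A :: "real^'n::finite^'n"
  assumes "invertible A"
  shows "A ** matrix_inv A = mat 1"
  using assms unfolding invertible_def matrix_inv_def by (rule someI2_ex) blast

lemma matrix_inv_left:
  fixes A :: "real^'n::finite^'n"
  assumes "invertible A"
  shows "matrix_inv A ** A = mat 1"
  using assms unfolding invertible_def matrix_inv_def by (rule someI2_ex) blast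

lemma matrix_mul_diff_left: "(A - B) ** C = A ** C - B ** (C :: real^'k::finite^'m::finite)"
  by (simp add: matrix_matrix_mult_def vec_eq_iff left_diff_distrib sum_subtractf)

lemma matrix_mul_diff_right: "C ** (A - B) = C ** A - C ** (B :: real^'k::finite^'m::finite)"
  by (simp add: matrix_matrix_mult_def vec_eq_iff right_diff_distrib sum_subtractf)

lemma matrix_mul_add_left: "(A + B) ** C = A ** C + B ** (C :: real^'k::finite^'m::finite)"
  by (simp add: matrix_matrix_mult_def vec_eq_iff distrib_right sum.distrib)

lemmas matrix_mul_add_right = matrix_add_ldistrib

lemma transpose_add: "transpose (A + B) = transpose A + transpose (B :: real^'k::finite^'m::finite)"
  by (simp add: transpose_def vec_eq_iff)

lemma inner_mult_transpose:
  fixes A :: "real^'n::finite^'m::finite"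
  shows "x \<bullet> (A *v y) = (transpose A *v x) \<bullet> y"
  by (simp add: dot_lmul_matrix)

lemma matrix_inv_unique_right:
  fixes A :: "real^'n::finite^'n"
  assumes "A ** B = mat 1"
  shows "matrix_inv A = B"
proof -
  have BA: "B ** A = mat 1" using assms matrix_left_right_inverse by blast
  then have "invertible A" using assms unfolding invertible_def by blast
  then have "(B ** A) ** matrix_inv A = B"
    by (simp add: matrix_inv_right matrix_mul_assoc[symmetric])
  then show ?thesis by (simp add: BA)
qed

lemma invertible_transpose_mult:
  fixes L :: "real^'n::finite^'n"
  assumes "invertible (L ** transpose L)"
  shows "invertible L"
  using assms by (metis det_mul invertible_det_nz mult_zero_left)

lemma pos_def_invertible: "pos_def (K :: real^'n::finite^'n) \<Longrightarrow> invertible K"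
  unfolding invertible_left_inverse matrix_left_invertible_ker pos_def_def by fastforce

section \<open>Orthogonal conjugation of diagonal matrices\<close>

lemma orthogonal_cancel:
  fixes Q :: "real^'n::finite^'n"
  assumes "orthogonal_matrix Q"
  shows "transpose Q ** Q = mat 1" "Q ** transpose Q = mat 1"
    "A ** Q ** transpose Q = (A :: real^'n^'m::finite)" "B ** transpose Q ** Q = (B :: real^'n^'m)"
  using assms by (auto simp: orthogonal_matrix_def matrix_mul_assoc[symmetric])

lemma diag_mat_mult: "diag_mat d ** diag_mat e = diag_mat (\<chi> i. d $ i * e $ i)"
  by (simp add: vec_eq_iff mat_mult_diag) (simp add: diag_mat_def)

lemma diag_mat_vector: "(diag_mat d *v x) $ i = d $ i * x $ i"
  by (simp add: matrix_vector_mult_def diag_mat_def if_distrib if_distribR cong: if_cong)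

lemma transpose_diag_mat [simp]: "transpose (diag_mat d) = diag_mat d"
  by (auto simp: transpose_def diag_mat_def vec_eq_iff)

lemma diag_mat_1: "diag_mat (\<chi> i. 1) = mat 1"
  by (simp add: diag_mat_def mat_def vec_eq_iff)

lemma det_diag_mat: "det (diag_mat d) = (\<Prod>i\<in>UNIV. d $ i)"
  by (subst det_diagonal) (auto simp: diag_mat_def)

lemma trace_diag_mat: "trace (diag_mat d) = (\<Sum>i\<in>UNIV. d $ i)"
  by (simp add: trace_def diag_mat_def)

lemma orthogonal_conj_mult:
  assumes "orthogonal_matrix Q"
  shows "(Q ** A ** transpose Q) ** (Q ** B ** transpose Q) = Q ** (A ** B) ** transpose (Q :: real^'n::finite^'n)"
  by (simp add: matrix_mul_assoc orthogonal_cancel[OF assms])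

lemma trace_orthogonal_conj:
  assumes "orthogonal_matrix Q"
  shows "trace (Q ** A ** transpose Q) = trace (A :: real^'n::finite^'n)"
  by (subst trace_mul_sym) (simp add: matrix_mul_assoc orthogonal_cancel[OF assms])

lemma det_orthogonal_conj:
  assumes "orthogonal_matrix Q"
  shows "det (Q ** A ** transpose Q) = det (A :: real^'n::finite^'n)"
proof -
  have "det Q * det (transpose Q) = 1"
    using orthogonal_cancel(2)[OF assms] by (metis det_I det_mul)
  then show ?thesis by (simp add: det_mul)
qed

lemma symmetric_orthogonal_diag: "transpose (Q ** diag_mat d ** transpose Q) = Q ** diag_mat d ** transpose Q"
  by (simp add: matrix_transpose_mul matrix_mul_assoc)

lemma orthogonal_diag_quadratic:
  "x \<bullet> ((Q ** diag_mat d ** transpose Q) *v x) = (\<Sum>i\<in>UNIV. d $ i * ((transpose Q *v x) $ i)\<^sup>2)"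
proof -
  have "x \<bullet> ((Q ** diag_mat d ** transpose Q) *v x) = x \<bullet> (Q *v (diag_mat d *v (transpose Q *v x)))"
    by (simp add: matrix_vector_mul_assoc matrix_mul_assoc del: transpose_matrix_vector)
  also have "\<dots> = (transpose Q *v x) \<bullet> (diag_mat d *v (transpose Q *v x))"
    by (rule inner_mult_transpose)
  finally show ?thesis
    by (simp add: inner_vec_def diag_mat_vector power2_eq_square mult_ac)
qed

lemma pos_def_orthogonal_diag:
  assumes Q: "orthogonal_matrix Q" and d: "\<And>i. d $ i > 0"
  shows "pos_def (Q ** diag_mat d ** transpose Q)"
  unfolding pos_def_def
proof (intro conjI allI impI symmetric_orthogonal_diag)
  fix x :: "real^'a" assume x: "x \<noteq> 0"
  have "transpose Q *v x \<noteq> 0"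
  proof
    assume "transpose Q *v x = 0"
    then have "(Q ** transpose Q) *v x = 0"
      by (metis matrix_vector_mul_assoc matrix_vector_mult_0_right)
    then show False using x orthogonal_cancel(2)[OF Q] by simp
  qed
  then obtain i where "(transpose Q *v x) $ i \<noteq> 0" by (auto simp: vec_eq_iff)
  then show "0 < x \<bullet> ((Q ** diag_mat d ** transpose Q) *v x)"
    unfolding orthogonal_diag_quadratic using d
    by (intro sum_pos2[of _ i]) (auto simp: less_imp_le)
qed

lemma pos_def_orthogonal_diag_pos:
  assumes "pos_def (Q ** diag_mat d ** transpose Q)" "orthogonal_matrix Q"
  shows "d $ i > 0"
proof -
  \<comment> \<open>Testing with the eigenvector for the index \<open>i\<close> isolates
    \<open>d $ i\<close>.\<close>
  define v where "v = Q *v axis i 1"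
  have tv: "transpose Q *v v = axis i 1"
    unfolding v_def using orthogonal_cancel(1)[OF assms(2)]
    by (simp add: matrix_vector_mul_assoc del: transpose_matrix_vector)
  then have "v \<noteq> 0" by (metis axis_eq_0_iff matrix_vector_mult_0_right zero_neq_one)
  then have "0 < v \<bullet> ((Q ** diag_mat d ** transpose Q) *v v)" using assms by (simp add: pos_def_def)
  also have "\<dots> = (\<Sum>k\<in>UNIV. if k = i then d $ i else 0)"
    unfolding orthogonal_diag_quadratic tv by (intro sum.cong) (auto simp: axis_def)
  finally show ?thesis by simp
qed

lemma pos_def_diagonalization:
  fixes K :: "real^'n::finite^'n"
  assumes "pos_def K"
  obtains Q d where "orthogonal_matrix Q" "K = Q ** diag_mat d ** transpose Q" "\<And>i. d $ i > 0"
proof -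
  obtain Q d where Q: "orthogonal_matrix Q" and K: "K = Q ** diag_mat d ** transpose Q"
    using symmetric_diagonalization[of K] assms unfolding pos_def_def by blast
  with assms that pos_def_orthogonal_diag_pos show ?thesis by blast
qed

text \<open>A factor of this shape, orthogonal times positive diagonal, suits the change of
  variables in \<open>nn_integral_gauss_affine\<close>: each of the two maps has its own
  substitution rule.\<close>

lemma pos_def_diag_factor:
  fixes K :: "real^'n::finite^'n"
  assumes "pos_def K"
  obtains Q d where "orthogonal_matrix Q" "\<And>i. d $ i > 0"
    "K = (Q ** diag_mat d) ** transpose (Q ** diag_mat d)"
proof -
  obtain Q e where Q: "orthogonal_matrix Q" "K = Q ** diag_mat e ** transpose Q" "\<And>i. e $ i > 0"
    using pos_def_diagonalization[OF assms] by blast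
  have "diag_mat e = diag_mat (\<chi> i. sqrt (e $ i)) ** diag_mat (\<chi> i. sqrt (e $ i))"
    unfolding diag_mat_mult using Q(3) by (simp add: vec_eq_iff diag_mat_def less_imp_le)
  then have "K = (Q ** diag_mat (\<chi> i. sqrt (e $ i))) ** transpose (Q ** diag_mat (\<chi> i. sqrt (e $ i)))"
    using Q(2) by (simp add: matrix_transpose_mul matrix_mul_assoc)
  with Q that[of Q "\<chi> i. sqrt (e $ i)"] show ?thesis by simp
qed

lemma square_factor:
  fixes K :: "real^'n::finite^'n"
  assumes "pos_def K"
  shows "K = square_factor K ** transpose (square_factor K)" "invertible (square_factor K)"
proof -
  show K: "K = square_factor K ** transpose (square_factor K)"
    unfolding square_factor_def by (rule someI_ex, rule pos_def_diag_factor[OF assms]) blast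
  show "invertible (square_factor K)"
    using pos_def_invertible[OF assms] K by (metis invertible_transpose_mult)
qed

text \<open>\<open>W\<close> may be rectangular. With the error map or the projection to the
  observation as \<open>W\<close>, this yields definiteness of the error and observation
  covariances.\<close>

lemma pos_def_congruence:
  fixes K :: "real^'m::finite^'m" and W :: "real^'m^'n::finite"
  assumes "pos_def K" and inj: "\<And>x. transpose W *v x = 0 \<Longrightarrow> x = 0"
  shows "pos_def (W ** K ** transpose W)"
  unfolding pos_def_def
proof (intro conjI allI impI)
  show "transpose (W ** K ** transpose W) = W ** K ** transpose W"
    using assms(1) by (simp add: pos_def_def matrix_transpose_mul matrix_mul_assoc)
  fix x :: "real^'n" assume "x \<noteq> 0"
  then have "0 < (transpose W *v x) \<bullet> (K *v (transpose W *v x))"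
    using assms by (metis pos_def_def)
  also have "\<dots> = x \<bullet> (W *v (K *v (transpose W *v x)))" by (simp only: inner_mult_transpose)
  also have "\<dots> = x \<bullet> ((W ** K ** transpose W) *v x)"
    by (simp only: matrix_vector_mul_assoc matrix_mul_assoc)
  finally show "0 < x \<bullet> ((W ** K ** transpose W) *v x)" .
qed

lemma pos_def_mat_1: "pos_def (mat 1 :: real^'n::finite^'n)"
  by (simp add: pos_def_def)

lemma invertible_transpose: "invertible A \<Longrightarrow> invertible (transpose (A :: real^'n::finite^'n))"
  by (simp add: invertible_det_nz)

lemma invertible_mult_vec_eq_0:
  fixes A :: "real^'n::finite^'n"
  assumes "invertible A" "A *v x = 0"
  shows "x = 0"
proof -
  have "matrix_inv A *v (A *v x) = x"
    by (simp only: matrix_vector_mul_assoc matrix_inv_left[OF assms(1)] matrix_vector_mul_lid)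
  then show ?thesis using assms(2) by simp
qed

lemma pos_def_mult_transpose:
  fixes L :: "real^'n::finite^'n"
  assumes "invertible L"
  shows "pos_def (L ** transpose L)"
  using pos_def_congruence[OF pos_def_mat_1, of L]
    invertible_mult_vec_eq_0[OF invertible_transpose[OF assms]] by simp

lemma matrix_inv_orthogonal_diag:
  assumes Q: "orthogonal_matrix (Q :: real^'n::finite^'n)" and d: "\<And>i. d $ i \<noteq> 0"
  shows "matrix_inv (Q ** diag_mat d ** transpose Q) = Q ** diag_mat (\<chi> i. inverse (d $ i)) ** transpose Q"
  using d by (intro matrix_inv_unique_right)
    (simp add: orthogonal_conj_mult[OF Q] diag_mat_mult diag_mat_1 orthogonal_cancel[OF Q])

lemma pos_def_matrix_inv:
  fixes K :: "real^'n::finite^'n"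
  assumes "pos_def K"
  shows "pos_def (matrix_inv K)"
proof -
  obtain Q d where *: "orthogonal_matrix Q" "K = Q ** diag_mat d ** transpose Q" "\<And>i. d $ i > 0"
    using pos_def_diagonalization[OF assms] by blast
  then have "matrix_inv K = Q ** diag_mat (\<chi> i. inverse (d $ i)) ** transpose Q"
    using matrix_inv_orthogonal_diag[OF *(1)] by (metis less_numeral_extra(3))
  with * show ?thesis by (simp add: pos_def_orthogonal_diag)
qed

lemma pos_def_det: "pos_def (K :: real^'n::finite^'n) \<Longrightarrow> det K > 0"
  using pos_def_diagonalization[of K] det_orthogonal_conj det_diag_mat
  by (metis (no_types, lifting) prod_pos)

lemma measurable_matrix_vector_mult [measurable]:
  fixes A :: "real^'n::finite^'m::finite"
  shows "(\<lambda>x. A *v x) \<in> borel_measurable borel"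
  by (intro borel_measurable_continuous_onI linear_continuous_on matrix_vector_mul_bounded_linear)

section \<open>Gaussian integrals\<close>

lemma measurable_vec_nth [measurable]: "(\<lambda>x::real^'n::finite. x $ i) \<in> borel_measurable borel"
  by (intro borel_measurable_continuous_onI continuous_intros)

text \<open>Lebesgue measure on \<open>real^'n\<close> is the image of a product measure indexed by
  the standard basis; the bijection between indices and basis vectors turns products over
  coordinates into products over that basis, where Fubini applies.\<close>

lemma has_bochner_integral_prod_components:
  fixes f :: "'n::finite \<Rightarrow> real \<Rightarrow> real"
  assumes "\<And>i. integrable lborel (f i)"
  shows "has_bochner_integral lborel (\<lambda>w::real^'n. \<Prod>i\<in>UNIV. f i (w $ i)) (\<Prod>i\<in>UNIV. integral\<^sup>L lborel (f i))"
proof -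
  interpret product_sigma_finite "\<lambda>_::real^'n. lborel :: real measure" by standard
  let ?T = "\<lambda>g. \<Sum>b\<in>(Basis :: (real^'n) set). g b *\<^sub>R b"
  let ?P = "\<Pi>\<^sub>M b\<in>(Basis :: (real^'n) set). (lborel :: real measure)"
  have bij: "bij_betw (\<lambda>i. axis i 1) (UNIV :: 'n set) (Basis :: (real^'n) set)"
    by (auto simp: bij_betw_def inj_on_def axis_eq_axis Basis_vec_def)
  have ai: "axis_index (axis i 1 :: real^'n) = i" for i
    using axis_index[of "axis i 1 :: real^'n"] by (simp add: axis_eq_axis)
  have T: "?T g $ i = g (axis i 1)" for g i
  proof -
    have "?T g $ i = ?T g \<bullet> axis i 1" by (simp add: inner_axis)
    also have "\<dots> = g (axis i 1)" by (subst inner_sum_left_Basis) auto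
    finally show ?thesis .
  qed
  have re: "(\<Prod>b\<in>(Basis :: (real^'n) set). h b) = (\<Prod>i\<in>UNIV. h (axis i 1))" for h :: "_ \<Rightarrow> real"
    using prod.reindex_bij_betw[OF bij, of h] by simp
  have fm: "f i \<in> borel_measurable borel" for i using assms[of i] by auto
  have meas: "(\<lambda>w::real^'n. \<Prod>i\<in>UNIV. f i (w $ i)) \<in> borel_measurable borel"
    using fm by (intro borel_measurable_prod measurable_compose[OF measurable_vec_nth]) auto
  have Tm: "?T \<in> measurable ?P borel" by simp
  have eq: "(\<Prod>i\<in>UNIV. f i (?T g $ i)) = (\<Prod>b\<in>Basis. f (axis_index b) (g b))" for g
    by (simp only: re T ai)
  have "integrable ?P (\<lambda>g. \<Prod>b\<in>Basis. f (axis_index b) (g b))"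
    using assms by (intro product_integrable_prod) auto
  moreover have "(\<integral>g. (\<Prod>b\<in>Basis. f (axis_index b) (g b)) \<partial>?P) = (\<Prod>i\<in>UNIV. integral\<^sup>L lborel (f i))"
    using assms by (subst product_integral_prod) (auto simp: re ai)
  ultimately have "has_bochner_integral ?P (\<lambda>g. \<Prod>i\<in>UNIV. f i (?T g $ i)) (\<Prod>i\<in>UNIV. integral\<^sup>L lborel (f i))"
    unfolding eq has_bochner_integral_iff by blast
  then have "has_bochner_integral (distr ?P borel ?T) (\<lambda>w. \<Prod>i\<in>UNIV. f i (w $ i)) (\<Prod>i\<in>UNIV. integral\<^sup>L lborel (f i))"
    unfolding has_bochner_integral_iff integrable_distr_eq[OF Tm meas] integral_distr[OF Tm meas] .
  then show ?thesis by (simp only: lborel_eq[symmetric])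
qed

abbreviation std_gauss :: "real^'n::finite \<Rightarrow> real" where
  "std_gauss \<equiv> gauss_density 0 (mat 1)"

lemma std_gauss_prod: "std_gauss (w :: real^'n::finite) = (\<Prod>i\<in>UNIV. std_normal_density (w $ i))"
proof -
  have "matrix_inv (mat 1 :: real^'n^'n) = mat 1" by (rule matrix_inv_unique_right) simp
  then have "std_gauss w = exp (\<Sum>i\<in>UNIV. - (w $ i)\<^sup>2 / 2) / sqrt (2 * pi) ^ CARD('n)"
    by (simp add: gauss_density_def inner_vec_def power2_eq_square sum_negf sum_divide_distrib
        real_sqrt_power[symmetric] del: power_mult_distrib)
  also have "\<dots> = (\<Prod>i\<in>UNIV. std_normal_density (w $ i))"
    by (simp add: std_normal_density_def exp_sum prod_dividef prod_constant)
  finally show ?thesis .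
qed

lemma std_gauss_pos: "std_gauss w > 0"
  unfolding std_gauss_prod by (intro prod_pos normal_density_pos) simp

text \<open>Density and monomial both factor over the coordinates, so every moment is a product of
  one-dimensional ones.\<close>

lemma std_gauss_moment:
  fixes a :: "'n::finite \<Rightarrow> nat"
  shows "has_bochner_integral lborel (\<lambda>w::real^'n. std_gauss w * (\<Prod>i\<in>UNIV. w $ i ^ a i))
    (\<Prod>i\<in>UNIV. LINT x|lborel. std_normal_density x * x ^ a i)"
  unfolding std_gauss_prod prod.distrib[symmetric]
  by (rule has_bochner_integral_prod_components[of "\<lambda>i x. std_normal_density x * x ^ a i"])
    (rule integrable_std_normal_moment)

lemma std_normal_moments_012:
  "(LINT x|lborel. std_normal_density x) = 1"
  "(LINT x|lborel. std_normal_density x * x) = 0"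
  "(LINT x|lborel. std_normal_density x * x\<^sup>2) = 1"
  using integral_std_normal_moment_even[of 0] integral_std_normal_moment_even[of 1]
    integral_std_normal_moment_odd[of 0] by simp_all

lemma std_gauss_moment_0: "has_bochner_integral lborel (std_gauss :: real^'n::finite \<Rightarrow> real) 1"
  using std_gauss_moment[of "\<lambda>_::'n. 0"] by (simp add: std_normal_moments_012)

lemma std_gauss_moment_1: "has_bochner_integral lborel (\<lambda>w::real^'n::finite. std_gauss w * w $ k) 0"
proof -
  have "(\<Prod>i\<in>UNIV. w $ i ^ (if i = k then 1 else 0)) = w $ k" for w :: "real^'n"
    by (simp add: if_distrib prod.delta cong: if_cong)
  then have "has_bochner_integral lborel (\<lambda>w::real^'n. std_gauss w * w $ k)
    (\<Prod>i\<in>UNIV. LINT x|lborel. std_normal_density x * x ^ (if i = k then 1 else 0))"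
    using std_gauss_moment[of "\<lambda>i. if i = k then 1 else 0"] by simp
  moreover have "(\<Prod>i\<in>UNIV. LINT x|lborel. std_normal_density x * x ^ (if i = k then 1 else 0)) = 0"
    by (rule prod_zero) (auto intro!: bexI[of _ k] simp: std_normal_moments_012)
  ultimately show ?thesis by simp
qed

lemma std_gauss_moment_2:
  "has_bochner_integral lborel (\<lambda>w::real^'n::finite. std_gauss w * (w $ k * w $ l)) (if k = l then 1 else 0)"
proof -
  \<comment> \<open>Exponents of the monomial \<open>w $ k * w $ l\<close>; the two indicators add
    up to 2 when \<open>k = l\<close>.\<close>
  let ?a = "\<lambda>i. (if i = k then 1 else 0) + (if i = l then 1 else 0) :: nat"
  have "(\<Prod>i\<in>UNIV. w $ i ^ ?a i) = w $ k * w $ l" for w :: "real^'n"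
    unfolding power_add prod.distrib
    by (simp add: if_distrib prod.delta cong: if_cong)
  then have "has_bochner_integral lborel (\<lambda>w::real^'n. std_gauss w * (w $ k * w $ l))
    (\<Prod>i\<in>UNIV. LINT x|lborel. std_normal_density x * x ^ ?a i)"
    using std_gauss_moment[of ?a] by simp
  moreover have "(\<Prod>i\<in>UNIV. LINT x|lborel. std_normal_density x * x ^ ?a i) = (if k = l then 1 else 0)"
  proof (cases "k = l")
    case True
    then show ?thesis
      by (intro trans[OF prod.neutral]) (auto simp: std_normal_moments_012 power2_eq_square[symmetric])
  next
    case False
    then show ?thesis
      using std_normal_moments_012
      by (intro trans[OF prod_zero]) (auto intro!: bexI[of _ k])
  qed
  ultimately show ?thesis by simp
qed

section \<open>Substitutions in Lebesgue integrals: translations, orthogonal maps, positive diagonal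
  maps\<close>

lemma sigma_finite_lborel_pair: "pair_sigma_finite (lborel :: 'a::euclidean_space measure) (lborel :: 'b::euclidean_space measure)"
  by (intro pair_sigma_finite.intro sigma_finite_lborel)

lemma nn_integral_lborel_swap:
  fixes f :: "'a::euclidean_space \<Rightarrow> 'b::euclidean_space \<Rightarrow> ennreal"
  assumes "(\<lambda>(x, y). f x y) \<in> borel_measurable (borel \<Otimes>\<^sub>M borel)"
  shows "(\<integral>\<^sup>+x. \<integral>\<^sup>+y. f x y \<partial>lborel \<partial>lborel) = (\<integral>\<^sup>+y. \<integral>\<^sup>+x. f x y \<partial>lborel \<partial>lborel)"
proof -
  have "(\<lambda>(x, y). f x y) \<in> borel_measurable (lborel \<Otimes>\<^sub>M lborel)"
    using assms by (simp cong: measurable_cong_sets add: sets_pair_measure_cong[OF sets_lborel sets_lborel])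
  from pair_sigma_finite.Fubini'[OF sigma_finite_lborel_pair this] show ?thesis by simp
qed

lemma nn_integral_lborel_shift:
  fixes f :: "'a::euclidean_space \<Rightarrow> ennreal"
  assumes [measurable]: "f \<in> borel_measurable borel"
  shows "(\<integral>\<^sup>+x. f (t + x) \<partial>lborel) = (\<integral>\<^sup>+x. f x \<partial>lborel)"
proof -
  have "(\<integral>\<^sup>+x. f x \<partial>lborel) = (\<integral>\<^sup>+x. f x \<partial>distr lborel borel ((+) t))"
    using lborel_distr_plus[of t] by simp
  also have "\<dots> = (\<integral>\<^sup>+x. f (t + x) \<partial>lborel)" by (rule nn_integral_distr) auto
  finally show ?thesis ..
qed

lemma norm_orthogonal_mult:
  fixes Q :: "real^'n::finite^'n"
  assumes "orthogonal_matrix Q"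
  shows "norm (Q *v x) = norm x"
proof -
  have "(Q *v x) \<bullet> (Q *v x) = (transpose Q *v (Q *v x)) \<bullet> x" by (rule inner_mult_transpose)
  also have "\<dots> = x \<bullet> x"
    by (simp only: matrix_vector_mul_assoc orthogonal_cancel[OF assms] matrix_vector_mul_lid)
  finally show ?thesis by (simp add: norm_eq_sqrt_inner)
qed

text \<open>Both sides are translation invariant in \<open>f\<close>, and Tonelli applied to \<open>f (Q x + y) g y\<close>
  shows that they are proportional; for \<open>g\<close> the indicator of the unit ball the factor is 1.
  The library's change of variables needs a well-ordered index type, which sum types lack.\<close>

lemma nn_integral_lborel_orthogonal:
  fixes Q :: "real^'n::finite^'n" and f :: "real^'n \<Rightarrow> ennreal"
  assumes Q: "orthogonal_matrix Q" and [measurable]: "f \<in> borel_measurable borel"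
  shows "(\<integral>\<^sup>+x. f (Q *v x) \<partial>lborel) = (\<integral>\<^sup>+x. f x \<partial>lborel)"
proof -
  define g :: "real^'n \<Rightarrow> ennreal" where "g = indicator (ball 0 1)"
  have [measurable]: "g \<in> borel_measurable borel"
    unfolding g_def by (intro borel_measurable_indicator) simp
  define v where "v = emeasure lborel (ball (0 :: real^'n) 1)"
  have vball: "emeasure lborel (ball (y :: real^'n) 1) = v" for y
    using emeasure_lborel_ball_finite emeasure_ball[of 1 y] emeasure_ball[of 1 "0 :: real^'n"]
    by (simp add: v_def)
  have v: "v \<noteq> 0" "v \<noteq> \<infinity>"
    using emeasure_lborel_ball_finite[of "0 :: real^'n" 1]
    by (auto simp: v_def emeasure_ball less_top[symmetric] unit_ball_vol_pos[THEN less_imp_neq, symmetric])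
  have "(\<integral>\<^sup>+x. f (Q *v x) \<partial>lborel) * v = (\<integral>\<^sup>+x. f (Q *v x) \<partial>lborel) * (\<integral>\<^sup>+y. g y \<partial>lborel)"
    by (simp add: g_def v_def)
  also have "\<dots> = (\<integral>\<^sup>+y. (\<integral>\<^sup>+x. f (Q *v x) \<partial>lborel) * g y \<partial>lborel)"
    by (simp add: nn_integral_cmult)
  \<comment> \<open>Translation invariance absorbs \<open>y\<close>, since
    \<open>Q *v x + y = Q *v (transpose Q *v y + x)\<close>.\<close>
  also have "\<dots> = (\<integral>\<^sup>+y. (\<integral>\<^sup>+x. f (Q *v x + y) * g y \<partial>lborel) \<partial>lborel)"
  proof (rule nn_integral_cong)
    fix y :: "real^'n"
    have "(\<integral>\<^sup>+x. f (Q *v x + y) \<partial>lborel) = (\<integral>\<^sup>+x. f (Q *v ((transpose Q *v y) + x)) \<partial>lborel)"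
      by (simp only: matrix_vector_right_distrib matrix_vector_mul_assoc orthogonal_cancel[OF Q]
          matrix_vector_mul_lid add.commute)
    also have "\<dots> = (\<integral>\<^sup>+x. f (Q *v x) \<partial>lborel)"
      by (rule nn_integral_lborel_shift[of "\<lambda>x. f (Q *v x)"]) measurable
    finally show "(\<integral>\<^sup>+x. f (Q *v x) \<partial>lborel) * g y = (\<integral>\<^sup>+x. f (Q *v x + y) * g y \<partial>lborel)"
      by (simp add: nn_integral_multc)
  qed
  also have "\<dots> = (\<integral>\<^sup>+x. (\<integral>\<^sup>+y. f (Q *v x + y) * g y \<partial>lborel) \<partial>lborel)"
    by (rule nn_integral_lborel_swap) measurable
  also have "\<dots> = (\<integral>\<^sup>+x. (\<integral>\<^sup>+y. f y * g (y - Q *v x) \<partial>lborel) \<partial>lborel)"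
  proof (rule nn_integral_cong)
    fix x
    have "(\<integral>\<^sup>+y. (\<lambda>y. f y * g (y - Q *v x)) (Q *v x + y) \<partial>lborel) = (\<integral>\<^sup>+y. f y * g (y - Q *v x) \<partial>lborel)"
      by (rule nn_integral_lborel_shift) measurable
    then show "(\<integral>\<^sup>+y. f (Q *v x + y) * g y \<partial>lborel) = (\<integral>\<^sup>+y. f y * g (y - Q *v x) \<partial>lborel)" by simp
  qed
  also have "\<dots> = (\<integral>\<^sup>+y. (\<integral>\<^sup>+x. f y * g (y - Q *v x) \<partial>lborel) \<partial>lborel)"
    by (rule nn_integral_lborel_swap) measurable
  also have "\<dots> = (\<integral>\<^sup>+y. f y * v \<partial>lborel)"
  proof (rule nn_integral_cong)
    fix y
    \<comment> \<open>A rotation maps balls to balls: the integral over \<open>x\<close> is the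
      volume of the unit ball around \<open>transpose Q *v y\<close>, the same for every
      \<open>y\<close>.\<close>
    have "norm (y - Q *v x) = norm (transpose Q *v y - x)" for x
    proof -
      have "y - Q *v x = Q *v (transpose Q *v y - x)"
        by (simp only: matrix_vector_mult_diff_distrib matrix_vector_mul_assoc orthogonal_cancel[OF Q] matrix_vector_mul_lid)
      then show ?thesis using norm_orthogonal_mult[OF Q] by simp
    qed
    then have "g (y - Q *v x) = indicator (ball (transpose Q *v y) 1) x" for x
      using norm_minus_commute[of "Q *v x" y] by (simp add: g_def indicator_def dist_norm)
    then have "(\<integral>\<^sup>+x. g (y - Q *v x) \<partial>lborel) = v" using vball[of "transpose Q *v y"] by simp
    then show "(\<integral>\<^sup>+x. f y * g (y - Q *v x) \<partial>lborel) = f y * v" by (simp add: nn_integral_cmult)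
  qed
  also have "\<dots> = (\<integral>\<^sup>+y. f y \<partial>lborel) * v" by (simp add: nn_integral_multc)
  finally show ?thesis using v by (simp add: ennreal_mult_cancel_left mult.commute[of _ v])
qed

text \<open>The scaling rule for Lebesgue measure is phrased over basis vectors;
  \<open>axis_index\<close> reads off the matching diagonal entry.\<close>

lemma nn_integral_lborel_diag:
  fixes f :: "real^'n::finite \<Rightarrow> ennreal"
  assumes d: "\<And>i. d $ i > 0" and [measurable]: "f \<in> borel_measurable borel"
  shows "(\<integral>\<^sup>+x. f x \<partial>lborel) = (\<integral>\<^sup>+x. ennreal (\<Prod>i\<in>UNIV. d $ i) * f (diag_mat d *v x) \<partial>lborel)"
proof -
  let ?c = "\<lambda>j :: real^'n. d $ axis_index j"
  have bij: "bij_betw (\<lambda>i. axis i 1) (UNIV :: 'n set) (Basis :: (real^'n) set)"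
    by (auto simp: bij_betw_def inj_on_def axis_eq_axis Basis_vec_def)
  have ai: "axis_index (axis i 1 :: real^'n) = i" for i
    using axis_index[of "axis i 1 :: real^'n"] by (simp add: axis_eq_axis)
  have "(\<Sum>j\<in>Basis. (?c j * (x \<bullet> j)) *\<^sub>R j) = diag_mat d *v x" for x
  proof -
    have "(\<Sum>j\<in>Basis. (?c j * (x \<bullet> j)) *\<^sub>R j) = (\<Sum>i\<in>UNIV. (d $ i * x $ i) *\<^sub>R axis i 1)"
      unfolding sum.reindex_bij_betw[OF bij, symmetric] by (simp add: ai inner_axis)
    also have "\<dots> = diag_mat d *v x"
      unfolding vec_eq_iff diag_mat_vector
      by (simp add: axis_def if_distrib cong: if_cong)
    finally show ?thesis .
  qed
  moreover have "(\<Prod>j\<in>Basis. \<bar>?c j\<bar>) = (\<Prod>i\<in>UNIV. d $ i)"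
    unfolding prod.reindex_bij_betw[OF bij, symmetric] using d by (simp add: ai less_imp_le)
  ultimately have "lborel = density (distr lborel borel (\<lambda>x. diag_mat d *v x)) (\<lambda>_. ennreal (\<Prod>i\<in>UNIV. d $ i))"
    using lborel_affine_euclidean[of ?c 0] d by (simp add: less_imp_neq[symmetric])
  then have "(\<integral>\<^sup>+x. f x \<partial>lborel)
      = (\<integral>\<^sup>+x. f x \<partial>density (distr lborel borel (\<lambda>x. diag_mat d *v x)) (\<lambda>_. ennreal (\<Prod>i\<in>UNIV. d $ i)))"
    by simp
  then show ?thesis by (simp add: nn_integral_density nn_integral_distr)
qed

section \<open>Gaussian integrals as affine images of standard Gaussian integrals\<close>

lemma matrix_inv_factor:
  fixes L :: "real^'n::finite^'n"
  assumes L: "invertible L"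
  shows "matrix_inv (L ** transpose L) = transpose (matrix_inv L) ** matrix_inv L"
proof (rule matrix_inv_unique_right)
  have "L ** transpose L ** (transpose (matrix_inv L) ** matrix_inv L)
      = L ** transpose (matrix_inv L ** L) ** matrix_inv L"
    by (simp add: matrix_transpose_mul matrix_mul_assoc)
  then show "L ** transpose L ** (transpose (matrix_inv L) ** matrix_inv L) = mat 1"
    by (simp add: matrix_inv_left[OF L] matrix_inv_right[OF L])
qed

text \<open>In coordinates \<open>w\<close> with \<open>z - m = L *v w\<close> the Gaussian exponent
  becomes the standard one.\<close>

lemma pos_def_factor_quadratic:
  fixes L :: "real^'n::finite^'n"
  assumes L: "invertible L" and K: "K = L ** transpose L"
  shows "(L *v w) \<bullet> (matrix_inv K *v (L *v w)) = w \<bullet> w"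
proof -
  have inv: "matrix_inv K = transpose (matrix_inv L) ** matrix_inv L"
    unfolding K by (rule matrix_inv_factor[OF L])
  have "(L *v w) \<bullet> (matrix_inv K *v (L *v w))
      = (L *v w) \<bullet> (transpose (matrix_inv L) *v (matrix_inv L *v (L *v w)))"
    by (simp only: inv matrix_vector_mul_assoc matrix_mul_assoc)
  also have "\<dots> = (transpose (transpose (matrix_inv L)) *v (L *v w)) \<bullet> (matrix_inv L *v (L *v w))"
    by (rule inner_mult_transpose)
  finally show ?thesis
    by (simp only: transpose_transpose matrix_vector_mul_assoc matrix_inv_left[OF L] matrix_vector_mul_lid)
qed

lemma std_gauss_eq: "std_gauss (w :: real^'n::finite) = exp (- (w \<bullet> w) / 2) / sqrt ((2 * pi) ^ CARD('n))"
proof -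
  have "matrix_inv (mat 1 :: real^'n^'n) = mat 1" by (rule matrix_inv_unique_right) simp
  then show ?thesis by (simp add: gauss_density_def)
qed

lemma measurable_gauss_density [measurable]: "gauss_density m K \<in> borel_measurable borel"
  unfolding gauss_density_def by measurable

lemma gauss_density_pos: "pos_def K \<Longrightarrow> gauss_density m K z > 0"
  unfolding gauss_density_def by (simp add: pos_def_det)

text \<open>Two factors of the same \<open>K\<close> differ by an orthogonal matrix, under which the
  standard Gaussian is invariant. This reduces an arbitrary \<open>L\<close> to the factor
  \<open>Q ** diag_mat d\<close>.\<close>

lemma nn_integral_gauss_affine:
  fixes L K :: "real^'n::finite^'n"
  assumes L: "invertible L" and K: "K = L ** transpose L" and f [measurable]: "f \<in> borel_measurable borel"
  shows "(\<integral>\<^sup>+z. ennreal (gauss_density m K z) * f z \<partial>lborel)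
       = (\<integral>\<^sup>+w. ennreal (std_gauss w) * f (m + L *v w) \<partial>lborel)"
proof -
  have pK: "pos_def K" using pos_def_mult_transpose[OF L] K by simp
  obtain Q d where Q: "orthogonal_matrix Q" and d: "\<And>i. d $ i > 0"
    and KM: "K = (Q ** diag_mat d) ** transpose (Q ** diag_mat d)"
    using pos_def_diag_factor[OF pK] by blast
  define M where "M = Q ** diag_mat d"
  have M: "invertible M" "K = M ** transpose M"
    using pos_def_invertible[OF pK] KM invertible_transpose_mult by (auto simp: M_def)
  define R where "R = matrix_inv M ** L"
  have MR: "M ** R = L" by (simp add: R_def matrix_mul_assoc matrix_inv_right[OF M(1)])
  have "R ** transpose R = matrix_inv M ** (L ** transpose L) ** transpose (matrix_inv M)"
    by (simp add: R_def matrix_transpose_mul matrix_mul_assoc)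
  also have "\<dots> = (matrix_inv M ** M) ** transpose (matrix_inv M ** M)"
    unfolding K[symmetric] by (subst M(2)) (simp add: matrix_transpose_mul matrix_mul_assoc)
  also have "\<dots> = mat 1" by (simp add: matrix_inv_left[OF M(1)])
  finally have R: "orthogonal_matrix R"
    unfolding orthogonal_matrix using matrix_left_right_inverse by blast
  have "(\<integral>\<^sup>+w. ennreal (std_gauss w) * f (m + L *v w) \<partial>lborel)
      = (\<integral>\<^sup>+w. ennreal (std_gauss (R *v w)) * f (m + M *v (R *v w)) \<partial>lborel)"
    using norm_orthogonal_mult[OF R]
    by (simp only: std_gauss_eq matrix_vector_mul_assoc MR dot_square_norm)
  also have "\<dots> = (\<integral>\<^sup>+w. ennreal (std_gauss w) * f (m + M *v w) \<partial>lborel)"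
    by (rule nn_integral_lborel_orthogonal[OF R]) measurable
  finally have lhs: "(\<integral>\<^sup>+w. ennreal (std_gauss w) * f (m + L *v w) \<partial>lborel) = \<dots>" .
  \<comment> \<open>The factor \<open>sqrt (det K)\<close> of the normalizer is the Jacobian of
    \<open>diag_mat d\<close>, which it cancels below.\<close>
  have "det Q * det Q = 1"
    using orthogonal_cancel(2)[OF Q] by (metis det_I det_mul det_transpose)
  then have "det K = (\<Prod>i\<in>UNIV. d $ i)\<^sup>2"
    by (simp add: KM det_mul det_diag_mat power2_eq_square)
  then have dK: "sqrt (det K) = (\<Prod>i\<in>UNIV. d $ i)"
    using d by (simp add: prod_nonneg less_imp_le)
  have pd: "(\<Prod>i\<in>UNIV. d $ i) > 0" using d by (simp add: prod_pos)
  have g: "(\<Prod>i\<in>UNIV. d $ i) * gauss_density m K (m + M *v w) = std_gauss w" for w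
    using pd unfolding std_gauss_eq
    by (simp add: gauss_density_def pos_def_factor_quadratic[OF M] real_sqrt_mult dK less_imp_neq[OF d, symmetric]
        del: power_mult_distrib)
  have "(\<integral>\<^sup>+z. ennreal (gauss_density m K z) * f z \<partial>lborel)
      = (\<integral>\<^sup>+z. ennreal (gauss_density m K (m + z)) * f (m + z) \<partial>lborel)"
    by (rule nn_integral_lborel_shift[symmetric]) measurable
  also have "\<dots> = (\<integral>\<^sup>+z. ennreal (gauss_density m K (m + Q *v z)) * f (m + Q *v z) \<partial>lborel)"
    by (rule nn_integral_lborel_orthogonal[OF Q, symmetric]) measurable
  also have "\<dots> = (\<integral>\<^sup>+w. ennreal (\<Prod>i\<in>UNIV. d $ i) *
      (ennreal (gauss_density m K (m + Q *v (diag_mat d *v w))) * f (m + Q *v (diag_mat d *v w))) \<partial>lborel)"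
    by (rule nn_integral_lborel_diag[OF d]) measurable
  also have "\<dots> = (\<integral>\<^sup>+w. ennreal (std_gauss w) * f (m + M *v w) \<partial>lborel)"
    using g pd gauss_density_pos[OF pK]
    by (simp add: matrix_vector_mul_assoc M_def[symmetric] mult.assoc[symmetric] ennreal_mult[symmetric] less_imp_le)
  finally show ?thesis using lhs by simp
qed

text \<open>Equality of measures carries the affine formula from nonnegative integrands over to
  Bochner integrals of vector-valued functions.\<close>

lemma gauss_measure_affine:
  fixes L K :: "real^'n::finite^'n"
  assumes L: "invertible L" and K: "K = L ** transpose L"
  shows "density lborel (\<lambda>z. ennreal (gauss_density m K z))
       = distr (density lborel (\<lambda>w. ennreal (std_gauss w))) borel (\<lambda>w. m + L *v w)"
proof (rule measure_eqI)
  fix A assume "A \<in> sets (density lborel (\<lambda>z. ennreal (gauss_density m K z)))"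
  then have [measurable]: "A \<in> sets borel" by simp
  have "emeasure (density lborel (\<lambda>z. ennreal (gauss_density m K z))) A
      = (\<integral>\<^sup>+z. ennreal (gauss_density m K z) * indicator A z \<partial>lborel)"
    by (simp add: emeasure_density)
  also have "\<dots> = (\<integral>\<^sup>+w. ennreal (std_gauss w) * indicator A (m + L *v w) \<partial>lborel)"
    by (rule nn_integral_gauss_affine[OF L K]) measurable
  also have "\<dots> = (\<integral>\<^sup>+w. indicator A (m + L *v w) \<partial>density lborel (\<lambda>w. ennreal (std_gauss w)))"
    by (simp add: nn_integral_density)
  also have "\<dots> = (\<integral>\<^sup>+z. indicator A z \<partial>distr (density lborel (\<lambda>w. ennreal (std_gauss w))) borel (\<lambda>w. m + L *v w))"
    by (rule nn_integral_distr[symmetric]) measurable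
  finally show "emeasure (density lborel (\<lambda>z. ennreal (gauss_density m K z))) A
      = emeasure (distr (density lborel (\<lambda>w. ennreal (std_gauss w))) borel (\<lambda>w. m + L *v w)) A"
    by simp
qed simp

lemma has_bochner_integral_gauss_affine:
  fixes L K :: "real^'n::finite^'n" and f :: "real^'n \<Rightarrow> 'b::{banach, second_countable_topology}"
  assumes L: "invertible L" and K: "K = L ** transpose L" and f [measurable]: "f \<in> borel_measurable borel"
  shows "has_bochner_integral lborel (\<lambda>z. gauss_density m K z *\<^sub>R f z) x
     \<longleftrightarrow> has_bochner_integral lborel (\<lambda>w. std_gauss w *\<^sub>R f (m + L *v w)) x"
proof -
  have pK: "gauss_density m K z \<ge> 0" for z
    using pos_def_mult_transpose[OF L] K gauss_density_pos less_imp_le by blast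
  have "has_bochner_integral lborel (\<lambda>z. gauss_density m K z *\<^sub>R f z) x
     \<longleftrightarrow> has_bochner_integral (density lborel (\<lambda>z. ennreal (gauss_density m K z))) f x"
    using pK by (simp add: has_bochner_integral_iff integrable_density integral_density)
  also have "\<dots> \<longleftrightarrow> has_bochner_integral (density lborel (\<lambda>w. ennreal (std_gauss w))) (\<lambda>w. f (m + L *v w)) x"
    unfolding gauss_measure_affine[OF L K]
    by (simp add: has_bochner_integral_iff integrable_distr_eq integral_distr)
  also have "\<dots> \<longleftrightarrow> has_bochner_integral lborel (\<lambda>w. std_gauss w *\<^sub>R f (m + L *v w)) x"
    by (simp add: has_bochner_integral_iff integrable_density integral_density std_gauss_pos less_imp_le)
  finally show ?thesis .
qed

text \<open>With rows of a factor as \<open>p\<close> and \<open>q\<close> this gives the entries of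
  a covariance matrix; with \<open>p = q\<close>, summed over rows, it gives mean squared
  norms.\<close>

lemma std_gauss_bilinear:
  fixes p q :: "real^'n::finite"
  shows "has_bochner_integral lborel (\<lambda>w. std_gauss w * ((a + p \<bullet> w) * (b + q \<bullet> w))) (a * b + p \<bullet> q)"
proof -
  have "has_bochner_integral lborel (\<lambda>w. a * b * std_gauss w
      + ((\<Sum>k\<in>UNIV. (a * q $ k + b * p $ k) * (std_gauss w * w $ k))
      + (\<Sum>k\<in>UNIV. \<Sum>l\<in>UNIV. p $ k * q $ l * (std_gauss w * (w $ k * w $ l)))))
      (a * b * 1 + ((\<Sum>k\<in>(UNIV::'n set). (a * q $ k + b * p $ k) * 0)
      + (\<Sum>k\<in>UNIV. \<Sum>l\<in>UNIV. p $ k * q $ l * (if k = l then 1 else 0))))"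
    by (intro has_bochner_integral_add has_bochner_integral_sum has_bochner_integral_mult_right
        std_gauss_moment_0 std_gauss_moment_1 std_gauss_moment_2)
  moreover have "a * b * std_gauss w
      + ((\<Sum>k\<in>UNIV. (a * q $ k + b * p $ k) * (std_gauss w * w $ k))
      + (\<Sum>k\<in>UNIV. \<Sum>l\<in>UNIV. p $ k * q $ l * (std_gauss w * (w $ k * w $ l))))
    = std_gauss w * ((a + p \<bullet> w) * (b + q \<bullet> w))" for w
  proof -
    have "(\<Sum>k\<in>UNIV. (a * q $ k + b * p $ k) * (std_gauss w * w $ k))
        = std_gauss w * (a * (q \<bullet> w) + b * (p \<bullet> w))"
      by (simp add: inner_vec_def sum.distrib sum_distrib_left algebra_simps)
    moreover have "(\<Sum>k\<in>UNIV. \<Sum>l\<in>UNIV. p $ k * q $ l * (std_gauss w * (w $ k * w $ l)))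
        = std_gauss w * ((p \<bullet> w) * (q \<bullet> w))"
    proof -
      have "(p \<bullet> w) * (q \<bullet> w) = (\<Sum>k\<in>UNIV. \<Sum>l\<in>UNIV. (p $ k * w $ k) * (q $ l * w $ l))"
        by (simp only: inner_vec_def inner_real_def sum_product)
      then show ?thesis by (simp only: sum_distrib_left) (simp add: mult_ac)
    qed
    ultimately show ?thesis by (simp add: algebra_simps)
  qed
  moreover have "(\<Sum>k\<in>UNIV. \<Sum>l\<in>UNIV. p $ k * q $ l * (if k = l then 1 else 0)) = p \<bullet> q"
    by (simp add: inner_vec_def if_distrib cong: if_cong)
  ultimately show ?thesis by simp
qed

lemma std_gauss_norm_squared:
  fixes N :: "real^'n::finite^'m::finite"
  shows "has_bochner_integral lborel (\<lambda>w. std_gauss w * (norm (v + N *v w))\<^sup>2) (trace (N ** transpose N) + (norm v)\<^sup>2)"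
proof -
  have "has_bochner_integral lborel
      (\<lambda>w. \<Sum>i\<in>UNIV. std_gauss w * ((v $ i + N $ i \<bullet> w) * (v $ i + N $ i \<bullet> w)))
      (\<Sum>i\<in>UNIV. v $ i * v $ i + N $ i \<bullet> N $ i)"
    by (intro has_bochner_integral_sum std_gauss_bilinear)
  moreover have "(\<Sum>i\<in>UNIV. std_gauss w * ((v $ i + N $ i \<bullet> w) * (v $ i + N $ i \<bullet> w)))
      = std_gauss w * (norm (v + N *v w))\<^sup>2" for w
    unfolding power2_norm_eq_inner
    by (simp add: inner_vec_def matrix_vector_mult_def sum_distrib_left)
  moreover have "(\<Sum>i\<in>UNIV. v $ i * v $ i + N $ i \<bullet> N $ i) = trace (N ** transpose N) + (norm v)\<^sup>2"
    unfolding power2_norm_eq_inner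
    by (simp add: inner_vec_def trace_def matrix_matrix_mult_def transpose_def sum.distrib)
  ultimately show ?thesis by simp
qed

section \<open>Mass, mean, covariance and quadratic moments of a Gaussian\<close>

lemma pos_def_factor:
  assumes "pos_def (K :: real^'n::finite^'n)"
  obtains L :: "real^'n^'n" where "invertible L" "K = L ** transpose L"
  using square_factor[OF assms] by blast

lemma has_bochner_integral_gauss:
  assumes "pos_def (K :: real^'n::finite^'n)"
  shows "has_bochner_integral lborel (gauss_density m K) 1"
proof -
  obtain L :: "real^'n^'n" where L: "invertible L" "K = L ** transpose L" by (rule pos_def_factor[OF assms])
  from has_bochner_integral_gauss_affine[OF L, of "\<lambda>_. 1::real" m 1] show ?thesis
    using std_gauss_moment_0 by simp
qed

lemma nn_integral_gauss:
  assumes "pos_def (K :: real^'n::finite^'n)"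
  shows "(\<integral>\<^sup>+z. ennreal (gauss_density m K z) \<partial>lborel) = 1"
  using has_bochner_integral_gauss[OF assms] gauss_density_pos[OF assms]
  by (subst nn_integral_eq_integral) (auto simp: has_bochner_integral_iff less_imp_le)

lemma density_mean_gauss:
  assumes "pos_def (K :: real^'n::finite^'n)"
  shows "density_mean (gauss_density m K) = m"
proof -
  obtain L :: "real^'n^'n" where L: "invertible L" "K = L ** transpose L" by (rule pos_def_factor[OF assms])
  have "has_bochner_integral lborel
     (\<lambda>w. std_gauss w *\<^sub>R m + (\<Sum>k\<in>UNIV. (std_gauss w * w $ k) *\<^sub>R column k L))
     (1 *\<^sub>R m + (\<Sum>k\<in>UNIV. 0 *\<^sub>R column k L))"
    by (intro has_bochner_integral_add has_bochner_integral_sum has_bochner_integral_scaleR_left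
        std_gauss_moment_0 std_gauss_moment_1)
  moreover have "std_gauss w *\<^sub>R m + (\<Sum>k\<in>UNIV. (std_gauss w * w $ k) *\<^sub>R column k L)
      = std_gauss w *\<^sub>R (m + L *v w)" for w
    unfolding matrix_mult_sum scaleR_add_right scaleR_sum_right
    by (simp add: scalar_mult_eq_scaleR)
  ultimately have "has_bochner_integral lborel (\<lambda>w. std_gauss w *\<^sub>R (m + L *v w)) m" by simp
  then have "has_bochner_integral lborel (\<lambda>z. gauss_density m K z *\<^sub>R z) m"
    by (subst has_bochner_integral_gauss_affine[OF L]) auto
  then show ?thesis by (simp add: density_mean_def has_bochner_integral_iff)
qed

lemma density_cov_gauss:
  assumes "pos_def (K :: real^'n::finite^'n)"
  shows "density_cov (gauss_density m K) = K"
proof -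
  obtain L :: "real^'n^'n" where L: "invertible L" "K = L ** transpose L" by (rule pos_def_factor[OF assms])
  have "(LINT z|lborel. gauss_density m K z * ((z - m) $ i * (z - m) $ j)) = K $ i $ j" for i j
  proof -
    have "has_bochner_integral lborel (\<lambda>w. std_gauss w *\<^sub>R (((m + L *v w) - m) $ i * ((m + L *v w) - m) $ j)) (L $ i \<bullet> L $ j)"
      using std_gauss_bilinear[of 0 "L $ i" 0 "L $ j"]
      by (simp add: matrix_vector_mult_def inner_vec_def)
    then have "has_bochner_integral lborel (\<lambda>z. gauss_density m K z *\<^sub>R ((z - m) $ i * (z - m) $ j)) (L $ i \<bullet> L $ j)"
      by (subst has_bochner_integral_gauss_affine[OF L]) auto
    then have "(LINT z|lborel. gauss_density m K z * ((z - m) $ i * (z - m) $ j)) = L $ i \<bullet> L $ j"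
      by (simp add: has_bochner_integral_iff)
    also have "\<dots> = K $ i $ j"
      unfolding L(2) by (simp add: inner_vec_def matrix_matrix_mult_def transpose_def)
    finally show ?thesis .
  qed
  then show ?thesis by (simp add: density_cov_def density_mean_gauss[OF assms] vec_eq_iff)
qed

text \<open>Membership in the ball fixes the joint density only almost everywhere; mean and
  covariance are integrals and do not notice the difference.\<close>

lemma density_mean_cov_AE_gauss:
  assumes K: "pos_def (K :: real^'n::finite^'n)" and [measurable]: "f \<in> borel_measurable borel"
    and ae: "AE z in lborel. f z = gauss_density m K z"
  shows "density_mean f = m" "density_cov f = K"
proof -
  have "density_mean f = density_mean (gauss_density m K)"
    unfolding density_mean_def by (rule integral_cong_AE) (use ae in auto)
  then show m: "density_mean f = m" by (simp add: density_mean_gauss[OF K])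
  have "density_cov f = density_cov (gauss_density m K)"
    unfolding density_cov_def m density_mean_gauss[OF K] vec_eq_iff vec_lambda_beta
    by (intro allI integral_cong_AE) (use ae in auto)
  then show "density_cov f = K" by (simp add: density_cov_gauss[OF K])
qed

lemma nn_integral_gauss_norm_squared:
  fixes W :: "real^'n::finite^'m::finite"
  assumes "pos_def K"
  shows "(\<integral>\<^sup>+z. ennreal (gauss_density m K z) * ennreal ((norm (W *v z - b))\<^sup>2) \<partial>lborel)
       = ennreal (trace (W ** K ** transpose W) + (norm (W *v m - b))\<^sup>2)"
proof -
  obtain L :: "real^'n^'n" where L: "invertible L" "K = L ** transpose L" by (rule pos_def_factor[OF assms])
  have "(\<integral>\<^sup>+z. ennreal (gauss_density m K z) * ennreal ((norm (W *v z - b))\<^sup>2) \<partial>lborel)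
     = (\<integral>\<^sup>+w. ennreal (std_gauss w) * ennreal ((norm (W *v (m + L *v w) - b))\<^sup>2) \<partial>lborel)"
    by (rule nn_integral_gauss_affine[OF L]) measurable
  also have "\<dots> = (\<integral>\<^sup>+w. ennreal (std_gauss w * (norm ((W *v m - b) + (W ** L) *v w))\<^sup>2) \<partial>lborel)"
    by (simp add: ennreal_mult std_gauss_pos less_imp_le matrix_vector_right_distrib
        matrix_vector_mul_assoc add_diff_eq diff_add_eq)
  also have "\<dots> = ennreal (trace ((W ** L) ** transpose (W ** L)) + (norm (W *v m - b))\<^sup>2)"
    using std_gauss_norm_squared[of "W *v m - b" "W ** L"]
    by (subst nn_integral_eq_integral) (auto simp: has_bochner_integral_iff std_gauss_pos less_imp_le)
  also have "(W ** L) ** transpose (W ** L) = W ** K ** transpose W"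
    by (simp add: L(2) matrix_transpose_mul matrix_mul_assoc)
  finally show ?thesis .
qed

text \<open>If \<open>L\<close> is a factor of \<open>K\<close>, so is \<open>M ** L\<close>. The
  left side is the affine formula for \<open>L\<close>, the right side the one for
  \<open>M ** L\<close>, and both give the same standard Gaussian integral.\<close>

lemma nn_integral_gauss_reflect:
  fixes K :: "real^'n::finite^'n"
  assumes K: "pos_def K" and M: "invertible M" "M ** K ** transpose M = K"
    and [measurable]: "f \<in> borel_measurable borel"
  shows "(\<integral>\<^sup>+z. ennreal (gauss_density m K z) * f (m + M *v (z - m)) \<partial>lborel)
       = (\<integral>\<^sup>+z. ennreal (gauss_density m K z) * f z \<partial>lborel)"
proof -
  obtain L :: "real^'n^'n" where L: "invertible L" "K = L ** transpose L" by (rule pos_def_factor[OF K])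
  have factor: "invertible (M ** L)" "K = (M ** L) ** transpose (M ** L)"
  proof -
    show "invertible (M ** L)" by (intro invertible_mult M L)
    have "(M ** L) ** transpose (M ** L) = M ** (L ** transpose L) ** transpose M"
      by (simp add: matrix_transpose_mul matrix_mul_assoc)
    then show "K = (M ** L) ** transpose (M ** L)" by (simp only: L(2)[symmetric] M(2))
  qed
  have "(\<integral>\<^sup>+z. ennreal (gauss_density m K z) * f (m + M *v (z - m)) \<partial>lborel)
      = (\<integral>\<^sup>+w. ennreal (std_gauss w) * f (m + M *v ((m + L *v w) - m)) \<partial>lborel)"
    by (rule nn_integral_gauss_affine[OF L]) measurable
  also have "\<dots> = (\<integral>\<^sup>+w. ennreal (std_gauss w) * f (m + (M ** L) *v w) \<partial>lborel)"
    by (simp add: matrix_vector_mul_assoc)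
  also have "\<dots> = (\<integral>\<^sup>+z. ennreal (gauss_density m K z) * f z \<partial>lborel)"
    by (rule nn_integral_gauss_affine[OF factor, symmetric]) measurable
  finally show ?thesis .
qed

text \<open>Identifies a Gaussian from its exponent and its total mass, whatever expression the
  constant in front has.\<close>

lemma gauss_density_normalized:
  assumes K: "pos_def (K :: real^'n::finite^'n)"
    and f: "\<And>z. f z = k * exp (- ((z - m) \<bullet> (matrix_inv K *v (z - m))) / 2)" and k: "k \<ge> 0"
    and total: "(\<integral>\<^sup>+z. ennreal (f z) \<partial>lborel) = 1"
  shows "f = gauss_density m K"
proof -
  define c where "c = k * sqrt ((2 * pi) ^ CARD('n) * det K)"
  have "sqrt ((2 * pi) ^ CARD('n) * det K) > 0"
    using pos_def_det[OF K] by simp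
  then have fc: "f z = c * gauss_density m K z" and c0: "c \<ge> 0" for z
    using k pos_def_det[OF K] by (simp_all add: f c_def gauss_density_def)
  have "ennreal c * (\<integral>\<^sup>+z. ennreal (gauss_density m K z) \<partial>lborel) = 1"
    using total c0 gauss_density_pos[OF K]
    by (simp add: fc ennreal_mult less_imp_le nn_integral_cmult)
  then have "c = 1" using c0 by (simp add: nn_integral_gauss[OF K])
  then show ?thesis using fc by auto
qed

section \<open>Gaussian mixtures by completing the square\<close>

lemma symmetric_bilinear_comm:
  assumes "transpose A = (A :: real^'n::finite^'n)"
  shows "x \<bullet> (A *v y) = y \<bullet> (A *v x)"
  using inner_mult_transpose[of x A y] assms by (simp add: inner_commute)

lemma pos_def_symmetric: "pos_def A \<Longrightarrow> transpose A = A"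
  by (simp add: pos_def_def)

lemma pos_def_plus_congruence:
  fixes H :: "real^'n::finite^'m::finite"
  assumes V: "pos_def V" and R: "pos_def R"
  shows "pos_def (V + transpose H ** R ** H)"
  unfolding pos_def_def
proof (intro conjI allI impI)
  show "transpose (V + transpose H ** R ** H) = V + transpose H ** R ** H"
    using assms by (simp add: pos_def_def transpose_add matrix_transpose_mul matrix_mul_assoc)
  fix x :: "real^'n" assume x: "x \<noteq> 0"
  have "x \<bullet> ((transpose H ** R ** H) *v x) = x \<bullet> (transpose H *v (R *v (H *v x)))"
    by (simp only: matrix_vector_mul_assoc matrix_mul_assoc)
  also have "\<dots> = (H *v x) \<bullet> (R *v (H *v x))"
    by (simp only: inner_mult_transpose transpose_transpose)
  also have "\<dots> \<ge> 0" using R by (cases "H *v x = 0") (auto simp: pos_def_def less_imp_le)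
  moreover have "x \<bullet> (V *v x) > 0" using V x by (simp add: pos_def_def)
  ultimately show "0 < x \<bullet> ((V + transpose H ** R ** H) *v x)"
    by (simp add: matrix_vector_mult_add_rdistrib inner_add_right)
qed

context
  fixes H :: "real^'n::finite^'m::finite" and V :: "real^'n^'n" and R :: "real^'m^'m"
  assumes V: "pos_def V" and R: "pos_def R"
begin

text \<open>The posterior precision of a vector with prior covariance \<open>V\<close> whose image
  under \<open>H\<close> is observed with noise covariance \<open>R\<close>.\<close>

private abbreviation "S \<equiv> matrix_inv V + transpose H ** matrix_inv R ** H"

private lemma S: "pos_def S"
  by (intro pos_def_plus_congruence pos_def_matrix_inv V R)

private abbreviation "J \<equiv> matrix_inv R - matrix_inv R ** H ** matrix_inv S ** transpose H ** matrix_inv R"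

text \<open>The heart is \<open>(H ** V ** transpose H + R) ** (matrix_inv R ** H) = H ** V **
  S\<close>: the factor \<open>S\<close> cancels the \<open>matrix_inv S\<close> inside
  \<open>J\<close>, and the remaining terms collapse to the identity.\<close>

lemma woodbury: "matrix_inv (H ** V ** transpose H + R) = J"
proof (rule matrix_inv_unique_right)
  note inv = matrix_inv_right[OF pos_def_invertible[OF R]] matrix_inv_right[OF pos_def_invertible[OF V]]
     matrix_inv_right[OF pos_def_invertible[OF S]]
  let ?T = "matrix_inv S ** transpose H ** matrix_inv R"
  have J: "J = matrix_inv R - matrix_inv R ** H ** ?T"
    by (simp add: matrix_mul_assoc)
  have "H ** V ** S = H + H ** V ** transpose H ** matrix_inv R ** H"
  proof -
    have "H ** V ** S = H ** (V ** matrix_inv V) + H ** V ** transpose H ** matrix_inv R ** H"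
      by (simp only: matrix_mul_add_right matrix_mul_assoc)
    then show ?thesis by (simp add: inv)
  qed
  then have "(H ** V ** transpose H + R) ** (matrix_inv R ** H) = H ** V ** S"
    by (simp add: matrix_mul_add_left matrix_mul_assoc inv add.commute)
  then have "(H ** V ** transpose H + R) ** (matrix_inv R ** H) ** ?T
      = H ** V ** (S ** matrix_inv S) ** transpose H ** matrix_inv R"
    by (simp add: matrix_mul_assoc)
  also have "\<dots> = H ** V ** transpose H ** matrix_inv R" by (simp add: inv)
  finally show "(H ** V ** transpose H + R) ** J = mat 1"
    unfolding J
    by (simp add: matrix_mul_diff_right matrix_mul_assoc) (simp add: matrix_mul_add_left inv)
qed

text \<open>\<open>b\<close> is the posterior mean of \<open>y\<close> given \<open>u\<close>. The
  cross terms match because \<open>S *v b = transpose H *v (matrix_inv R *v u)\<close>; what is left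
  over is the quadratic form of the marginal of \<open>u\<close>, whose inverse covariance is
  \<open>J\<close> by \<open>woodbury\<close>.\<close>

private lemma complete_square:
  fixes u :: "real^'m" and y :: "real^'n"
  defines "b \<equiv> matrix_inv S *v (transpose H *v (matrix_inv R *v u))"
  shows "(u - H *v y) \<bullet> (matrix_inv R *v (u - H *v y)) + y \<bullet> (matrix_inv V *v y)
     = (y - b) \<bullet> (S *v (y - b)) + u \<bullet> (J *v u)"
proof -
  note symR = pos_def_symmetric[OF pos_def_matrix_inv[OF R]]
  define a where "a = transpose H *v (matrix_inv R *v u)"
  have Sb: "S *v b = a"
    by (simp only: b_def a_def matrix_vector_mul_assoc matrix_mul_assoc
        matrix_inv_right[OF pos_def_invertible[OF S]] matrix_mul_lid)
  have yS: "y \<bullet> (S *v y) = y \<bullet> (matrix_inv V *v y) + (H *v y) \<bullet> (matrix_inv R *v (H *v y))"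
  proof -
    have "y \<bullet> ((transpose H ** matrix_inv R ** H) *v y) = y \<bullet> (transpose H *v (matrix_inv R *v (H *v y)))"
      by (simp only: matrix_vector_mul_assoc matrix_mul_assoc)
    then show ?thesis
      by (simp only: matrix_vector_mult_add_rdistrib inner_add_right inner_mult_transpose transpose_transpose)
  qed
  have ya: "(H *v y) \<bullet> (matrix_inv R *v u) = y \<bullet> a"
    by (simp only: a_def inner_mult_transpose[of y] transpose_transpose)
  have uJ: "u \<bullet> (J *v u) = u \<bullet> (matrix_inv R *v u) - b \<bullet> a"
  proof -
    have "u \<bullet> ((matrix_inv R ** H ** matrix_inv S ** transpose H ** matrix_inv R) *v u)
        = u \<bullet> (matrix_inv R *v (H *v b))"
      by (simp only: b_def matrix_vector_mul_assoc matrix_mul_assoc)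
    also have "\<dots> = (H *v b) \<bullet> (matrix_inv R *v u)"
      by (rule symmetric_bilinear_comm[OF symR])
    also have "\<dots> = b \<bullet> a"
      by (simp only: a_def inner_mult_transpose[of b] transpose_transpose)
    finally show ?thesis
      by (simp only: matrix_vector_mult_diff_rdistrib inner_diff_right)
  qed
  have "(u - H *v y) \<bullet> (matrix_inv R *v (u - H *v y))
      = u \<bullet> (matrix_inv R *v u) - 2 * (y \<bullet> a) + (H *v y) \<bullet> (matrix_inv R *v (H *v y))"
    using symmetric_bilinear_comm[OF symR, of u "H *v y"] ya
    by (simp add: matrix_vector_mult_diff_distrib inner_diff_left inner_diff_right)
  moreover have "(y - b) \<bullet> (S *v (y - b)) = y \<bullet> (S *v y) - 2 * (y \<bullet> a) + b \<bullet> a"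
    using symmetric_bilinear_comm[OF pos_def_symmetric[OF S], of b y]
    by (simp add: matrix_vector_mult_diff_distrib Sb inner_diff_left inner_diff_right
        )
  ultimately show ?thesis using uJ yS by simp
qed

text \<open>The normalizing constant comes from Tonelli instead of a determinant identity.\<close>

lemma gauss_mixture:
  fixes x0 :: "real^'n"
  shows "has_bochner_integral lborel (\<lambda>x. gauss_density (H *v x) R z * gauss_density x0 V x)
     (gauss_density (H *v x0) (H ** V ** transpose H + R) z)"
proof -
  let ?K = "H ** V ** transpose H + R"
  have K: "pos_def ?K"
    using pos_def_plus_congruence[OF R V, of "transpose H"] by (simp add: add.commute)
  have iS: "matrix_inv (matrix_inv S) = S"
    by (rule matrix_inv_unique_right[OF matrix_inv_left[OF pos_def_invertible[OF S]]])
  have pS: "pos_def (matrix_inv S)" by (rule pos_def_matrix_inv[OF S])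
  \<comment> \<open>The quotient of normalizers left over when the product of the two densities is
    written as \<open>h z\<close> times the posterior density of \<open>x\<close>.\<close>
  define k where "k = sqrt ((2 * pi) ^ CARD('n) * det (matrix_inv S)) /
      (sqrt ((2 * pi) ^ CARD('m) * det R) * sqrt ((2 * pi) ^ CARD('n) * det V))"
  define h where "h z = k * exp (- ((z - H *v x0) \<bullet> (matrix_inv ?K *v (z - H *v x0))) / 2)" for z
  have k: "k \<ge> 0" unfolding k_def
    using pos_def_det[OF V] pos_def_det[OF R] pos_def_det[OF pS] by simp
  have hb: "has_bochner_integral lborel (\<lambda>x. gauss_density (H *v x) R z * gauss_density x0 V x) (h z)" for z
  proof -
    define u where "u = z - H *v x0"
    define b where "b = matrix_inv S *v (transpose H *v (matrix_inv R *v u))"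
    have "gauss_density (H *v x) R z * gauss_density x0 V x = h z * gauss_density (x0 + b) (matrix_inv S) x" for x
    proof -
      define A where "A = (u - H *v (x - x0)) \<bullet> (matrix_inv R *v (u - H *v (x - x0)))"
      define A' where "A' = (x - x0) \<bullet> (matrix_inv V *v (x - x0))"
      define B where "B = u \<bullet> (matrix_inv ?K *v u)"
      define B' where "B' = (x - x0 - b) \<bullet> (S *v (x - x0 - b))"
      have "A + A' = B' + B"
        unfolding A_def A'_def B_def B'_def b_def woodbury by (rule complete_square)
      then have e: "exp (- A / 2) * exp (- A' / 2) = exp (- B / 2) * exp (- B' / 2)"
        by (simp add: exp_add[symmetric] field_simps)
      have "z - H *v x = u - H *v (x - x0)" by (simp add: u_def matrix_vector_mult_diff_distrib)
      then have "gauss_density (H *v x) R z = exp (- A / 2) / sqrt ((2 * pi) ^ CARD('m) * det R)"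
        by (simp add: gauss_density_def A_def)
      moreover have "gauss_density x0 V x = exp (- A' / 2) / sqrt ((2 * pi) ^ CARD('n) * det V)"
        by (simp add: gauss_density_def A'_def)
      moreover have "gauss_density (x0 + b) (matrix_inv S) x
          = exp (- B' / 2) / sqrt ((2 * pi) ^ CARD('n) * det (matrix_inv S))"
        unfolding gauss_density_def iS B'_def diff_diff_eq ..
      moreover have "h z = k * exp (- B / 2)" by (simp add: h_def B_def u_def)
      moreover have "sqrt ((2 * pi) ^ CARD('n) * det (matrix_inv S)) \<noteq> 0"
        using pos_def_det[OF pS] by simp
      moreover define s1 s2 s3 where "s1 = sqrt ((2 * pi) ^ CARD('m) * det R)"
        and "s2 = sqrt ((2 * pi) ^ CARD('n) * det V)"
        and "s3 = sqrt ((2 * pi) ^ CARD('n) * det (matrix_inv S))"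
      moreover have "k = s3 / (s1 * s2)" by (simp add: k_def s1_def s2_def s3_def)
      ultimately show ?thesis
        using e by simp
    qed
    then show ?thesis
      using has_bochner_integral_mult_right[OF has_bochner_integral_gauss[OF pS, of "x0 + b"], of "h z"]
      by simp
  qed
  have "(\<integral>\<^sup>+z. ennreal (h z) \<partial>lborel)
      = (\<integral>\<^sup>+z. \<integral>\<^sup>+x. ennreal (gauss_density (H *v x) R z * gauss_density x0 V x) \<partial>lborel \<partial>lborel)"
  proof (rule nn_integral_cong)
    fix z
    show "ennreal (h z) = (\<integral>\<^sup>+x. ennreal (gauss_density (H *v x) R z * gauss_density x0 V x) \<partial>lborel)"
      using hb[of z] gauss_density_pos[OF R] gauss_density_pos[OF V]
      by (subst nn_integral_eq_integral) (auto simp: has_bochner_integral_iff less_imp_le)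
  qed
  also have "\<dots> = (\<integral>\<^sup>+x. \<integral>\<^sup>+z. ennreal (gauss_density (H *v x) R z * gauss_density x0 V x) \<partial>lborel \<partial>lborel)"
    by (rule nn_integral_lborel_swap) (unfold gauss_density_def, measurable)
  also have "\<dots> = (\<integral>\<^sup>+x. ennreal (gauss_density x0 V x) \<partial>lborel)"
    using gauss_density_pos[OF R] gauss_density_pos[OF V]
    by (intro nn_integral_cong) (simp add: ennreal_mult less_imp_le nn_integral_multc nn_integral_gauss[OF R])
  also have "\<dots> = 1" by (rule nn_integral_gauss[OF V])
  finally have "h = gauss_density (H *v x0) ?K"
    by (intro gauss_density_normalized[OF K _ k]) (simp_all add: h_def)
  then show ?thesis using hb[of z] by simp
qed

end

section \<open>Matrix functions\<close>

lemma trace_scaleR: "trace (c *\<^sub>R A) = c * trace (A :: real^'n::finite^'n)"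
  by (simp add: trace_def sum_distrib_left)

lemma diag_mat_add: "diag_mat d + diag_mat e = diag_mat (\<chi> i. d $ i + e $ i)"
  by (simp add: diag_mat_def vec_eq_iff)

lemma diag_mat_scaleR: "c *\<^sub>R diag_mat d = diag_mat (\<chi> i. c * d $ i)"
  by (simp add: diag_mat_def vec_eq_iff)

lemma orthogonal_conj_add:
  "Q ** A ** transpose Q + Q ** B ** transpose Q = Q ** (A + B) ** transpose (Q :: real^'n::finite^'n)"
  by (simp add: matrix_mul_add_left matrix_mul_add_right)

lemma orthogonal_conj_scaleR:
  "c *\<^sub>R (Q ** A ** transpose Q) = Q ** (c *\<^sub>R A) ** transpose (Q :: real^'n::finite^'n)"
  by (simp add: matrix_scalar_ac scalar_matrix_assoc)

lemma orthogonal_conj_affine: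
  assumes Q: "orthogonal_matrix (Q :: real^'n::finite^'n)"
  shows "a *\<^sub>R mat 1 + b *\<^sub>R (Q ** diag_mat d ** transpose Q)
    = Q ** diag_mat (\<chi> i. a + b * d $ i) ** transpose Q"
proof -
  have "a *\<^sub>R mat 1 = Q ** diag_mat (\<chi> i. a) ** transpose Q"
  proof -
    have "(mat 1 :: real^'n^'n) = Q ** mat 1 ** transpose Q"
      by (simp add: orthogonal_cancel(2)[OF Q])
    then have "a *\<^sub>R (mat 1 :: real^'n^'n) = Q ** (a *\<^sub>R mat 1) ** transpose Q"
      by (metis orthogonal_conj_scaleR)
    moreover have "a *\<^sub>R (mat 1 :: real^'n^'n) = diag_mat (\<chi> i. a)"
      by (simp add: diag_mat_def mat_def vec_eq_iff)
    ultimately show ?thesis by simp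
  qed
  then show ?thesis by (simp add: orthogonal_conj_scaleR diag_mat_scaleR orthogonal_conj_add diag_mat_add)
qed

text \<open>In eigenbases of \<open>S\<close> and \<open>T\<close> the hypothesis says that
  \<open>X\<close> has nonzero entries only between equal eigenvalues, and there \<open>f\<close>
  takes equal values. Since \<open>X\<close> may be rectangular, this compares functions of matrices
  of different sizes.\<close>

lemma mat_fun_intertwine:
  fixes S :: "real^'n::finite^'n" and T :: "real^'m::finite^'m" and X :: "real^'m^'n"
  assumes S: "transpose S = S" and T: "transpose T = T" and SX: "S ** X = X ** T"
  shows "mat_fun f S ** X = X ** mat_fun f T"
proof -
  obtain Q d where Q: "orthogonal_matrix Q" and Sd: "S = Q ** diag_mat d ** transpose Q"
    using symmetric_diagonalization[OF S] by blast
  obtain R e where R: "orthogonal_matrix R" and Te: "T = R ** diag_mat e ** transpose R"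
    using symmetric_diagonalization[OF T] by blast
  define Y where "Y = transpose Q ** X ** R"
  have "diag_mat d ** Y = transpose Q ** (S ** X) ** R"
    by (simp add: Y_def Sd matrix_mul_assoc orthogonal_cancel[OF Q])
  also have "\<dots> = Y ** diag_mat e"
    by (simp add: SX Y_def Te matrix_mul_assoc orthogonal_cancel[OF R])
  finally have "d $ i * Y $ i $ j = Y $ i $ j * e $ j" for i j
    by (metis mat_mult_diag diag_mult_mat)
  then have "Y $ i $ j = 0 \<or> d $ i = e $ j" for i j
    by (metis mult.commute mult_cancel_right)
  then have "f (d $ i) * Y $ i $ j = Y $ i $ j * f (e $ j)" for i j
    by (metis mult.commute mult_zero_left)
  then have Yf: "diag_mat (\<chi> i. f (d $ i)) ** Y = Y ** diag_mat (\<chi> i. f (e $ i))"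
    by (simp add: vec_eq_iff mat_mult_diag diag_mult_mat)
  have "mat_fun f S ** X = Q ** (diag_mat (\<chi> i. f (d $ i)) ** Y) ** transpose R"
    unfolding Sd mat_fun_eq[OF Q] by (simp add: Y_def matrix_mul_assoc orthogonal_cancel[OF R])
  also have "\<dots> = X ** mat_fun f T"
    unfolding Te mat_fun_eq[OF R] Yf by (simp add: Y_def matrix_mul_assoc orthogonal_cancel[OF Q])
  finally show ?thesis .
qed

text \<open>\<open>transpose L\<close> intertwines \<open>transpose L ** L\<close> with
  \<open>L ** transpose L\<close>. Hence expressions written with an arbitrary factor
  \<open>L\<close> depend on \<open>L ** transpose L\<close> only.\<close>

lemma mat_fun_Gram:
  fixes L :: "real^'n::finite^'n"
  assumes L: "invertible L" and Q: "orthogonal_matrix Q"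
    and P: "L ** transpose L = Q ** diag_mat p ** transpose Q"
  shows "trace (mat_fun f (transpose L ** L)) = (\<Sum>i\<in>UNIV. f (p $ i))"
    and "L ** mat_fun f (transpose L ** L) ** transpose L
      = Q ** diag_mat (\<chi> i. p $ i * f (p $ i)) ** transpose Q"
proof -
  let ?P = "L ** transpose L"
  have LT: "invertible (transpose L)" using L by (rule invertible_transpose)
  have "mat_fun f (transpose L ** L) ** transpose L = transpose L ** mat_fun f ?P"
    by (rule mat_fun_intertwine) (simp_all add: matrix_transpose_mul matrix_mul_assoc)
  then have f: "mat_fun f (transpose L ** L) ** transpose L
      = transpose L ** (Q ** diag_mat (\<chi> i. f (p $ i)) ** transpose Q)"
    by (simp only: P mat_fun_eq[OF Q])
  have "mat_fun f (transpose L ** L)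
      = mat_fun f (transpose L ** L) ** transpose L ** matrix_inv (transpose L)"
    by (simp add: matrix_mul_assoc[symmetric] matrix_inv_right[OF LT])
  also have "trace \<dots> = trace (matrix_inv (transpose L) ** (transpose L ** (Q ** diag_mat (\<chi> i. f (p $ i)) ** transpose Q)))"
    unfolding f by (rule trace_mul_sym)
  also have "\<dots> = trace (Q ** diag_mat (\<chi> i. f (p $ i)) ** transpose Q)"
    by (simp add: matrix_mul_assoc matrix_inv_left[OF LT])
  finally show "trace (mat_fun f (transpose L ** L)) = (\<Sum>i\<in>UNIV. f (p $ i))"
    by (simp add: trace_orthogonal_conj[OF Q] trace_diag_mat)
  have "L ** mat_fun f (transpose L ** L) ** transpose L
      = ?P ** (Q ** diag_mat (\<chi> i. f (p $ i)) ** transpose Q)"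
    by (simp add: f matrix_mul_assoc[symmetric])
  then show "L ** mat_fun f (transpose L ** L) ** transpose L
      = Q ** diag_mat (\<chi> i. p $ i * f (p $ i)) ** transpose Q"
    by (simp add: P orthogonal_conj_mult[OF Q] diag_mat_mult)
qed

section \<open>The scalar entropy and the tilting parameter\<close>

text \<open>\<open>tau_slope\<close> is the derivative of \<open>tau_entropy\<close> on the positive reals, \<open>tau_tilt\<close> the inverse of
  that derivative; \<open>tau_tilt \<tau> x\<close> is meaningful for \<open>(1 - \<tau>) * x < 1\<close> only.\<close>

definition tau_entropy :: "real \<Rightarrow> real \<Rightarrow> real" where
  "tau_entropy \<tau> s = (if \<tau> = 0 then s - 1 - ln s
     else if \<tau> < 1 then - (1 / (\<tau> * (1 - \<tau>))) * s powr \<tau> + (1 / (1 - \<tau>)) * s + 1 / \<tau>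
     else s * ln s - s + 1)"

definition tau_slope :: "real \<Rightarrow> real \<Rightarrow> real" where
  "tau_slope \<tau> s = (if \<tau> < 1 then (1 - s powr (\<tau> - 1)) / (1 - \<tau>) else ln s)"

definition tau_tilt :: "real \<Rightarrow> real \<Rightarrow> real" where
  "tau_tilt \<tau> x = (if \<tau> < 1 then (1 - (1 - \<tau>) * x) powr (1 / (\<tau> - 1)) else exp x)"

lemma tau_entropy_deriv:
  assumes "0 \<le> \<tau>" "\<tau> \<le> 1" "s > 0"
  shows "(tau_entropy \<tau> has_real_derivative tau_slope \<tau> s) (at s)"
proof -
  consider "\<tau> = 0" | "0 < \<tau>" "\<tau> < 1" | "\<tau> = 1" using assms by linarith
  then show ?thesis
  proof cases
    case 1
    have "((\<lambda>s. s - 1 - ln s) has_real_derivative (1 - inverse s)) (at s)"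
      using assms by (auto intro!: derivative_eq_intros simp: divide_inverse)
    then show ?thesis
      using assms 1 by (simp add: tau_entropy_def[abs_def] tau_slope_def powr_minus)
  next
    case 2
    have "((\<lambda>s. - (1 / (\<tau> * (1 - \<tau>))) * s powr \<tau> + (1 / (1 - \<tau>)) * s + 1 / \<tau>) has_real_derivative
        (- (1 / (\<tau> * (1 - \<tau>))) * (\<tau> * s powr (\<tau> - 1)) + 1 / (1 - \<tau>) * 1 + 0)) (at s)"
      by (intro DERIV_add DERIV_cmult DERIV_const DERIV_ident has_real_derivative_powr assms)
    moreover have "- (1 / (\<tau> * (1 - \<tau>))) * (\<tau> * s powr (\<tau> - 1)) + 1 / (1 - \<tau>) * 1 + 0 = tau_slope \<tau> s"
      using 2 by (simp add: tau_slope_def diff_divide_distrib)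
    ultimately show ?thesis
      using 2 by (simp add: tau_entropy_def[abs_def])
  next
    case 3
    have "((\<lambda>s. s * ln s - s + 1) has_real_derivative ln s) (at s)"
      using assms by (auto intro!: derivative_eq_intros)
    then show ?thesis using 3 by (simp add: tau_entropy_def[abs_def] tau_slope_def)
  qed
qed

lemma tau_slope_mono:
  assumes "0 < s" "s \<le> t"
  shows "tau_slope \<tau> s \<le> tau_slope \<tau> t"
  using assms by (auto simp: tau_slope_def divide_right_mono powr_mono2')

lemma tau_entropy_tangent:
  assumes \<tau>: "0 \<le> \<tau>" "\<tau> \<le> 1" and s: "s > 0" and t: "t > 0"
  shows "tau_entropy \<tau> s \<ge> tau_entropy \<tau> t + tau_slope \<tau> t * (s - t)"
proof -
  have "convex_on {0<..} (tau_entropy \<tau>)"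
    by (rule convex_on_realI[where f' = "tau_slope \<tau>"])
      (use tau_entropy_deriv[OF \<tau>] tau_slope_mono in auto)
  then have "tau_entropy \<tau> s - tau_entropy \<tau> t \<ge> tau_slope \<tau> t * (s - t)"
    by (rule convex_on_imp_above_tangent)
      (use s t tau_entropy_deriv[OF \<tau> t] in \<open>auto simp: interior_open intro: has_field_derivative_at_within\<close>)
  then show ?thesis by simp
qed

text \<open>For intermediate \<tau> the constants cancel because
  \<open>1 / (1 - \<tau>) + 1 / \<tau> = 1 / (\<tau> * (1 - \<tau>))\<close>.\<close>

lemma tau_entropy_1: "0 \<le> \<tau> \<Longrightarrow> \<tau> \<le> 1 \<Longrightarrow> tau_entropy \<tau> 1 = 0"
  using add_frac_eq[of "1 - \<tau>" \<tau> 1 1] by (auto simp: tau_entropy_def mult.commute)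

lemma tau_slope_1: "tau_slope \<tau> 1 = 0"
  by (simp add: tau_slope_def)

lemma tau_entropy_nonneg: "0 \<le> \<tau> \<Longrightarrow> \<tau> \<le> 1 \<Longrightarrow> s > 0 \<Longrightarrow> tau_entropy \<tau> s \<ge> 0"
  using tau_entropy_tangent[of \<tau> s 1] by (simp add: tau_entropy_1 tau_slope_1)

lemma tau_tilt_pos: "(1 - \<tau>) * x < 1 \<Longrightarrow> tau_tilt \<tau> x > 0"
  by (simp add: tau_tilt_def)

lemma tau_slope_tilt:
  assumes "\<tau> \<le> 1" "(1 - \<tau>) * x < 1"
  shows "tau_slope \<tau> (tau_tilt \<tau> x) = x"
proof (cases "\<tau> < 1")
  case True
  then have "(tau_tilt \<tau> x) powr (\<tau> - 1) = 1 - (1 - \<tau>) * x"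
    using assms by (simp add: tau_tilt_def powr_powr)
  then show ?thesis using True by (simp add: tau_slope_def)
qed (simp add: tau_slope_def tau_tilt_def)

text \<open>The values of the slope lie in the domain on which \<open>tau_tilt\<close> inverts
  it.\<close>

lemma tau_slope_bound: "s > 0 \<Longrightarrow> (1 - \<tau>) * tau_slope \<tau> s < 1" if "\<tau> \<le> 1"
  using that by (auto simp: tau_slope_def)

lemma tau_tilt_slope:
  assumes "\<tau> \<le> 1" "s > 0"
  shows "tau_tilt \<tau> (tau_slope \<tau> s) = s"
  using assms by (auto simp: tau_slope_def tau_tilt_def powr_powr)

text \<open>The slope is monotone and undoes the tilt, so a failure would give
  \<open>y \<le> x\<close>.\<close>

lemma tau_tilt_strict_mono:
  assumes "\<tau> \<le> 1" "(1 - \<tau>) * y < 1" "x < y"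
  shows "tau_tilt \<tau> x < tau_tilt \<tau> y"
proof (rule ccontr)
  assume "\<not> ?thesis"
  moreover have "(1 - \<tau>) * x \<le> (1 - \<tau>) * y" using assms by (intro mult_left_mono) auto
  ultimately have "tau_slope \<tau> (tau_tilt \<tau> y) \<le> tau_slope \<tau> (tau_tilt \<tau> x)"
    using assms by (intro tau_slope_mono tau_tilt_pos) auto
  then show False using assms \<open>(1 - \<tau>) * x \<le> (1 - \<tau>) * y\<close> by (simp add: tau_slope_tilt)
qed

lemma tau_tilt_0: "tau_tilt \<tau> 0 = 1"
  by (simp add: tau_tilt_def)

lemma tau_tilt_gt_1: "\<tau> \<le> 1 \<Longrightarrow> (1 - \<tau>) * x < 1 \<Longrightarrow> x > 0 \<Longrightarrow> tau_tilt \<tau> x > 1"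
  using tau_tilt_strict_mono[of \<tau> x 0] by (simp add: tau_tilt_0)

text \<open>The tangent at \<open>tau_tilt \<tau> x\<close> has slope \<open>x > 0\<close>, so the
  entropy grows at least by \<open>x\<close> times the strict increase of the tilt.\<close>

lemma tau_entropy_tilt_less:
  assumes \<tau>: "0 \<le> \<tau>" "\<tau> \<le> 1" and y: "(1 - \<tau>) * y < 1" and x: "0 < x" "x < y"
  shows "tau_entropy \<tau> (tau_tilt \<tau> x) < tau_entropy \<tau> (tau_tilt \<tau> y)"
proof -
  have "(1 - \<tau>) * x \<le> (1 - \<tau>) * y" using \<tau> x by (intro mult_left_mono) auto
  then have x1: "(1 - \<tau>) * x < 1" using y by simp
  have "0 < x * (tau_tilt \<tau> y - tau_tilt \<tau> x)"
    using tau_tilt_strict_mono[OF \<tau>(2) y x(2)] x by simp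
  moreover have "tau_entropy \<tau> (tau_tilt \<tau> y) \<ge> tau_entropy \<tau> (tau_tilt \<tau> x) + x * (tau_tilt \<tau> y - tau_tilt \<tau> x)"
    using tau_entropy_tangent[OF \<tau> tau_tilt_pos[OF y] tau_tilt_pos[OF x1]] by (simp add: tau_slope_tilt[OF \<tau>(2) x1])
  ultimately show ?thesis by simp
qed

lemma tau_entropy_tilt_continuous:
  assumes \<tau>: "0 \<le> \<tau>" "\<tau> \<le> 1" and x: "(1 - \<tau>) * x < 1"
  shows "isCont (\<lambda>x. tau_entropy \<tau> (tau_tilt \<tau> x)) x"
proof -
  have "isCont (tau_tilt \<tau>) x"
  proof (cases "\<tau> < 1")
    case True
    then show ?thesis using x unfolding tau_tilt_def[abs_def]
      by (auto intro!: continuous_intros)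
  next
    case False
    then show ?thesis unfolding tau_tilt_def[abs_def] by (auto intro!: continuous_intros)
  qed
  then show ?thesis
    by (rule isCont_o2) (rule DERIV_isCont[OF tau_entropy_deriv[OF \<tau> tau_tilt_pos[OF x]]])
qed

text \<open>Existence is the intermediate value theorem: the sum vanishes at 0 and reaches
  \<open>c\<close> inside the domain because the term of the largest entry alone does. Uniqueness is
  strict growth of every term.\<close>

lemma tau_entropy_sum_unique_scale:
  fixes p :: "'n::finite \<Rightarrow> real"
  assumes \<tau>: "0 \<le> \<tau>" "\<tau> \<le> 1" and c: "c > 0" and p: "\<And>i. p i > 0"
  shows "\<exists>!\<theta>. \<theta> > 0 \<and> (\<forall>i. (1 - \<tau>) * (\<theta> * p i) < 1) \<and> c = (\<Sum>i\<in>UNIV. tau_entropy \<tau> (tau_tilt \<tau> (\<theta> * p i)))"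
    (is "\<exists>!\<theta>. \<theta> > 0 \<and> ?D \<theta> \<and> c = ?F \<theta>")
proof -
  have less: "?F a < ?F b" if "0 < a" "a < b" "?D b" for a b
  proof (rule sum_strict_mono)
    show "tau_entropy \<tau> (tau_tilt \<tau> (a * p i)) < tau_entropy \<tau> (tau_tilt \<tau> (b * p i))" for i
      using that p[of i] by (intro tau_entropy_tilt_less[OF \<tau>]) simp_all
  qed simp_all
  have "\<exists>\<theta>. \<theta> > 0 \<and> ?D \<theta> \<and> c = ?F \<theta>"
  proof -
    have fin: "finite (range p)" "range p \<noteq> {}" by auto
    obtain k where "Max (range p) = p k" using Max_in[OF fin] by (rule imageE)
    then have k: "p i \<le> p k" for i using Max_ge[OF fin(1), of "p i"] by simp
    have sl: "tau_slope \<tau> 2 > 0"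
      using powr_less_one[of 2 "\<tau> - 1"] by (simp add: tau_slope_def)
    \<comment> \<open>The tangent at 2 has positive slope; moving right by \<open>c\<close> over
      that slope raises it by \<open>c\<close>, starting from
      \<open>tau_entropy \<tau> 2 \<ge> 0\<close>.\<close>
    define s where "s = 2 + c / tau_slope \<tau> 2"
    have s: "s > 2" using c sl by (simp add: s_def)
    have hs: "tau_entropy \<tau> s \<ge> c"
      using tau_entropy_tangent[OF \<tau>, of s 2] tau_entropy_nonneg[OF \<tau>, of 2] s sl by (simp add: s_def)
    \<comment> \<open>At this scale the largest entry has tilt exactly \<open>s\<close>, so its term
      is at least \<open>c\<close>; the other products \<open>b * p i\<close> are no larger and stay
      in the domain.\<close>
    define b where "b = tau_slope \<tau> s / p k"
    have "tau_slope \<tau> s > 0" using tau_slope_mono[of 2 s \<tau>] sl s by simp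
    then have b: "b > 0" "b * p k = tau_slope \<tau> s" using p[of k] by (auto simp: b_def)
    have D: "?D a" if "0 \<le> a" "a \<le> b" for a
    proof
      fix i
      have "(1 - \<tau>) * (a * p i) \<le> (1 - \<tau>) * (b * p k)"
        using that \<tau> p[of i] k[of i] by (intro mult_left_mono mult_mono) auto
      also have "\<dots> < 1" using tau_slope_bound[OF \<tau>(2), of s] s b by simp
      finally show "(1 - \<tau>) * (a * p i) < 1" .
    qed
    have "c \<le> tau_entropy \<tau> (tau_tilt \<tau> (b * p k))"
      using hs s by (simp add: b tau_tilt_slope[OF \<tau>(2)])
    also have "\<dots> \<le> ?F b"
      using D[of b] b tau_entropy_nonneg[OF \<tau> tau_tilt_pos] by (intro member_le_sum) auto
    finally have "c \<le> ?F b" .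
    moreover have "?F 0 \<le> c" using c by (simp add: tau_tilt_0 tau_entropy_1[OF \<tau>])
    moreover have "\<forall>x. 0 \<le> x \<and> x \<le> b \<longrightarrow> isCont ?F x"
    proof (intro allI impI isCont_sum ballI)
      fix x i assume "0 \<le> x \<and> x \<le> b"
      then have "isCont (\<lambda>x. tau_entropy \<tau> (tau_tilt \<tau> x)) (x * p i)"
        using D by (intro tau_entropy_tilt_continuous[OF \<tau>]) simp
      moreover have "isCont (\<lambda>x. x * p i) x" by simp
      ultimately show "isCont (\<lambda>x. tau_entropy \<tau> (tau_tilt \<tau> (x * p i))) x"
        by (rule isCont_o2[rotated])
    qed
    ultimately have "\<exists>\<theta>\<ge>0. \<theta> \<le> b \<and> ?F \<theta> = c"
      using b(1) by (intro IVT) simp_all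
    then obtain \<theta> where \<theta>: "0 \<le> \<theta>" "\<theta> \<le> b" "?F \<theta> = c" by blast
    have "\<theta> \<noteq> 0"
    proof
      assume "\<theta> = 0"
      then show False using \<theta>(3) c by (simp add: tau_tilt_0 tau_entropy_1[OF \<tau>])
    qed
    with \<theta> have "\<theta> > 0 \<and> ?D \<theta> \<and> c = ?F \<theta>" using D[OF \<theta>(1,2)] by simp
    then show ?thesis ..
  qed
  moreover have "a = b" if "a > 0 \<and> ?D a \<and> c = ?F a" "b > 0 \<and> ?D b \<and> c = ?F b" for a b
  proof (rule linorder_cases[of a b])
    assume "a < b" then show ?thesis using less[of a b] that by simp
  next
    assume "b < a" then show ?thesis using less[of b a] that by simp
  qed
  ultimately show ?thesis by blast
qed

section \<open>Divergence and gamma in terms of eigenvalues\<close>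

text \<open>Keeps \<open>transpose A *v x\<close> in this form, on which
  \<open>inner_mult_transpose\<close> and associativity work; the simp rule would turn it into a row
  vector product.\<close>

declare transpose_matrix_vector [simp del]

text \<open>\<open>K' ** matrix_inv K\<close> need not be symmetric, but cyclicity of the trace and
  multiplicativity of the determinant give it the trace and determinant of the whitened matrix. So
  everything is a sum over the eigenvalues \<open>s\<close>.\<close>

lemma gauss_tau_div_eq:
  fixes K K' R :: "real^'n::finite^'n"
  assumes \<tau>: "0 \<le> \<tau>" "\<tau> \<le> 1" and K: "pos_def K"
    and R: "orthogonal_matrix R" and s: "\<And>i. s $ i > 0"
    and S: "matrix_inv (square_factor K) ** K' ** transpose (matrix_inv (square_factor K))
      = R ** diag_mat s ** transpose R"
  shows "gauss_tau_div \<tau> m' K' m K =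
    (if \<tau> < 1 then ereal ((norm (matrix_inv (square_factor K) *v (m' - m)))\<^sup>2 / (1 - \<tau>) + (\<Sum>i\<in>UNIV. tau_entropy \<tau> (s $ i)))
     else delta_infty (m' - m) + ereal (\<Sum>i\<in>UNIV. tau_entropy \<tau> (s $ i)))"
proof -
  define M where "M = matrix_inv (square_factor K)"
  have iK: "matrix_inv K = transpose M ** M"
    unfolding M_def using matrix_inv_factor[OF square_factor(2)[OF K]] square_factor(1)[OF K] by simp
  have S': "M ** K' ** transpose M = R ** diag_mat s ** transpose R"
    using S by (simp add: M_def)
  have "trace (K' ** matrix_inv K) = trace ((K' ** transpose M) ** M)"
    by (simp add: iK matrix_mul_assoc)
  also have "\<dots> = trace (M ** (K' ** transpose M))" by (rule trace_mul_sym)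
  also have "\<dots> = (\<Sum>i\<in>UNIV. s $ i)"
    by (simp add: matrix_mul_assoc S' trace_orthogonal_conj[OF R] trace_diag_mat)
  finally have tr: "trace (K' ** matrix_inv K) = (\<Sum>i\<in>UNIV. s $ i)" .
  have "det (K' ** matrix_inv K) = det (M ** K' ** transpose M)"
    by (simp add: iK det_mul)
  also have "\<dots> = (\<Prod>i\<in>UNIV. s $ i)"
    by (simp add: S' det_orthogonal_conj[OF R] det_diag_mat)
  finally have dt: "ln (det (K' ** matrix_inv K)) = (\<Sum>i\<in>UNIV. ln (s $ i))"
    using s by (simp add: ln_prod less_imp_neq[symmetric])
  have q: "v \<bullet> (matrix_inv K *v v) = (norm (M *v v))\<^sup>2" for v
  proof -
    have "v \<bullet> (matrix_inv K *v v) = v \<bullet> (transpose M *v (M *v v))"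
      by (simp only: iK matrix_vector_mul_assoc)
    also have "\<dots> = (M *v v) \<bullet> (M *v v)" by (simp only: inner_mult_transpose transpose_transpose)
    finally show ?thesis by (simp add: power2_norm_eq_inner)
  qed
  have f: "trace (mat_fun f (M ** K' ** transpose M)) = (\<Sum>i\<in>UNIV. f (s $ i))" for f
    by (simp add: S' mat_fun_eq[OF R] trace_orthogonal_conj[OF R] trace_diag_mat)
  have xlnx: "trace (M ** K' ** transpose M ** mat_ln (M ** K' ** transpose M)) = (\<Sum>i\<in>UNIV. s $ i * ln (s $ i))"
    by (simp add: S' mat_fun_eq[OF R] orthogonal_conj_mult[OF R] diag_mat_mult trace_orthogonal_conj[OF R] trace_diag_mat)
  consider "\<tau> = 0" | "0 < \<tau>" "\<tau> < 1" | "\<tau> = 1" using \<tau> by linarith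
  then show ?thesis
  proof cases
    case 1
    then show ?thesis
      by (simp add: gauss_tau_div_def M_def[symmetric] q tr dt trace_sub trace_I tau_entropy_def sum_subtractf)
  next
    case 2
    then show ?thesis
      by (simp add: gauss_tau_div_def Let_def M_def[symmetric] q tr f trace_sub trace_add trace_scaleR trace_I tau_entropy_def
          sum.distrib sum_distrib_left[symmetric] sum_negf sum_subtractf sum_divide_distrib[symmetric])
  next
    case 3
    then show ?thesis
      by (simp add: gauss_tau_div_def Let_def M_def[symmetric] tr xlnx trace_add trace_sub trace_I tau_entropy_def
          sum.distrib sum_subtractf)
  qed
qed

text \<open>Moves the affine argument into the scalar function, so that \<open>mat_fun_Gram\<close>
  applies to a function of the Gram matrix itself.\<close>

lemma mat_fun_tilt:
  fixes S :: "real^'n::finite^'n"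
  assumes "transpose S = S"
  shows "\<tau> < 1 \<Longrightarrow> mat_powr (mat 1 - (\<theta> * (1 - \<tau>)) *\<^sub>R S) a = mat_fun (\<lambda>x. (1 - (1 - \<tau>) * (\<theta> * x)) powr a) S"
    and "mat_exp (\<theta> *\<^sub>R S) = mat_fun (\<lambda>x. exp (\<theta> * x)) S"
proof -
  obtain R e where R: "orthogonal_matrix R" and S: "S = R ** diag_mat e ** transpose R"
    using symmetric_diagonalization[OF assms] by blast
  have "mat 1 - c *\<^sub>R S = R ** diag_mat (\<chi> i. 1 - c * e $ i) ** transpose R" for c
    using orthogonal_conj_affine[OF R, of 1 "- c" e] by (simp add: S)
  then show "mat_powr (mat 1 - (\<theta> * (1 - \<tau>)) *\<^sub>R S) a = mat_fun (\<lambda>x. (1 - (1 - \<tau>) * (\<theta> * x)) powr a) S"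
    by (simp add: mat_fun_eq[OF R]) (simp add: S mat_fun_eq[OF R] mult_ac)
  have "\<theta> *\<^sub>R S = R ** diag_mat (\<chi> i. \<theta> * e $ i) ** transpose R"
    using orthogonal_conj_affine[OF R, of 0 \<theta> e] by (simp add: S)
  then show "mat_exp (\<theta> *\<^sub>R S) = mat_fun (\<lambda>x. exp (\<theta> * x)) S"
    by (simp add: mat_fun_eq[OF R]) (simp add: S mat_fun_eq[OF R])
qed

lemma symmetric_Gram: "transpose (transpose L ** L) = transpose L ** (L :: real^'n::finite^'n)"
  by (simp add: matrix_transpose_mul)

text \<open>Each branch is the scalar entropy at the tilted eigenvalue: the power with exponent
  \<open>\<tau> / (\<tau> - 1)\<close> is the tilt raised to \<tau>, and
  \<open>exp x * (x - 1) + 1\<close> is \<open>t * ln t - t + 1\<close> at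
  \<open>t = exp x\<close>.\<close>

lemma gamma_tau_eq:
  fixes P :: "real^'n::finite^'n"
  assumes \<tau>: "0 \<le> \<tau>" "\<tau> \<le> 1" and P: "pos_def P"
    and Q: "orthogonal_matrix Q" "P = Q ** diag_mat p ** transpose Q"
    and \<theta>: "\<And>i. (1 - \<tau>) * (\<theta> * p $ i) < 1"
  shows "gamma_tau \<tau> P \<theta> = (\<Sum>i\<in>UNIV. tau_entropy \<tau> (tau_tilt \<tau> (\<theta> * p $ i)))"
proof -
  define L where "L = square_factor P"
  define S where "S = transpose L ** L"
  have L: "invertible L" "L ** transpose L = Q ** diag_mat p ** transpose Q"
    using square_factor[OF P] Q(2) by (simp_all add: L_def)
  have symS: "transpose S = S" unfolding S_def by (rule symmetric_Gram)
  have tr: "trace (mat_fun f S) = (\<Sum>i\<in>UNIV. f (p $ i))" for f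
    unfolding S_def by (rule mat_fun_Gram(1)[OF L(1) Q(1) L(2)])
  consider "\<tau> = 0" | "0 < \<tau>" "\<tau> < 1" | "\<tau> = 1" using \<tau> by linarith
  then show ?thesis
  proof cases
    case 1
    have pos: "1 - \<theta> * p $ i > 0" for i using \<theta>[of i] 1 by simp
    have "mat 1 - \<theta> *\<^sub>R P = Q ** diag_mat (\<chi> i. 1 - \<theta> * p $ i) ** transpose Q"
      using orthogonal_conj_affine[OF Q(1), of 1 "- \<theta>" p] by (simp add: Q(2))
    then have inv: "matrix_inv (mat 1 - \<theta> *\<^sub>R P) = Q ** diag_mat (\<chi> i. inverse (1 - \<theta> * p $ i)) ** transpose Q"
      using pos by (simp add: matrix_inv_orthogonal_diag[OF Q(1)] less_imp_neq[symmetric])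
    have tl: "tau_tilt 0 (\<theta> * p $ i) = inverse (1 - \<theta> * p $ i)" for i
      using 1 pos[of i] by (simp add: tau_tilt_def powr_minus)
    have nz: "inverse (1 - \<theta> * p $ i) \<noteq> 0" for i using pos[of i] by simp
    show ?thesis using 1 ln_prod[OF finite nz]
      by (simp add: gamma_tau_def inv trace_sub trace_I trace_orthogonal_conj[OF Q(1)] trace_diag_mat
          det_orthogonal_conj[OF Q(1)] det_diag_mat tl tau_entropy_def sum_subtractf)
  next
    case 2
    have e: "(1 - (1 - \<tau>) * (\<theta> * x)) powr (\<tau> / (\<tau> - 1)) = tau_tilt \<tau> (\<theta> * x) powr \<tau>" for x
      using 2 by (simp add: tau_tilt_def powr_powr)
    have e': "(1 - (1 - \<tau>) * (\<theta> * x)) powr (1 / (\<tau> - 1)) = tau_tilt \<tau> (\<theta> * x)" for x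
      using 2 by (simp add: tau_tilt_def)
    show ?thesis using 2
      by (simp add: gamma_tau_def Let_def L_def[symmetric] S_def[symmetric] mat_fun_tilt(1)[OF symS] e e' tr
          trace_sub trace_add trace_scaleR trace_I tau_entropy_def
          sum.distrib sum_distrib_left[symmetric] sum_negf sum_subtractf sum_divide_distrib[symmetric])
  next
    case 3
    obtain R e where R: "orthogonal_matrix R" and S: "S = R ** diag_mat e ** transpose R"
      using symmetric_diagonalization[OF symS] by blast
    have "\<theta> *\<^sub>R S - mat 1 = R ** diag_mat (\<chi> i. - 1 + \<theta> * e $ i) ** transpose R"
      using orthogonal_conj_affine[OF R, of "- 1" \<theta> e] by (simp add: S)
    moreover have "mat_exp (\<theta> *\<^sub>R S) = R ** diag_mat (\<chi> i. exp (\<theta> * e $ i)) ** transpose R"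
      unfolding mat_fun_tilt(2)[OF symS] by (simp add: S mat_fun_eq[OF R])
    ultimately have "mat_exp (\<theta> *\<^sub>R S) ** (\<theta> *\<^sub>R S - mat 1) = mat_fun (\<lambda>x. exp (\<theta> * x) * (- 1 + \<theta> * x)) S"
      by (simp add: orthogonal_conj_mult[OF R] diag_mat_mult) (simp add: S mat_fun_eq[OF R])
    then have "gamma_tau \<tau> P \<theta> = (\<Sum>i\<in>UNIV. exp (\<theta> * p $ i) * (- 1 + \<theta> * p $ i)) + real CARD('n)"
      using 3 by (simp add: gamma_tau_def Let_def L_def[symmetric] S_def[symmetric] trace_add tr trace_I)
    also have "\<dots> = (\<Sum>i\<in>UNIV. exp (\<theta> * p $ i) * (- 1 + \<theta> * p $ i) + 1)"
      by (simp add: sum.distrib)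
    finally show ?thesis using 3 by (simp add: tau_entropy_def tau_tilt_def algebra_simps)
  qed
qed

lemma tilted_covariance:
  fixes L :: "real^'n::finite^'n"
  assumes L: "invertible L" and Q: "orthogonal_matrix Q" and P: "L ** transpose L = Q ** diag_mat p ** transpose Q"
  shows "(if \<tau> < 1
       then L ** mat_powr (mat 1 - (\<theta> * (1 - \<tau>)) *\<^sub>R (transpose L ** L)) (1 / (\<tau> - 1)) ** transpose L
       else L ** mat_exp (\<theta> *\<^sub>R (transpose L ** L)) ** transpose L)
     = Q ** diag_mat (\<chi> i. p $ i * tau_tilt \<tau> (\<theta> * p $ i)) ** transpose Q"
  unfolding tau_tilt_def
  using mat_fun_Gram(2)[OF L Q P, of "\<lambda>x. (1 - (1 - \<tau>) * (\<theta> * x)) powr (1 / (\<tau> - 1))"]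
    mat_fun_Gram(2)[OF L Q P, of "\<lambda>x. exp (\<theta> * x)"]
  by (simp add: mat_fun_tilt[OF symmetric_Gram])

text \<open>The spectral norm is the largest eigenvalue \<open>p $ k\<close>, attained at column
  \<open>k\<close> of \<open>Q\<close>; the condition for it implies the condition for all
  others.\<close>

lemma spectral_norm_less_iff:
  fixes Q :: "real^'n::finite^'n"
  assumes Q: "orthogonal_matrix Q" and p: "\<And>i. p $ i > 0" and \<theta>: "\<theta> > 0" and \<tau>: "\<tau> \<le> 1"
  shows "inverse \<theta> > (1 - \<tau>) * spectral_norm (Q ** diag_mat p ** transpose Q)
     \<longleftrightarrow> (\<forall>i. (1 - \<tau>) * (\<theta> * p $ i) < 1)"
proof -
  let ?P = "Q ** diag_mat p ** transpose Q"
  have nP: "norm (?P *v x) = norm (diag_mat p *v (transpose Q *v x))" for x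
  proof -
    have "?P *v x = Q *v (diag_mat p *v (transpose Q *v x))"
      by (simp only: matrix_vector_mul_assoc matrix_mul_assoc)
    then show ?thesis by (simp only: norm_orthogonal_mult[OF Q])
  qed
  have nQ: "norm (transpose Q *v x) = norm x" for x
    using Q by (intro norm_orthogonal_mult) simp
  have fin: "finite (range (($) p))" "range (($) p) \<noteq> {}" by auto
  obtain k where "Max (range (($) p)) = p $ k" using Max_in[OF fin] by (rule imageE)
  then have k: "p $ i \<le> p $ k" for i using Max_ge[OF fin(1), of "p $ i"] by simp
  have "onorm ((*v) ?P) \<le> p $ k"
  proof (rule onorm_bound)
    fix x :: "real^'n"
    define y where "y = transpose Q *v x"
    have "norm (diag_mat p *v y) \<le> norm ((p $ k) *\<^sub>R y)"
      by (rule norm_le_componentwise_cart)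
        (use p k in \<open>simp add: diag_mat_vector abs_mult mult_right_mono less_imp_le\<close>)
    then show "norm (?P *v x) \<le> p $ k * norm x"
      using p[of k] by (simp add: nP nQ[of x, folded y_def] y_def[symmetric])
  qed (use p[of k] in simp)
  moreover have "p $ k \<le> onorm ((*v) ?P)"
  proof -
    define x where "x = Q *v axis k 1"
    have nx: "norm x = 1" by (simp add: x_def norm_orthogonal_mult[OF Q])
    have "transpose Q *v x = axis k 1"
      by (simp only: x_def matrix_vector_mul_assoc orthogonal_cancel[OF Q] matrix_vector_mul_lid)
    moreover have "diag_mat p *v axis k 1 = p $ k *\<^sub>R axis k 1"
      by (simp add: vec_eq_iff diag_mat_vector axis_def)
    ultimately have "norm (?P *v x) = p $ k" unfolding nP using p[of k] by simp
    then show ?thesis using onorm[OF matrix_vector_mul_bounded_linear, of ?P x] nx by simp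
  qed
  ultimately have n: "spectral_norm ?P = p $ k" by simp
  have "inverse \<theta> > (1 - \<tau>) * p $ k \<longleftrightarrow> (1 - \<tau>) * (\<theta> * p $ k) < 1"
    using \<theta> by (simp add: field_simps)
  also have "\<dots> \<longleftrightarrow> (\<forall>i. (1 - \<tau>) * (\<theta> * p $ i) < 1)"
  proof
    assume *: "(1 - \<tau>) * (\<theta> * p $ k) < 1"
    show "\<forall>i. (1 - \<tau>) * (\<theta> * p $ i) < 1"
    proof
      fix i
      have "(1 - \<tau>) * (\<theta> * p $ i) \<le> (1 - \<tau>) * (\<theta> * p $ k)"
        using \<theta> \<tau> k by (intro mult_left_mono) auto
      then show "(1 - \<tau>) * (\<theta> * p $ i) < 1" using * by simp
    qed
  qed blast
  finally show ?thesis by (simp add: n)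
qed

lemma tau_entropy_weighted_bound:
  fixes w :: "'n::finite \<Rightarrow> 'm::finite \<Rightarrow> real" and s :: "'m \<Rightarrow> real" and p :: "'n \<Rightarrow> real"
  assumes \<tau>: "0 \<le> \<tau>" "\<tau> \<le> 1" and s: "\<And>i. s i > 0"
    and dom: "\<And>j. (1 - \<tau>) * (\<theta> * p j) < 1"
    and w: "\<And>j i. w j i \<ge> 0" "\<And>j. (\<Sum>i\<in>UNIV. w j i) = 1" "\<And>i. (\<Sum>j\<in>UNIV. w j i) \<le> 1"
    and budget: "q + (\<Sum>i\<in>UNIV. tau_entropy \<tau> (s i)) \<le> (\<Sum>j\<in>UNIV. tau_entropy \<tau> (tau_tilt \<tau> (\<theta> * p j)))"
  shows "\<theta> * (\<Sum>j\<in>UNIV. p j * (\<Sum>i\<in>UNIV. w j i * s i)) + q \<le> \<theta> * (\<Sum>j\<in>UNIV. p j * tau_tilt \<tau> (\<theta> * p j))"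
proof -
  let ?h = "tau_entropy \<tau>" and ?t = "\<lambda>j. tau_tilt \<tau> (\<theta> * p j)"
  \<comment> \<open>The Fenchel-Young inequality for the entropy: \<open>\<theta> * p j\<close> is
    its slope at \<open>?t j\<close>.\<close>
  have tangent: "\<theta> * p j * s i \<le> \<theta> * p j * ?t j - ?h (?t j) + ?h (s i)" for i j
    using tau_entropy_tangent[OF \<tau> s[of i] tau_tilt_pos[OF dom[of j]]] tau_slope_tilt[OF \<tau>(2) dom[of j]]
    by (simp add: algebra_simps)
  have "\<theta> * (\<Sum>j\<in>UNIV. p j * (\<Sum>i\<in>UNIV. w j i * s i)) = (\<Sum>j\<in>UNIV. \<Sum>i\<in>UNIV. w j i * (\<theta> * p j * s i))"
    by (simp add: sum_distrib_left mult_ac)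
  also have "\<dots> \<le> (\<Sum>j\<in>UNIV. \<Sum>i\<in>UNIV. w j i * (\<theta> * p j * ?t j - ?h (?t j) + ?h (s i)))"
    by (intro sum_mono mult_left_mono tangent w)
  also have "\<dots> = (\<Sum>j\<in>UNIV. (\<Sum>i\<in>UNIV. w j i) * (\<theta> * p j * ?t j - ?h (?t j)) + (\<Sum>i\<in>UNIV. w j i * ?h (s i)))"
    by (simp only: distrib_left sum.distrib sum_distrib_right)
  also have "\<dots> = (\<Sum>j\<in>UNIV. \<theta> * p j * ?t j) - (\<Sum>j\<in>UNIV. ?h (?t j)) + (\<Sum>i\<in>UNIV. (\<Sum>j\<in>UNIV. w j i) * ?h (s i))"
  proof -
    have "(\<Sum>j\<in>UNIV. \<Sum>i\<in>UNIV. w j i * ?h (s i)) = (\<Sum>i\<in>UNIV. (\<Sum>j\<in>UNIV. w j i) * ?h (s i))"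
      by (subst sum.swap) (simp only: sum_distrib_right)
    then show ?thesis by (simp only: w sum.distrib sum_subtractf mult_1)
  qed
  \<comment> \<open>The weights on one eigenvalue may total less than 1; filling them up only
    increases the sum because the entropy is nonnegative.\<close>
  also have "\<dots> \<le> (\<Sum>j\<in>UNIV. \<theta> * p j * ?t j) - (\<Sum>j\<in>UNIV. ?h (?t j)) + (\<Sum>i\<in>UNIV. 1 * ?h (s i))"
    by (intro add_left_mono sum_mono mult_right_mono w tau_entropy_nonneg[OF \<tau> s])
  also have "\<dots> \<le> (\<Sum>j\<in>UNIV. \<theta> * p j * ?t j) - q" using budget by simp
  finally show ?thesis by (simp add: sum_distrib_left mult_ac)
qed

section \<open>Splitting off the estimation error\<close>

lemma norm_squared_vec: "(norm (v :: real^'n::finite))\<^sup>2 = (\<Sum>j\<in>UNIV. (v $ j)\<^sup>2)"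
  unfolding power2_norm_eq_inner by (simp add: inner_vec_def power2_eq_square)

lemma norm_coisometry_le:
  fixes U :: "real^'m::finite^'n::finite"
  assumes "U ** transpose U = mat 1"
  shows "norm (U *v x) \<le> norm x"
proof -
  define y where "y = transpose U *v (U *v x)"
  have "y \<bullet> y = (U *v x) \<bullet> (U *v (transpose U *v (U *v x)))"
    unfolding y_def by (simp only: inner_mult_transpose transpose_transpose)
  also have "\<dots> = (U *v x) \<bullet> (U *v x)"
    by (simp only: matrix_vector_mul_assoc[of U "transpose U"] assms matrix_vector_mul_lid)
  finally have yy: "y \<bullet> y = (U *v x) \<bullet> (U *v x)" .
  have "x \<bullet> y = (U *v x) \<bullet> (U *v x)"
    unfolding y_def by (simp only: inner_mult_transpose transpose_transpose)
  then have "(x - y) \<bullet> (x - y) = x \<bullet> x - (U *v x) \<bullet> (U *v x)"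
    using yy by (simp add: inner_diff_left inner_diff_right inner_commute)
  then have "(U *v x) \<bullet> (U *v x) \<le> x \<bullet> x" using inner_ge_zero[of "x - y"] by linarith
  then show ?thesis by (simp add: norm_le)
qed

text \<open>Every vector decomposes as \<open>z = F (W z) + N (E z)\<close>, where \<open>W z\<close> is the estimation error and \<open>E z\<close>
  the observation. A covariance for which the two are uncorrelated has the form \<open>cov X Y\<close> below.\<close>

locale block_split =
  fixes F :: "real^'n::finite^'m::finite" and N :: "real^'p::finite^'m"
    and W :: "real^'m^'n" and E :: "real^'m^'p"
  assumes WF: "W ** F = mat 1" and WN: "W ** N = 0" and EF: "E ** F = 0" and EN: "E ** N = mat 1"
    and FWNE: "F ** W + N ** E = mat 1"
begin

definition cov :: "real^'n^'n \<Rightarrow> real^'p^'p \<Rightarrow> real^'m^'m" where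
  "cov X Y = F ** X ** transpose F + N ** Y ** transpose N"

lemma transposed:
  "transpose F ** transpose W = mat 1" "transpose N ** transpose W = 0"
  "transpose F ** transpose E = 0" "transpose N ** transpose E = mat 1"
  by (simp_all only: matrix_transpose_mul[symmetric] WF WN EF EN) (simp_all add: transpose_def vec_eq_iff mat_def)

lemma cancel:
  fixes A :: "real^'n^'a::finite" and B :: "real^'p^'a"
  shows "A ** W ** F = A" "A ** W ** N = 0" "B ** E ** F = 0" "B ** E ** N = B"
    "A ** transpose F ** transpose W = A" "B ** transpose N ** transpose W = 0"
    "A ** transpose F ** transpose E = 0" "B ** transpose N ** transpose E = B"
  by (simp_all add: matrix_mul_assoc[symmetric] WF WN EF EN transposed)

lemma cov_W: "cov X Y ** transpose W = F ** X"
  by (simp add: cov_def matrix_mul_add_left cancel)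

lemma W_cov_W: "W ** cov X Y ** transpose W = X"
  by (simp add: matrix_mul_assoc[symmetric] cov_W) (simp add: matrix_mul_assoc WF)

lemma cov_pos_def:
  assumes X: "pos_def X" and Y: "pos_def Y"
  shows "pos_def (cov X Y)"
  unfolding pos_def_def
proof (intro conjI allI impI)
  show "transpose (cov X Y) = cov X Y"
    using X Y by (simp add: cov_def pos_def_def transpose_add matrix_transpose_mul matrix_mul_assoc)
  fix z :: "real^'m" assume z: "z \<noteq> 0"
  let ?x = "transpose F *v z" and ?y = "transpose N *v z"
  have "z \<bullet> ((F ** X ** transpose F) *v z) = z \<bullet> (F *v (X *v ?x))"
    by (simp only: matrix_vector_mul_assoc matrix_mul_assoc)
  moreover have "z \<bullet> ((N ** Y ** transpose N) *v z) = z \<bullet> (N *v (Y *v ?y))"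
    by (simp only: matrix_vector_mul_assoc matrix_mul_assoc)
  ultimately have q: "z \<bullet> (cov X Y *v z) = ?x \<bullet> (X *v ?x) + ?y \<bullet> (Y *v ?y)"
    by (simp add: cov_def matrix_vector_mult_add_rdistrib inner_add_right inner_mult_transpose)
  have "transpose (F ** W + N ** E) *v z = z" by (simp add: FWNE)
  then have "transpose W *v ?x + transpose E *v ?y = z"
    by (simp add: transpose_add matrix_transpose_mul matrix_vector_mult_add_rdistrib matrix_vector_mul_assoc)
  then have "?x \<noteq> 0 \<or> ?y \<noteq> 0" using z by auto
  moreover have "?x \<bullet> (X *v ?x) \<ge> 0" "?x \<noteq> 0 \<Longrightarrow> ?x \<bullet> (X *v ?x) > 0"
    using X by (cases "?x = 0"; auto simp: pos_def_def less_imp_le)+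
  moreover have "?y \<bullet> (Y *v ?y) \<ge> 0" "?y \<noteq> 0 \<Longrightarrow> ?y \<bullet> (Y *v ?y) > 0"
    using Y by (cases "?y = 0"; auto simp: pos_def_def less_imp_le)+
  ultimately show "0 < z \<bullet> (cov X Y *v z)"
    unfolding q by (auto intro: add_pos_nonneg add_nonneg_pos)
qed

lemma cov_inverse:
  assumes X: "pos_def X" and Y: "pos_def Y"
  shows "matrix_inv (cov X Y) = transpose W ** matrix_inv X ** W + transpose E ** matrix_inv Y ** E"
proof (rule matrix_inv_unique_right)
  note inv = matrix_inv_right[OF pos_def_invertible[OF X]] matrix_inv_right[OF pos_def_invertible[OF Y]]
  have "F ** X ** matrix_inv X = F" "N ** Y ** matrix_inv Y = N"
    by (simp_all add: matrix_mul_assoc[symmetric] inv)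
  then show "cov X Y ** (transpose W ** matrix_inv X ** W + transpose E ** matrix_inv Y ** E) = mat 1"
    by (simp add: cov_def matrix_mul_add_left matrix_mul_add_right matrix_mul_assoc cancel FWNE)
qed

text \<open>The Gaussian exponent separates into an error part and an observation part. This yields
  both the conditional density and the effect of the exponential tilt.\<close>

lemma cov_inverse_quadratic:
  assumes X: "pos_def X" and Y: "pos_def Y"
  shows "z \<bullet> (matrix_inv (cov X Y) *v z)
     = (W *v z) \<bullet> (matrix_inv X *v (W *v z)) + (E *v z) \<bullet> (matrix_inv Y *v (E *v z))"
proof -
  have "z \<bullet> ((transpose W ** matrix_inv X ** W) *v z) = z \<bullet> (transpose W *v (matrix_inv X *v (W *v z)))"
    by (simp only: matrix_vector_mul_assoc matrix_mul_assoc)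
  moreover have "z \<bullet> ((transpose E ** matrix_inv Y ** E) *v z) = z \<bullet> (transpose E *v (matrix_inv Y *v (E *v z)))"
    by (simp only: matrix_vector_mul_assoc matrix_mul_assoc)
  ultimately show ?thesis
    by (simp add: cov_inverse[OF X Y] matrix_vector_mult_add_rdistrib inner_add_right inner_mult_transpose)
qed

text \<open>The reflection \<open>z \<mapsto> z - 2 F W z\<close> preserves the Gaussian and the second block and flips the
  sign of the residual, so the cross term between the residual and any function of the
  second block averages out.\<close>

lemma residual_optimal:
  assumes X: "pos_def X" and Y: "pos_def Y" and [measurable]: "d \<in> borel_measurable borel"
  shows "(\<integral>\<^sup>+z. ennreal (gauss_density m (cov X Y) z) * ennreal ((norm (W *v (z - m)))\<^sup>2) \<partial>lborel)
    \<le> (\<integral>\<^sup>+z. ennreal (gauss_density m (cov X Y) z) * ennreal ((norm (W *v (z - m) + d (E *v z)))\<^sup>2) \<partial>lborel)"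
    (is "?A \<le> ?B")
proof -
  let ?g = "\<lambda>z. ennreal (gauss_density m (cov X Y) z)"
  \<comment> \<open>The reflection: it negates the range of \<open>F\<close>, fixes that of
    \<open>N\<close>, and squares to the identity.\<close>
  define M where "M = mat 1 - (F ** W + F ** W)"
  have "M ** F = F - (F + F)"
    by (simp only: M_def matrix_mul_diff_left matrix_mul_add_left cancel matrix_mul_lid)
  then have MF: "M ** F = - F" by simp
  have MN: "M ** N = N"
    by (simp only: M_def matrix_mul_diff_left matrix_mul_add_left cancel matrix_mul_lid) simp
  have "W ** M = W - (W + W)"
    by (simp only: M_def matrix_mul_diff_right matrix_mul_add_right matrix_mul_assoc WF matrix_mul_lid matrix_mul_rid)
  then have WM: "W ** M = - W" by simp
  have "0 ** W = (0 :: real^'m^'p)" by (simp add: matrix_matrix_mult_def vec_eq_iff)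
  then have EM: "E ** M = E"
    by (simp only: M_def matrix_mul_diff_right matrix_mul_add_right matrix_mul_assoc EF matrix_mul_rid) simp
  have neg: "(- A) ** B = - (A ** B)" "A ** (- B) = - (A ** B)"
    for A :: "real^'b::finite^'a::finite" and B :: "real^'c::finite^'b"
    using matrix_mul_diff_left[of 0 A B] matrix_mul_diff_right[of A 0 B] by simp_all
  have "M ** M = M - (M ** F ** W + M ** F ** W)"
    by (subst (2) M_def) (simp only: matrix_mul_diff_right matrix_mul_add_right matrix_mul_assoc matrix_mul_rid)
  then have "M ** M = M + (F ** W + F ** W)" by (simp only: MF neg) simp
  then have MM: "M ** M = mat 1" by (simp add: M_def)
  then have invM: "invertible M" by (auto simp: invertible_def)
  have neg_t: "transpose (- F) = - transpose F" by (simp add: transpose_def vec_eq_iff)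
  have "M ** cov X Y ** transpose M
      = (M ** F) ** X ** transpose (M ** F) + (M ** N) ** Y ** transpose (M ** N)"
    by (simp add: cov_def matrix_mul_add_left matrix_mul_add_right matrix_transpose_mul matrix_mul_assoc)
  then have Mcov: "M ** cov X Y ** transpose M = cov X Y"
    by (simp add: MF MN neg neg_t cov_def)
  have W': "W *v (M *v u) = - (W *v u)" and E': "E *v (M *v u) = E *v u" for u
    using matrix_vector_mult_diff_rdistrib[of 0 W u]
    by (simp_all add: matrix_vector_mul_assoc WM EM)
  have "?B = (\<integral>\<^sup>+z. ?g z * ennreal ((norm (W *v ((m + M *v (z - m)) - m) + d (E *v (m + M *v (z - m)))))\<^sup>2) \<partial>lborel)"
    by (rule nn_integral_gauss_reflect[OF cov_pos_def[OF X Y] invM Mcov, symmetric]) measurable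
  also have "\<dots> = (\<integral>\<^sup>+z. ?g z * ennreal ((norm (- (W *v (z - m)) + d (E *v z)))\<^sup>2) \<partial>lborel)"
    by (simp add: W' E' matrix_vector_right_distrib matrix_vector_mult_diff_distrib)
  finally have B: "?B = \<dots>" .
  \<comment> \<open>Parallelogram law: the cross terms of the two reflected integrands cancel in
    their sum.\<close>
  have par: "(norm (a + b))\<^sup>2 + (norm (- a + b))\<^sup>2 = (norm a)\<^sup>2 + (norm a)\<^sup>2 + 2 * (norm b)\<^sup>2" for a b :: "real^'n"
    by (simp add: power2_norm_eq_inner inner_add_left inner_add_right inner_diff_left inner_diff_right inner_commute)
  have split: "(\<integral>\<^sup>+z. ?g z * ennreal (a z + b z) \<partial>lborel)
      = (\<integral>\<^sup>+z. ?g z * ennreal (a z) \<partial>lborel) + (\<integral>\<^sup>+z. ?g z * ennreal (b z) \<partial>lborel)"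
    if [measurable]: "a \<in> borel_measurable borel" "b \<in> borel_measurable borel" and "\<And>z. a z \<ge> 0" "\<And>z. b z \<ge> 0"
    for a b :: "real^'m \<Rightarrow> real"
    using that(3,4) by (simp add: ennreal_plus distrib_left nn_integral_add del: ennreal_plus[symmetric])
  have meas: "(\<lambda>z. (norm (W *v (z - m)))\<^sup>2) \<in> borel_measurable borel"
    "(\<lambda>z. (norm (W *v (z - m) + d (E *v z)))\<^sup>2) \<in> borel_measurable borel"
    "(\<lambda>z. (norm (- (W *v (z - m)) + d (E *v z)))\<^sup>2) \<in> borel_measurable borel"
    by measurable
  \<comment> \<open>The argument only adds and never subtracts, since \<open>?B\<close> may be
    infinite.\<close>
  have "?A + ?A = (\<integral>\<^sup>+z. ?g z * ennreal ((norm (W *v (z - m)))\<^sup>2 + (norm (W *v (z - m)))\<^sup>2) \<partial>lborel)"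
    by (rule split[OF meas(1) meas(1), symmetric]) (rule zero_le_power2)+
  also have "\<dots> \<le> (\<integral>\<^sup>+z. ?g z * ennreal ((norm (W *v (z - m) + d (E *v z)))\<^sup>2 + (norm (- (W *v (z - m)) + d (E *v z)))\<^sup>2) \<partial>lborel)"
    unfolding par by (intro nn_integral_mono mult_left_mono ennreal_leI) auto
  also have "\<dots> = ?B + (\<integral>\<^sup>+z. ?g z * ennreal ((norm (- (W *v (z - m)) + d (E *v z)))\<^sup>2) \<partial>lborel)"
    by (rule split[OF meas(2) meas(3)]) (rule zero_le_power2)+
  also have "\<dots> = ?B + ?B" by (simp only: B[symmetric])
  finally have "?A + ?A \<le> ?B + ?B" .
  then show ?thesis using add_strict_mono[of ?B ?A ?B ?A] by (meson not_le)
qed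

section \<open>Whitened coordinates for the error map\<close>

context
  fixes Q :: "real^'n^'n" and p :: "real^'n" and Y :: "real^'p^'p" and Lk :: "real^'m^'m"
  assumes Q: "orthogonal_matrix Q" and p: "\<And>i. p $ i > 0"
    and Lk: "invertible Lk" "cov (Q ** diag_mat p ** transpose Q) Y = Lk ** transpose Lk"
begin

text \<open>\<open>L0\<close> is a factor of the error covariance and \<open>L1\<close> its inverse;
  \<open>U\<close> is the error map between the coordinates whitened by \<open>Lk\<close> and by
  \<open>L0\<close>.\<close>

private definition "L0 = Q ** diag_mat (\<chi> i. sqrt (p $ i))"
private definition "L1 = diag_mat (\<chi> i. inverse (sqrt (p $ i))) ** transpose Q"
private definition "U = L1 ** W ** Lk"

private lemma L0L1: "L0 ** L1 = mat 1" "L1 ** L0 = mat 1"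
proof -
  have "diag_mat (\<chi> i. sqrt (p $ i)) ** diag_mat (\<chi> i. inverse (sqrt (p $ i))) = mat 1"
    using p by (simp add: diag_mat_mult diag_mat_1 less_imp_neq[symmetric])
  then have "L0 ** L1 = Q ** mat 1 ** transpose Q"
    unfolding L0_def L1_def by (metis matrix_mul_assoc)
  then show "L0 ** L1 = mat 1" by (simp add: orthogonal_cancel[OF Q])
  then show "L1 ** L0 = mat 1" using matrix_left_right_inverse by blast
qed

private lemma L1_conj: "L1 ** (Q ** diag_mat d ** transpose Q) ** transpose L1 = diag_mat (\<chi> i. d $ i / p $ i)"
proof -
  have "L1 ** (Q ** diag_mat d ** transpose Q) ** transpose L1
     = diag_mat (\<chi> i. inverse (sqrt (p $ i))) ** diag_mat d ** diag_mat (\<chi> i. inverse (sqrt (p $ i)))"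
    by (simp add: L1_def matrix_transpose_mul matrix_mul_assoc orthogonal_cancel[OF Q])
  also have "\<dots> = diag_mat (\<chi> i. d $ i / p $ i)"
  proof -
    have "inverse (sqrt (p $ i)) * d $ i * inverse (sqrt (p $ i)) = d $ i / p $ i" for i
    proof -
      have "inverse (sqrt (p $ i)) * d $ i * inverse (sqrt (p $ i)) = d $ i / (sqrt (p $ i) * sqrt (p $ i))"
        by (simp only: divide_inverse inverse_mult_distrib mult_ac)
      moreover have "sqrt (p $ i) * sqrt (p $ i) = p $ i" using p[of i] by simp
      ultimately show ?thesis by simp
    qed
    then show ?thesis by (simp add: diag_mat_mult)
  qed
  finally show ?thesis .
qed

private lemma W_Lk: "W ** Lk = L0 ** U"
  by (simp add: U_def matrix_mul_assoc L0L1)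

text \<open>The error has nominal covariance \<open>L0 ** transpose L0\<close>, so its whitened
  covariance is the identity.\<close>

private lemma UU: "U ** transpose U = mat 1"
proof -
  have "U ** transpose U = L1 ** (W ** (Lk ** transpose Lk) ** transpose W) ** transpose L1"
    by (simp add: U_def matrix_transpose_mul matrix_mul_assoc)
  also have "\<dots> = diag_mat (\<chi> i. p $ i / p $ i)"
    by (simp only: Lk(2)[symmetric] W_cov_W L1_conj)
  also have "\<dots> = mat 1" using p by (simp add: diag_mat_1 less_imp_neq[symmetric])
  finally show ?thesis .
qed

text \<open>By \<open>cov_W\<close>, \<open>F\<close> times the error covariance is the covariance
  of the whole vector with the error; written in factors this reads
  \<open>F ** L0 = Lk ** transpose U\<close>.\<close>

private lemma inv_Lk_F: "matrix_inv Lk ** F = transpose U ** L1"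
proof -
  let ?P = "Q ** diag_mat p ** transpose Q"
  have "L0 ** transpose L0 = Q ** (diag_mat (\<chi> i. sqrt (p $ i)) ** diag_mat (\<chi> i. sqrt (p $ i))) ** transpose Q"
    by (simp add: L0_def matrix_transpose_mul matrix_mul_assoc)
  also have "\<dots> = ?P" using p by (simp add: diag_mat_mult less_imp_le)
  finally have P: "?P = L0 ** transpose L0" ..
  have "F ** ?P = Lk ** (transpose Lk ** transpose W)"
    using cov_W[of ?P Y] by (simp add: Lk(2) matrix_mul_assoc)
  also have "\<dots> = Lk ** transpose U ** transpose L0"
    by (simp add: matrix_transpose_mul[symmetric] W_Lk) (simp add: matrix_transpose_mul matrix_mul_assoc)
  finally have "F ** L0 ** transpose L0 = Lk ** transpose U ** transpose L0"
    by (simp add: P matrix_mul_assoc)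
  then have "F ** L0 ** (transpose L0 ** transpose L1) = Lk ** transpose U ** (transpose L0 ** transpose L1)"
    by (simp add: matrix_mul_assoc)
  then have FL: "F ** L0 = Lk ** transpose U"
    by (simp add: matrix_transpose_mul[symmetric] L0L1)
  have "matrix_inv Lk ** F = matrix_inv Lk ** (F ** L0) ** L1"
    by (simp add: matrix_mul_assoc[symmetric] L0L1)
  also have "\<dots> = transpose U ** L1"
    by (simp add: FL matrix_mul_assoc matrix_inv_left[OF Lk(1)])
  finally show ?thesis .
qed

text \<open>The whitened matrix is \<open>1 - U\<^sup>T U + U\<^sup>T diag(t) U\<close> with \<open>U U\<^sup>T = 1\<close>. Functional calculus respects
  this splitting, and the first part contributes only \<open>h 1\<close>.\<close>

lemma whitened_cov:
  fixes t :: "real^'n" and h :: "real \<Rightarrow> real"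
  defines "S \<equiv> matrix_inv Lk ** cov (Q ** diag_mat (\<chi> i. p $ i * t $ i) ** transpose Q) Y ** transpose (matrix_inv Lk)"
  assumes h: "h 1 = 0" and R: "orthogonal_matrix R" "S = R ** diag_mat s ** transpose R"
  shows "(\<Sum>i\<in>UNIV. h (s $ i)) = (\<Sum>j\<in>UNIV. h (t $ j))"
proof -
  let ?P = "Q ** diag_mat p ** transpose Q" and ?V = "Q ** diag_mat (\<chi> i. p $ i * t $ i) ** transpose Q"
  \<comment> \<open>The orthogonal projection onto the kernel of \<open>U\<close>, where the
    whitened matrix acts as the identity.\<close>
  define Z where "Z = mat 1 - transpose U ** U"
  have UtL: "B ** U ** transpose U = B" for B :: "real^'n^'a::finite"
    by (simp add: matrix_mul_assoc[symmetric] UU)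
  \<comment> \<open>Tilted and nominal covariance differ only in the error block, so after whitening
    they differ only on the range of \<open>transpose U\<close>.\<close>
  have "cov ?V Y = cov ?P Y + F ** (?V - ?P) ** transpose F"
    by (simp add: cov_def matrix_mul_diff_left matrix_mul_diff_right)
  then have "S = matrix_inv Lk ** (Lk ** transpose Lk) ** transpose (matrix_inv Lk)
      + (matrix_inv Lk ** F) ** (?V - ?P) ** transpose (matrix_inv Lk ** F)"
    by (simp add: S_def Lk(2) matrix_mul_add_left matrix_mul_add_right matrix_transpose_mul matrix_mul_assoc)
  also have "matrix_inv Lk ** (Lk ** transpose Lk) ** transpose (matrix_inv Lk)
      = (matrix_inv Lk ** Lk) ** transpose (matrix_inv Lk ** Lk)"
    by (simp add: matrix_transpose_mul matrix_mul_assoc)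
  also have "\<dots> = mat 1" by (simp add: matrix_inv_left[OF Lk(1)])
  also have "(matrix_inv Lk ** F) ** (?V - ?P) ** transpose (matrix_inv Lk ** F)
      = transpose U ** (L1 ** ?V ** transpose L1 - L1 ** ?P ** transpose L1) ** U"
    unfolding inv_Lk_F
    by (simp add: matrix_transpose_mul matrix_mul_diff_left matrix_mul_diff_right matrix_mul_assoc)
  also have "L1 ** ?V ** transpose L1 = diag_mat t"
    using p by (simp add: L1_conj less_imp_neq[symmetric])
  also have "L1 ** ?P ** transpose L1 = mat 1"
    using p by (simp add: L1_conj diag_mat_1 less_imp_neq[symmetric])
  finally have S: "S = Z + transpose U ** diag_mat t ** U"
    by (simp add: Z_def matrix_mul_diff_left matrix_mul_diff_right)
  have ZU: "Z ** transpose U = 0"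
    by (simp add: Z_def matrix_mul_diff_left matrix_mul_assoc[symmetric] UU)
  have UZ: "U ** Z = 0"
    by (simp add: Z_def matrix_mul_diff_right matrix_mul_assoc UU)
  have ZZ: "Z ** Z = Z"
    by (subst (1) Z_def) (simp add: matrix_mul_diff_left matrix_mul_assoc[symmetric] UZ)
  have symS: "transpose S = S" by (simp add: R(2) symmetric_orthogonal_diag)
  have "S ** transpose U = transpose U ** diag_mat t"
    by (simp add: S matrix_mul_add_left ZU UtL)
  then have f1: "mat_fun h S ** transpose U = transpose U ** mat_fun h (diag_mat t)"
    by (intro mat_fun_intertwine symS) simp_all
  have "S ** Z = Z ** mat 1"
    by (simp add: S matrix_mul_add_left ZZ) (simp add: matrix_mul_assoc[symmetric] UZ)
  then have f2: "mat_fun h S ** Z = Z ** mat_fun h (mat 1)"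
    by (intro mat_fun_intertwine symS) simp_all
  have o1: "orthogonal_matrix (mat 1 :: real^'a::finite^'a)" by (simp add: orthogonal_matrix_def)
  have hd: "mat_fun h (diag_mat d) = diag_mat (\<chi> i. h (d $ i))" for d :: "real^'a::finite"
    using mat_fun_eq[OF o1, of h d] by simp
  have h1: "mat_fun h (mat 1 :: real^'m^'m) = 0"
    unfolding diag_mat_1[symmetric] hd by (simp add: h) (simp add: diag_mat_def vec_eq_iff)
  \<comment> \<open>The two intertwining relations evaluate \<open>mat_fun h S\<close> on the two
    pieces; on the range of \<open>Z\<close> it is multiplication by \<open>h 1\<close>, which is
    zero.\<close>
  have "mat_fun h S = mat_fun h S ** (Z + transpose U ** U)"
    by (simp add: Z_def)
  also have "\<dots> = transpose U ** diag_mat (\<chi> i. h (t $ i)) ** U"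
    by (simp add: matrix_mul_add_right matrix_mul_assoc f1 f2 h1 hd)
  also have "trace \<dots> = trace (U ** (transpose U ** diag_mat (\<chi> i. h (t $ i))))"
    by (rule trace_mul_sym)
  also have "\<dots> = (\<Sum>j\<in>UNIV. h (t $ j))"
    by (simp add: matrix_mul_assoc UU trace_diag_mat)
  finally have "trace (mat_fun h S) = (\<Sum>j\<in>UNIV. h (t $ j))" .
  then show ?thesis
    by (simp add: R(2) mat_fun_eq[OF R(1)] trace_orthogonal_conj[OF R(1)] trace_diag_mat)
qed

text \<open>For \<open>\<tau> = 1\<close> a mean shift \<open>\<delta> \<noteq> 0\<close> has infinite divergence; otherwise \<open>\<theta> (1 - \<tau>) p \<le> 1\<close> makes
  its cost \<open>q\<close> outweigh the gain in variance.\<close>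

lemma residual_variance_bound:
  fixes K' R :: "real^'m^'m" and s \<delta> :: "real^'m"
  assumes \<tau>: "0 \<le> \<tau>" "\<tau> \<le> 1" and \<theta>: "\<theta> > 0" and dom: "\<And>j. (1 - \<tau>) * (\<theta> * p $ j) < 1"
    and R: "orthogonal_matrix R" "matrix_inv Lk ** K' ** transpose (matrix_inv Lk) = R ** diag_mat s ** transpose R"
    and s: "\<And>i. s $ i > 0"
    and q: "if \<tau> < 1 then q = (norm (matrix_inv Lk *v \<delta>))\<^sup>2 / (1 - \<tau>) else q = 0 \<and> \<delta> = 0"
    and budget: "q + (\<Sum>i\<in>UNIV. tau_entropy \<tau> (s $ i)) \<le> (\<Sum>j\<in>UNIV. tau_entropy \<tau> (tau_tilt \<tau> (\<theta> * p $ j)))"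
  shows "trace (W ** K' ** transpose W) + (norm (W *v \<delta>))\<^sup>2 \<le> (\<Sum>j\<in>UNIV. p $ j * tau_tilt \<tau> (\<theta> * p $ j))"
proof -
  \<comment> \<open>The rows are the whitened error directions expressed in the eigenbasis of the
    competitor; their squared entries are the weights.\<close>
  define X where "X = U ** R"
  have XX: "X ** transpose X = mat 1"
    by (simp add: X_def matrix_transpose_mul matrix_mul_assoc orthogonal_cancel[OF R(1)] UU)
  have row: "(\<Sum>i\<in>UNIV. (X $ j $ i)\<^sup>2) = 1" for j
  proof -
    have "(X ** transpose X) $ j $ j = (1::real)" by (simp add: XX mat_def)
    then show ?thesis by (simp add: matrix_matrix_mult_def transpose_def power2_eq_square)
  qed
  have col: "(\<Sum>j\<in>UNIV. (X $ j $ i)\<^sup>2) \<le> 1" for i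
  proof -
    have "X *v axis i 1 = column i X" by (simp add: matrix_vector_mult_basis)
    then have "(norm (column i X))\<^sup>2 \<le> 1"
      using norm_coisometry_le[OF XX, of "axis i 1"] by (simp add: power_le_one)
    then show ?thesis by (simp add: norm_squared_vec column_def)
  qed
  have "\<theta> * (\<Sum>j\<in>UNIV. p $ j * (\<Sum>i\<in>UNIV. (X $ j $ i)\<^sup>2 * s $ i)) + q
      \<le> \<theta> * (\<Sum>j\<in>UNIV. p $ j * tau_tilt \<tau> (\<theta> * p $ j))"
    by (rule tau_entropy_weighted_bound[OF \<tau> s dom]) (use row col budget in auto)
  moreover have "trace (W ** K' ** transpose W) = (\<Sum>j\<in>UNIV. p $ j * (\<Sum>i\<in>UNIV. (X $ j $ i)\<^sup>2 * s $ i))"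
  proof -
    have "K' = (Lk ** matrix_inv Lk) ** K' ** transpose (Lk ** matrix_inv Lk)"
      by (simp add: matrix_inv_right[OF Lk(1)])
    also have "\<dots> = Lk ** (matrix_inv Lk ** K' ** transpose (matrix_inv Lk)) ** transpose Lk"
      by (simp add: matrix_transpose_mul matrix_mul_assoc)
    finally have K': "K' = Lk ** (R ** diag_mat s ** transpose R) ** transpose Lk" by (simp only: R(2))
    have "W ** K' ** transpose W = (W ** Lk) ** (R ** diag_mat s ** transpose R) ** transpose (W ** Lk)"
      by (subst K') (simp add: matrix_transpose_mul matrix_mul_assoc)
    also have "\<dots> = L0 ** (X ** diag_mat s ** transpose X) ** transpose L0"
      by (simp add: W_Lk X_def matrix_transpose_mul matrix_mul_assoc)
    also have "trace \<dots> = trace (transpose L0 ** (L0 ** (X ** diag_mat s ** transpose X)))"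
      by (rule trace_mul_sym)
    also have "transpose L0 ** (L0 ** (X ** diag_mat s ** transpose X)) = diag_mat p ** (X ** diag_mat s ** transpose X)"
    proof -
      have "transpose L0 ** L0 = diag_mat (\<chi> i. sqrt (p $ i)) ** diag_mat (\<chi> i. sqrt (p $ i))"
        by (simp add: L0_def matrix_transpose_mul matrix_mul_assoc orthogonal_cancel[OF Q])
      also have "\<dots> = diag_mat p" using p by (simp add: diag_mat_mult less_imp_le)
      finally show ?thesis by (simp add: matrix_mul_assoc)
    qed
    also have "trace \<dots> = (\<Sum>j\<in>UNIV. p $ j * (X ** diag_mat s ** transpose X) $ j $ j)"
      by (simp add: trace_def diag_mult_mat)
    also have "\<dots> = (\<Sum>j\<in>UNIV. p $ j * (\<Sum>i\<in>UNIV. (X $ j $ i)\<^sup>2 * s $ i))"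
    proof -
      have "(X ** diag_mat s ** transpose X) $ j $ j = (\<Sum>i\<in>UNIV. (X $ j $ i)\<^sup>2 * s $ i)" for j
        by (subst matrix_matrix_mult_def) (simp add: mat_mult_diag transpose_def power2_eq_square mult_ac)
      then show ?thesis by simp
    qed
    finally show ?thesis .
  qed
  moreover have "\<theta> * (norm (W *v \<delta>))\<^sup>2 \<le> q"
  proof (cases "\<tau> < 1")
    case True
    define u where "u = matrix_inv Lk *v \<delta>"
    have "Lk *v u = \<delta>"
      by (simp only: u_def matrix_vector_mul_assoc matrix_inv_right[OF Lk(1)] matrix_vector_mul_lid)
    then have "W *v \<delta> = Q *v (diag_mat (\<chi> i. sqrt (p $ i)) *v (U *v u))"
      by (metis W_Lk L0_def matrix_vector_mul_assoc)
    then have "(norm (W *v \<delta>))\<^sup>2 = (norm (diag_mat (\<chi> i. sqrt (p $ i)) *v (U *v u)))\<^sup>2"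
      by (simp add: norm_orthogonal_mult[OF Q])
    also have "\<dots> = (\<Sum>j\<in>UNIV. p $ j * ((U *v u) $ j)\<^sup>2)"
      using p by (simp add: norm_squared_vec diag_mat_vector power_mult_distrib less_imp_le)
    finally have "(1 - \<tau>) * (\<theta> * (norm (W *v \<delta>))\<^sup>2) = (\<Sum>j\<in>UNIV. (1 - \<tau>) * (\<theta> * p $ j) * ((U *v u) $ j)\<^sup>2)"
      by (simp add: sum_distrib_left mult_ac)
    also have "\<dots> \<le> (\<Sum>j\<in>UNIV. 1 * ((U *v u) $ j)\<^sup>2)"
      by (intro sum_mono mult_right_mono less_imp_le[OF dom]) simp
    also have "\<dots> = (norm (U *v u))\<^sup>2"
      by (simp add: norm_squared_vec)
    also have "\<dots> \<le> (norm u)\<^sup>2" using norm_coisometry_le[OF UU, of u] by (simp add: power_mono)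
    finally show ?thesis using q True by (simp add: u_def pos_le_divide_eq mult.commute)
  next
    case False
    then show ?thesis using q by simp
  qed
  ultimately have "\<theta> * (trace (W ** K' ** transpose W) + (norm (W *v \<delta>))\<^sup>2) \<le> \<theta> * (\<Sum>j\<in>UNIV. p $ j * tau_tilt \<tau> (\<theta> * p $ j))"
    by (simp add: distrib_left)
  then show ?thesis using \<theta> by simp
qed

end

end

section \<open>Block matrices\<close>

lemma sum_UNIV_sum_type:
  "(\<Sum>k\<in>(UNIV :: ('n::finite + 'p::finite) set). f k) = (\<Sum>i\<in>UNIV. f (Inl i)) + (\<Sum>j\<in>UNIV. f (Inr j))"
  by (subst UNIV_Plus_UNIV[symmetric]) (simp add: sum.Plus del: UNIV_Plus_UNIV)

lemma vec_eq_sum_type_iff: "x = y \<longleftrightarrow> (\<forall>i. x $ Inl i = y $ Inl i) \<and> (\<forall>j. x $ Inr j = y $ Inr j)"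
  unfolding vec_eq_iff by (metis sum.exhaust)

lemma mat_stack_mult: "mat_stack a b ** Z = mat_stack (a ** Z) (b ** (Z :: real^'c::finite^'d::finite))"
  by (simp add: vec_eq_sum_type_iff mat_stack_def matrix_matrix_mult_def vec_eq_iff)

lemma transpose_mat_stack_mult:
  "transpose (mat_stack a b) ** mat_stack c d = transpose a ** c + transpose b ** (d :: real^'d::finite^'p::finite)"
  by (simp add: vec_eq_iff mat_stack_def matrix_matrix_mult_def transpose_def sum_UNIV_sum_type)

lemma mat_stack_mult_transpose:
  fixes a :: "real^'k::finite^'n::finite" and b :: "real^'k^'p::finite"
  shows "mat_stack a b ** transpose (mat_stack c d)
    = mat_blocks (a ** transpose c) (a ** transpose d) (b ** transpose c) (b ** transpose d)"
  by (simp add: vec_eq_sum_type_iff mat_blocks_def mat_stack_def vec_join_def matrix_matrix_mult_def transpose_def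
      vec_eq_iff[of "_ :: real^('n + 'p)"] split: sum.split)

lemma mat_blocks_add:
  "mat_blocks a b c d + mat_blocks a' b' c' d' = mat_blocks (a + a') (b + b') (c + c') (d + d')"
  by (simp add: vec_eq_sum_type_iff mat_blocks_def mat_stack_def vec_join_def)

lemma mat_blocks_1: "mat_blocks (mat 1) 0 0 (mat 1) = mat 1"
  by (simp add: vec_eq_sum_type_iff mat_blocks_def mat_stack_def vec_join_def mat_def)

lemma mat_blocks_entries:
  "(\<chi> i j. mat_blocks a b c d $ Inl i $ Inr j) = b"
  "(\<chi> i j. mat_blocks a b c d $ Inr i $ Inl j) = c"
  "(\<chi> i j. mat_blocks a b c d $ Inr i $ Inr j) = d"
  by (simp_all add: vec_eq_iff mat_blocks_def mat_stack_def vec_join_def)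

lemma transpose_mat_stack_vec:
  "transpose (mat_stack a b) *v z = transpose a *v vec_upper z + transpose b *v vec_lower z"
  by (simp add: vec_eq_iff mat_stack_def matrix_vector_mult_def transpose_def sum_UNIV_sum_type
      vec_upper_def vec_lower_def)

lemma vec_upper_mat_stack: "vec_upper (mat_stack a b *v x) = a *v x"
  and vec_lower_mat_stack: "vec_lower (mat_stack a b *v x) = b *v x"
  by (simp_all add: vec_eq_iff mat_stack_def matrix_vector_mult_def vec_upper_def vec_lower_def)

lemma vec_upper_join: "vec_upper (vec_join x y) = x" and vec_lower_join: "vec_lower (vec_join x y) = y"
  by (simp_all add: vec_eq_iff vec_join_def vec_upper_def vec_lower_def)

lemma vec_upper_diff: "vec_upper (a - b) = vec_upper a - vec_upper b"
  and vec_lower_diff: "vec_lower (a - b) = vec_lower a - vec_lower b"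
  by (simp_all add: vec_eq_iff vec_upper_def vec_lower_def)

lemma measurable_vec_upper [measurable]: "vec_upper \<in> borel_measurable borel"
  and measurable_vec_lower [measurable]: "vec_lower \<in> borel_measurable borel"
  unfolding vec_upper_def[abs_def] vec_lower_def[abs_def]
  by (intro borel_measurable_continuous_onI continuous_intros)+

text \<open>The decomposition sends \<open>(x, y)\<close> to the error \<open>x - G y\<close> and
  the observation \<open>y\<close>. The wide matrices are written as transposed stacks because
  \<open>mat_stack\<close> is vertical.\<close>

lemma block_split_stack:
  fixes G :: "real^'p::finite^'n::finite"
  shows "block_split (mat_stack (mat 1) 0) (mat_stack G (mat 1))
    (transpose (mat_stack (mat 1) (- transpose G))) (transpose (mat_stack 0 (mat 1)))"
proof
  have neg: "transpose (- A) = - transpose A" "(- A) ** B = - (A ** B)" "A ** 0 = 0" "0 ** B = 0" "transpose (0 :: real^'b^'a) = 0"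
    for A :: "real^'b::finite^'a::finite" and B :: "real^'c::finite^'b"
    using matrix_mul_diff_left[of 0 A B] matrix_mul_diff_right[of A 0 0]
    by (simp_all add: transpose_def vec_eq_iff)
  show "transpose (mat_stack (mat 1) (- transpose G)) ** mat_stack (mat 1) 0 = mat 1"
    "transpose (mat_stack (mat 1) (- transpose G)) ** mat_stack G (mat 1) = 0"
    "transpose (mat_stack 0 (mat 1)) ** mat_stack (mat 1) 0 = (0 :: real^'n^'p)"
    "transpose (mat_stack 0 (mat 1)) ** mat_stack G (mat 1) = (mat 1 :: real^'p^'p)"
    by (simp_all add: transpose_mat_stack_mult neg)
  show "mat_stack (mat 1) 0 ** transpose (mat_stack (mat 1) (- transpose G))
      + mat_stack G (mat 1) ** transpose (mat_stack 0 (mat 1)) = mat 1"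
    by (simp add: mat_stack_mult_transpose neg mat_blocks_add mat_blocks_1)
qed

section \<open>Joint densities as mixtures over the state\<close>

lemma mixture_AE_gauss:
  fixes \<phi> :: "real^'m::finite \<Rightarrow> real^'n::finite \<Rightarrow> real"
  assumes V: "pos_def V" and nonneg: "\<And>z x. \<phi> z x \<ge> 0"
    and meas: "(\<lambda>(z, x). \<phi> z x) \<in> borel_measurable borel"
    and K: "pos_def K" and ae: "AE z in lborel. (LINT x|lborel. \<phi> z x * gauss_density xhat V x) = gauss_density m K z"
    and r: "\<And>z. r z \<ge> 0" "r \<in> borel_measurable borel"
  shows "(\<integral>\<^sup>+z. \<integral>\<^sup>+x. ennreal (r z * \<phi> z x * gauss_density xhat V x) \<partial>lborel \<partial>lborel)
    = (\<integral>\<^sup>+z. ennreal (gauss_density m K z) * ennreal (r z) \<partial>lborel)"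
proof (rule nn_integral_cong_AE, use ae in eventually_elim)
  fix z assume z: "(LINT x|lborel. \<phi> z x * gauss_density xhat V x) = gauss_density m K z"
  have "(\<lambda>(z, x). \<phi> z x) \<in> borel_measurable (borel \<Otimes>\<^sub>M borel)"
    using meas by (simp add: borel_prod)
  from measurable_compose[OF measurable_Pair1'[of z] this]
  have [measurable]: "\<phi> z \<in> borel_measurable borel" by simp
  \<comment> \<open>The Bochner integral of a non-integrable function is 0 by convention; here the
    value is a positive Gaussian density.\<close>
  have "integrable lborel (\<lambda>x. \<phi> z x * gauss_density xhat V x)"
    using z gauss_density_pos[OF K, of m z] not_integrable_integral_eq by force
  then have "(\<integral>\<^sup>+x. ennreal (\<phi> z x * gauss_density xhat V x) \<partial>lborel) = ennreal (gauss_density m K z)"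
    using nonneg gauss_density_pos[OF V] z
    by (subst nn_integral_eq_integral) (auto simp: less_imp_le)
  moreover have "(\<integral>\<^sup>+x. ennreal (r z * \<phi> z x * gauss_density xhat V x) \<partial>lborel)
      = ennreal (r z) * (\<integral>\<^sup>+x. ennreal (\<phi> z x * gauss_density xhat V x) \<partial>lborel)"
    using r nonneg gauss_density_pos[OF V]
    by (subst nn_integral_cmult[symmetric]) (auto simp: ennreal_mult mult.assoc less_imp_le)
  ultimately show "(\<integral>\<^sup>+x. ennreal (r z * \<phi> z x * gauss_density xhat V x) \<partial>lborel)
      = ennreal (gauss_density m K z) * ennreal (r z)"
    by (simp add: mult.commute)
qed

lemma measurable_joint_density:
  assumes "(\<lambda>(z, x). \<phi> z x) \<in> borel_measurable borel"
  shows "joint_density xhat V \<phi> \<in> borel_measurable borel"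
proof -
  have [measurable]: "(\<lambda>(z, x). \<phi> z x) \<in> borel_measurable (borel \<Otimes>\<^sub>M borel)"
    using assms by (simp add: borel_prod)
  have "(\<lambda>z. LINT x|lborel. \<phi> z x * gauss_density xhat V x) \<in> borel_measurable borel"
    by measurable
  then show ?thesis by (simp add: joint_density_def[abs_def])
qed

lemma mat_stack_conj:
  fixes a :: "real^'k::finite^'n::finite" and b :: "real^'k^'p::finite"
  shows "mat_stack a b ** Z ** transpose (mat_stack c d)
    = mat_blocks (a ** Z ** transpose c) (a ** Z ** transpose d) (b ** Z ** transpose c) (b ** Z ** transpose d)"
  by (subst mat_stack_mult) (rule mat_stack_mult_transpose)

lemma nominal_cov_blocks:
  "nominal_cov A B C D V = mat_blocks (A ** V ** transpose A + B ** transpose B) (A ** V ** transpose C + B ** transpose D)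
     (C ** V ** transpose A + D ** transpose B) (C ** V ** transpose C + D ** transpose D)"
  by (simp add: nominal_cov_def mat_stack_conj mat_stack_mult_transpose mat_blocks_add)

text \<open>The left side is the block matrix with lower block \<open>Y\<close>, regression matrix
  \<open>G\<close> and Schur complement \<open>X\<close>; this links the model's blocks to the
  splitting into error and observation.\<close>

lemma mat_blocks_eq_cov:
  fixes G :: "real^'p::finite^'n::finite"
  shows "mat_blocks (X + G ** Y ** transpose G) (G ** Y) (Y ** transpose G) Y
    = block_split.cov (mat_stack (mat 1) 0) (mat_stack G (mat 1)) X Y"
proof -
  have z: "A ** 0 = 0" "0 ** B = 0" "transpose (0 :: real^'b^'a) = 0"
    for A :: "real^'b::finite^'a::finite" and B :: "real^'c::finite^'b"
    using matrix_mul_diff_left[of 0 0 B] matrix_mul_diff_right[of A 0 0] by (simp_all add: transpose_def vec_eq_iff)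
  show ?thesis
    unfolding block_split.cov_def[OF block_split_stack]
    by (simp add: mat_stack_conj mat_blocks_add z)
qed

section \<open>The nominal model\<close>

locale robust_update =
  fixes A :: "real^'n::finite^'n" and B :: "real^('n + 'p::finite)^'n"
    and C :: "real^'n^'p" and D :: "real^('n + 'p)^'p"
    and xhat :: "real^'n" and V P :: "real^'n^'n" and G :: "real^'p^'n"
  assumes BD: "invertible (mat_stack B D)" and V: "pos_def V"
    and G: "G = (A ** V ** transpose C + B ** transpose D)
               ** matrix_inv (C ** V ** transpose C + D ** transpose D)"
    and P: "P = A ** V ** transpose A
               - G ** (C ** V ** transpose C + D ** transpose D) ** transpose G + B ** transpose B"
begin

abbreviation "Ky \<equiv> C ** V ** transpose C + D ** transpose D"
abbreviation "K \<equiv> nominal_cov A B C D V"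
abbreviation "m \<equiv> mat_stack A C *v xhat"
abbreviation "g0 y \<equiv> A *v xhat + G *v (y - C *v xhat)"
abbreviation "W \<equiv> transpose (mat_stack (mat 1) (- transpose G))"
abbreviation "E \<equiv> transpose (mat_stack (0 :: real^'p^'n) (mat 1 :: real^'p^'p))"

sublocale block_split "mat_stack (mat 1) 0" "mat_stack G (mat 1)" W E
  by (rule block_split_stack)

lemma noise_cov_pos_def: "pos_def (mat_stack B D ** transpose (mat_stack B D))"
  by (rule pos_def_mult_transpose[OF BD])

lemma K_pos_def: "pos_def K"
  using pos_def_plus_congruence[OF noise_cov_pos_def V, of "transpose (mat_stack A C)"]
  by (simp add: nominal_cov_def add.commute)

lemma Ky_pos_def: "pos_def Ky"
proof -
  have "E ** K ** transpose E = (E ** mat_stack A C) ** V ** transpose (E ** mat_stack A C)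
      + (E ** mat_stack B D) ** transpose (E ** mat_stack B D)"
    by (simp add: nominal_cov_def matrix_mul_add_left matrix_mul_add_right matrix_transpose_mul matrix_mul_assoc)
  moreover have Em: "E ** mat_stack a b = b" for a :: "real^'k::finite^'n" and b :: "real^'k^'p"
    unfolding transpose_mat_stack_mult by (simp add: matrix_matrix_mult_def transpose_def vec_eq_iff mat_def if_distribR if_distrib cong: if_cong)
  moreover have "pos_def (E ** K ** transpose E)"
  proof (rule pos_def_congruence[OF K_pos_def])
    fix x :: "real^'p" assume "transpose E *v x = 0"
    then have "vec_lower (mat_stack (0 :: real^'p^'n) (mat 1) *v x) = 0"
      by (simp add: vec_lower_def vec_eq_iff)
    then show "x = 0" by (simp add: vec_lower_mat_stack)
  qed
  ultimately show ?thesis by (simp add: Em)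
qed

lemma Kxy_eq: "A ** V ** transpose C + B ** transpose D = G ** Ky"
  unfolding G matrix_mul_assoc[of _ "matrix_inv Ky" Ky, symmetric] matrix_inv_left[OF pos_def_invertible[OF Ky_pos_def]]
  by simp

lemma Kyx_eq: "C ** V ** transpose A + D ** transpose B = Ky ** transpose G"
proof -
  have "transpose (A ** V ** transpose C + B ** transpose D) = transpose (G ** Ky)"
    by (simp only: Kxy_eq)
  then show ?thesis
    using pos_def_symmetric[OF V] pos_def_symmetric[OF Ky_pos_def]
    by (simp add: transpose_add matrix_transpose_mul matrix_mul_assoc)
qed

text \<open>\<open>G\<close> is the regression of the next state on the observation, so the error is
  uncorrelated with the observation and has covariance \<open>P\<close>.\<close>

lemma K_eq_cov: "K = cov P Ky"
  unfolding nominal_cov_blocks Kxy_eq Kyx_eq mat_blocks_eq_cov[symmetric] by (simp add: P)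

text \<open>Altering the upper left block in this way amounts to replacing \<open>P\<close> by
  \<open>X\<close> in \<open>K_eq_cov\<close>.\<close>

lemma least_favorable_cov_eq:
  "mat_blocks (X + (\<chi> i j. K $ Inl i $ Inr j) ** matrix_inv (\<chi> i j. K $ Inr i $ Inr j) ** (\<chi> i j. K $ Inr i $ Inl j))
     (\<chi> i j. K $ Inl i $ Inr j) (\<chi> i j. K $ Inr i $ Inl j) (\<chi> i j. K $ Inr i $ Inr j) = cov X Ky"
proof -
  have "G ** Ky ** matrix_inv Ky = G"
    unfolding matrix_mul_assoc[of G Ky, symmetric] matrix_inv_right[OF pos_def_invertible[OF Ky_pos_def]]
    by simp
  then show ?thesis
    unfolding nominal_cov_blocks mat_blocks_entries Kxy_eq Kyx_eq mat_blocks_eq_cov[symmetric]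
    by (simp add: matrix_mul_assoc)
qed

text \<open>\<open>P\<close> is the covariance \<open>W ** K ** transpose W\<close> of the error,
  and \<open>transpose W\<close> is injective because it has a left inverse.\<close>

lemma P_pos_def: "pos_def P"
proof -
  have "pos_def (W ** K ** transpose W)"
  proof (rule pos_def_congruence[OF K_pos_def])
    fix x assume "transpose W *v x = 0"
    then have "(transpose (mat_stack (mat 1) 0) ** transpose W) *v x = 0"
      by (simp only: matrix_vector_mul_assoc[symmetric] matrix_vector_mult_0_right)
    then show "x = 0" by (simp only: transposed matrix_vector_mul_lid)
  qed
  then show ?thesis by (simp only: K_eq_cov W_cov_W)
qed

lemma W_residual: "W *v (z - m) = vec_upper z - g0 (vec_lower z)"
proof -
  have "(- G) *v v = - (G *v v)" for v
    using matrix_vector_mult_diff_rdistrib[of 0 G v] by simp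
  moreover have "transpose (- transpose G) = - G" by (simp add: transpose_def vec_eq_iff)
  ultimately show ?thesis
    by (simp add: transpose_mat_stack_vec vec_upper_diff vec_lower_diff vec_upper_mat_stack vec_lower_mat_stack
        matrix_vector_mult_diff_distrib)
qed

lemma E_lower: "E *v z = vec_lower z"
proof -
  have "transpose (0 :: real^'p^'n) *v v = 0" for v :: "real^'n"
    by (simp add: transpose_def matrix_vector_mult_def vec_eq_iff)
  then show ?thesis by (simp add: transpose_mat_stack_vec)
qed

lemma joint_density_nominal: "joint_density xhat V (nominal_density A B C D) = gauss_density m K"
proof
  fix z
  from gauss_mixture[OF V noise_cov_pos_def, of "mat_stack A C" z xhat]
  show "joint_density xhat V (nominal_density A B C D) z = gauss_density m K z"
    by (simp add: joint_density_def nominal_density_def has_bochner_integral_iff nominal_cov_def)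
qed

lemma nominal_density_nonneg: "nominal_density A B C D z x \<ge> 0"
  unfolding nominal_density_def using gauss_density_pos[OF noise_cov_pos_def] by (simp add: less_imp_le)

lemma measurable_nominal_density:
  "(\<lambda>w. nominal_density A B C D (fst w) (snd w)) \<in> borel_measurable (borel \<Otimes>\<^sub>M borel)"
  unfolding nominal_density_def gauss_density_def by measurable

lemma cond_density_gauss:
  assumes X: "pos_def X"
  shows "cond_density (gauss_density m (cov X Ky)) y = gauss_density (g0 y) X"
proof -
  define e where "e = (y - C *v xhat) \<bullet> (matrix_inv Ky *v (y - C *v xhat))"
  \<comment> \<open>The marginal density of the observation at \<open>y\<close>: it collects what is
    independent of \<open>x\<close> and cancels in the quotient.\<close>
  define k where "k = exp (- e / 2) * sqrt ((2 * pi) ^ CARD('n) * det X) / sqrt ((2 * pi) ^ CARD('n + 'p) * det (cov X Ky))"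
  have dX: "sqrt ((2 * pi) ^ CARD('n) * det X) > 0"
    using pos_def_det[OF X] by simp
  have k: "k > 0"
    unfolding k_def using dX pos_def_det[OF cov_pos_def[OF X Ky_pos_def]] by simp
  have f: "gauss_density m (cov X Ky) (vec_join x y) = k * gauss_density (g0 y) X x" for x
  proof -
    define a where "a = (x - g0 y) \<bullet> (matrix_inv X *v (x - g0 y))"
    have "(vec_join x y - m) \<bullet> (matrix_inv (cov X Ky) *v (vec_join x y - m)) = a + e"
      unfolding cov_inverse_quadratic[OF X Ky_pos_def] W_residual E_lower a_def e_def
      by (simp add: vec_upper_join vec_lower_join vec_lower_diff vec_lower_mat_stack)
    moreover have "exp (- (a + e) / 2) = exp (- e / 2) * exp (- a / 2)"
      by (simp add: exp_add[symmetric] add_divide_distrib)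
    ultimately show ?thesis
      using dX pos_def_det[OF X] by (simp add: gauss_density_def k_def a_def[symmetric])
  qed
  have "(LINT x|lborel. k * gauss_density (g0 y) X x) = k"
    using has_bochner_integral_gauss[OF X, of "g0 y"] by (simp add: has_bochner_integral_iff)
  then show ?thesis using k by (auto simp: cond_density_def f)
qed

end

section \<open>The saddle point\<close>

locale least_favorable = robust_update A B C D xhat V P G
  for A :: "real^'n::finite^'n" and B :: "real^('n + 'p::finite)^'n"
    and C :: "real^'n^'p" and D :: "real^('n + 'p)^'p"
    and xhat :: "real^'n" and V P :: "real^'n^'n" and G :: "real^'p^'n" +
  fixes \<tau> c \<theta> :: real and Q :: "real^'n^'n" and p :: "real^'n"
  assumes \<tau>: "0 \<le> \<tau>" "\<tau> \<le> 1"
    and Q: "orthogonal_matrix Q" and P_diag: "P = Q ** diag_mat p ** transpose Q"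
    and \<theta>: "\<theta> > 0" and dom: "\<And>i. (1 - \<tau>) * (\<theta> * p $ i) < 1"
    and c: "c = (\<Sum>i\<in>UNIV. tau_entropy \<tau> (tau_tilt \<tau> (\<theta> * p $ i)))"
begin

abbreviation "V' \<equiv> Q ** diag_mat (\<chi> i. p $ i * tau_tilt \<tau> (\<theta> * p $ i)) ** transpose Q"
abbreviation "\<Phi> \<equiv> matrix_inv P - matrix_inv V'"
abbreviation "Kt \<equiv> cov V' Ky"
text \<open>The quotient of the Gaussian normalizers of \<open>Kt\<close> and
  \<open>K\<close>.\<close>

abbreviation "M \<equiv> sqrt ((2 * pi) ^ CARD('n + 'p) * det Kt) / sqrt ((2 * pi) ^ CARD('n + 'p) * det K)"
abbreviation "\<phi>0 \<equiv> \<lambda>z x. 1 / M * exp (1 / 2 * ((vec_upper z - g0 (vec_lower z))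
    \<bullet> (\<Phi> *v (vec_upper z - g0 (vec_lower z))))) * nominal_density A B C D z x"
abbreviation "\<B> \<equiv> uncertainty_ball \<tau> c xhat V (nominal_density A B C D)"

lemma p_pos: "p $ i > 0"
  using P_pos_def Q unfolding P_diag by (rule pos_def_orthogonal_diag_pos)

lemma tilt_gt_1: "tau_tilt \<tau> (\<theta> * p $ i) > 1"
  using \<theta> p_pos by (intro tau_tilt_gt_1 \<tau> dom) simp

lemma V'_pos_def: "pos_def V'"
proof (rule pos_def_orthogonal_diag[OF Q])
  fix i show "(\<chi> i. p $ i * tau_tilt \<tau> (\<theta> * p $ i)) $ i > 0"
    using p_pos[of i] tilt_gt_1[of i] by simp
qed

lemma Kt_pos_def: "pos_def Kt"
  by (rule cov_pos_def[OF V'_pos_def Ky_pos_def])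

text \<open>In the common eigenbasis of \<open>P\<close> and \<open>V'\<close> the eigenvalues are
  \<open>1 / p - 1 / (p * t)\<close>, positive because the tilt \<open>t\<close> exceeds 1.\<close>

lemma \<Phi>_pos_def: "pos_def \<Phi>"
proof -
  have nz: "p $ i \<noteq> 0" "p $ i * tau_tilt \<tau> (\<theta> * p $ i) \<noteq> 0" for i
    using p_pos[of i] tilt_gt_1[of i] by auto
  have "matrix_inv P = Q ** diag_mat (\<chi> i. inverse (p $ i)) ** transpose Q"
    unfolding P_diag by (rule matrix_inv_orthogonal_diag[OF Q nz(1)])
  moreover have "matrix_inv V' = Q ** diag_mat (\<chi> i. inverse (p $ i * tau_tilt \<tau> (\<theta> * p $ i))) ** transpose Q"
    using nz(2) by (subst matrix_inv_orthogonal_diag[OF Q]) simp_all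
  moreover have "diag_mat d - diag_mat e = diag_mat (\<chi> i. d $ i - e $ i)" for d e :: "real^'n"
    by (simp add: diag_mat_def vec_eq_iff)
  ultimately have "\<Phi> = Q ** diag_mat (\<chi> i. inverse (p $ i) - inverse (p $ i * tau_tilt \<tau> (\<theta> * p $ i))) ** transpose Q"
    by (simp only: matrix_mul_diff_left[symmetric] matrix_mul_diff_right[symmetric]) simp
  moreover have "inverse (p $ i) - inverse (p $ i * tau_tilt \<tau> (\<theta> * p $ i)) > 0" for i
    using p_pos[of i] tilt_gt_1[of i] by (simp add: field_simps)
  ultimately show ?thesis using pos_def_orthogonal_diag[OF Q] by simp
qed

lemma M_pos: "M > 0"
  using pos_def_det[OF Kt_pos_def] pos_def_det[OF K_pos_def] by simp

text \<open>\<Phi> exchanges \<open>matrix_inv P\<close> for \<open>matrix_inv V'\<close> in the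
  error part of the exponent; the observation part is common to both Gaussians.\<close>

lemma tilted_gauss:
  "1 / M * exp (1 / 2 * ((vec_upper z - g0 (vec_lower z)) \<bullet> (\<Phi> *v (vec_upper z - g0 (vec_lower z)))))
     * gauss_density m K z = gauss_density m Kt z"
proof -
  define w e where "w = vec_upper z - g0 (vec_lower z)"
    and "e = (E *v (z - m)) \<bullet> (matrix_inv Ky *v (E *v (z - m)))"
  have Kq: "(z - m) \<bullet> (matrix_inv K *v (z - m)) = w \<bullet> (matrix_inv P *v w) + e"
    unfolding K_eq_cov cov_inverse_quadratic[OF P_pos_def Ky_pos_def] W_residual w_def e_def ..
  have Ktq: "(z - m) \<bullet> (matrix_inv Kt *v (z - m)) = w \<bullet> (matrix_inv V' *v w) + e"
    unfolding cov_inverse_quadratic[OF V'_pos_def Ky_pos_def] W_residual w_def e_def ..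
  have "exp (1 / 2 * (w \<bullet> (\<Phi> *v w))) * exp (- (w \<bullet> (matrix_inv P *v w) + e) / 2)
      = exp (- (w \<bullet> (matrix_inv V' *v w) + e) / 2)"
    by (simp add: exp_add[symmetric] matrix_vector_mult_diff_rdistrib inner_diff_right field_simps)
  moreover define s1 s2 where "s1 = sqrt ((2 * pi) ^ CARD('n + 'p) * det Kt)"
    and "s2 = sqrt ((2 * pi) ^ CARD('n + 'p) * det K)"
  moreover have "s1 > 0" "s2 > 0"
    unfolding s1_def s2_def using pos_def_det[OF Kt_pos_def] pos_def_det[OF K_pos_def] by simp_all
  ultimately show ?thesis
    unfolding gauss_density_def Kq Ktq w_def[symmetric] s1_def[symmetric] s2_def[symmetric]
    by simp
qed

lemma joint_density_\<phi>0: "joint_density xhat V \<phi>0 = gauss_density m Kt"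
proof
  fix z
  let ?r = "1 / M * exp (1 / 2 * ((vec_upper z - g0 (vec_lower z)) \<bullet> (\<Phi> *v (vec_upper z - g0 (vec_lower z)))))"
  have "joint_density xhat V \<phi>0 z = ?r * joint_density xhat V (nominal_density A B C D) z"
    unfolding joint_density_def by (subst integral_mult_right_zero[symmetric]) (simp only: mult.assoc)
  then show "joint_density xhat V \<phi>0 z = gauss_density m Kt z"
    unfolding joint_density_nominal tilted_gauss .
qed

lemma \<phi>0_nonneg: "\<phi>0 z x \<ge> 0"
  by (intro mult_nonneg_nonneg divide_nonneg_pos[OF zero_le_one M_pos] exp_ge_zero nominal_density_nonneg)

lemma measurable_\<phi>0: "(\<lambda>(z, x). \<phi>0 z x) \<in> borel_measurable borel"
proof -
  note [measurable] = measurable_nominal_density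
  have "(\<lambda>w. \<phi>0 (fst w) (snd w)) \<in> borel_measurable (borel \<Otimes>\<^sub>M borel)"
    by measurable
  then show ?thesis by (simp add: borel_prod split_beta')
qed

lemma density_nominal: "density_mean (gauss_density m K) = m" "density_cov (gauss_density m K) = K"
  by (rule density_mean_gauss[OF K_pos_def], rule density_cov_gauss[OF K_pos_def])

lemma factor_K: "cov (Q ** diag_mat p ** transpose Q) Ky = square_factor K ** transpose (square_factor K)"
  unfolding P_diag[symmetric] K_eq_cov[symmetric] by (rule square_factor(1)[OF K_pos_def])

lemma whitened_diagonalization:
  assumes "pos_def K'"
  obtains R s where "orthogonal_matrix R" "\<And>i. s $ i > 0"
    "matrix_inv (square_factor K) ** K' ** transpose (matrix_inv (square_factor K)) = R ** diag_mat s ** transpose R"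
proof -
  let ?M = "matrix_inv (square_factor K)"
  have "pos_def (?M ** K' ** transpose ?M)"
  proof (rule pos_def_congruence[OF assms])
    fix x :: "real^('n + 'p)" assume "transpose ?M *v x = 0"
    moreover have "invertible (transpose ?M)"
      using matrix_inv_right[OF square_factor(2)[OF K_pos_def]] matrix_inv_left[OF square_factor(2)[OF K_pos_def]]
      by (intro invertible_transpose) (auto simp: invertible_def)
    ultimately show "x = 0" using invertible_mult_vec_eq_0 by blast
  qed
  then obtain R :: "real^('n + 'p)^('n + 'p)" and s where "orthogonal_matrix R"
    "?M ** K' ** transpose ?M = R ** diag_mat s ** transpose R" "\<And>i. s $ i > 0"
    using pos_def_diagonalization[of "?M ** K' ** transpose ?M"] by blast
  with that show ?thesis by blast
qed

text \<open>The mean is unshifted and the whitened eigenvalues cost exactly \<open>c\<close>, so the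
  constraint is active.\<close>

lemma \<phi>0_in_ball: "\<phi>0 \<in> \<B>"
proof -
  obtain R s where R: "orthogonal_matrix R" and s: "\<And>i. s $ i > 0"
    and S: "matrix_inv (square_factor K) ** Kt ** transpose (matrix_inv (square_factor K)) = R ** diag_mat s ** transpose R"
    using whitened_diagonalization[OF Kt_pos_def] by blast
  have "(\<Sum>i\<in>UNIV. tau_entropy \<tau> (s $ i)) = c"
    using whitened_cov[OF Q p_pos square_factor(2)[OF K_pos_def] factor_K, of "tau_entropy \<tau>" R "\<chi> i. tau_tilt \<tau> (\<theta> * p $ i)" s]
      tau_entropy_1[OF \<tau>] R S by (simp add: c)
  then have "gauss_tau_div \<tau> m Kt m K \<le> ereal c"
    unfolding gauss_tau_div_eq[OF \<tau> K_pos_def R s S] by (simp add: delta_infty_def)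
  then have "tau_div \<tau> (gauss_density m Kt) (gauss_density m K) \<le> ereal c"
    unfolding tau_div_def density_nominal density_mean_gauss[OF Kt_pos_def] density_cov_gauss[OF Kt_pos_def] .
  moreover have "is_gauss_density (gauss_density m Kt)"
    unfolding is_gauss_density_def using Kt_pos_def by blast
  ultimately show ?thesis
    unfolding uncertainty_ball_def mem_Collect_eq joint_density_\<phi>0 joint_density_nominal
    using \<phi>0_nonneg measurable_\<phi>0 by blast
qed

text \<open>Reduces a member of the ball to its mean and covariance; the left side of the last bound
  is its loss at \<open>g0\<close>, the right side that of \<open>\<phi>0\<close>.\<close>

lemma ball_gauss:
  assumes "\<phi> \<in> \<B>"
  obtains m' K' where "pos_def K'" "AE z in lborel. (LINT x|lborel. \<phi> z x * gauss_density xhat V x) = gauss_density m' K' z"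
    "trace (W ** K' ** transpose W) + (norm (W *v m' - W *v m))\<^sup>2 \<le> trace V'"
proof -
  have meas: "(\<lambda>(z, x). \<phi> z x) \<in> borel_measurable borel"
    and g: "is_gauss_density (joint_density xhat V \<phi>)"
    and div: "tau_div \<tau> (joint_density xhat V \<phi>) (gauss_density m K) \<le> ereal c"
    using assms unfolding uncertainty_ball_def mem_Collect_eq joint_density_nominal by blast+
  obtain m' K' where K': "pos_def K'" and ae: "AE z in lborel. joint_density xhat V \<phi> z = gauss_density m' K' z"
    using g by (auto simp: is_gauss_density_def)
  have "density_mean (joint_density xhat V \<phi>) = m'" "density_cov (joint_density xhat V \<phi>) = K'"
    by (rule density_mean_cov_AE_gauss[OF K' measurable_joint_density[OF meas] ae])+
  then have div': "gauss_tau_div \<tau> m' K' m K \<le> ereal c"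
    using div by (simp only: tau_div_def density_nominal)
  obtain R s where R: "orthogonal_matrix R" and s: "\<And>i. s $ i > 0"
    and S: "matrix_inv (square_factor K) ** K' ** transpose (matrix_inv (square_factor K)) = R ** diag_mat s ** transpose R"
    using whitened_diagonalization[OF K'] by blast
  \<comment> \<open>For \<open>\<tau> = 1\<close> a finite divergence forces a zero shift, so the
    cost of the mean is set to 0.\<close>
  define q where "q = (if \<tau> < 1 then (norm (matrix_inv (square_factor K) *v (m' - m)))\<^sup>2 / (1 - \<tau>) else 0)"
  note div'' = div'[unfolded gauss_tau_div_eq[OF \<tau> K_pos_def R s S]]
  have "q + (\<Sum>i\<in>UNIV. tau_entropy \<tau> (s $ i)) \<le> c \<and> (\<tau> < 1 \<or> m' - m = 0)"
  proof (cases "\<tau> < 1")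
    case True
    then show ?thesis using div'' by (simp only: q_def if_True ereal_less_eq simp_thms)
  next
    case False
    then have le: "delta_infty (m' - m) + ereal (\<Sum>i\<in>UNIV. tau_entropy \<tau> (s $ i)) \<le> ereal c"
      using div'' by (simp only: if_False)
    have 0: "m' - m = 0"
    proof (rule ccontr)
      assume "m' - m \<noteq> 0"
      with le show False by (simp only: delta_infty_def if_False) simp
    qed
    show ?thesis
      using le False unfolding 0 by (simp add: delta_infty_def q_def)
  qed
  then have q: "if \<tau> < 1 then q = (norm (matrix_inv (square_factor K) *v (m' - m)))\<^sup>2 / (1 - \<tau>) else q = 0 \<and> m' - m = 0"
    and budget: "q + (\<Sum>i\<in>UNIV. tau_entropy \<tau> (s $ i)) \<le> c"
    by (auto simp only: q_def if_True if_False split: if_splits)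
  have "trace (W ** K' ** transpose W) + (norm (W *v (m' - m)))\<^sup>2 \<le> (\<Sum>j\<in>UNIV. p $ j * tau_tilt \<tau> (\<theta> * p $ j))"
    by (rule residual_variance_bound[OF Q p_pos square_factor(2)[OF K_pos_def] factor_K \<tau> \<theta> dom R S s q budget[unfolded c]])
  also have "\<dots> = trace V'" by (simp add: trace_orthogonal_conj[OF Q] trace_diag_mat)
  finally show ?thesis
    by (intro that[OF K' ae[unfolded joint_density_def]]) (simp only: matrix_vector_mult_diff_distrib)
qed

lemma ball_nonneg_measurable:
  assumes "\<phi> \<in> \<B>"
  shows "\<phi> z x \<ge> 0" "(\<lambda>(z, x). \<phi> z x) \<in> borel_measurable borel"
  using assms unfolding uncertainty_ball_def by blast+

text \<open>\<open>g0\<close> is affine in \<open>z\<close>, so its second moment is finite under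
  every Gaussian.\<close>

lemma g0_in_estimators: "g0 \<in> estimators xhat V \<B>"
  unfolding estimators_def mem_Collect_eq
proof (intro conjI ballI)
  show "g0 \<in> borel_measurable borel" by measurable
  fix \<phi> assume \<phi>: "\<phi> \<in> \<B>"
  obtain m' K' where K': "pos_def K'"
    and ae: "AE z in lborel. (LINT x|lborel. \<phi> z x * gauss_density xhat V x) = gauss_density m' K' z"
    using ball_gauss[OF \<phi>] by blast
  have g0: "g0 (vec_lower z) = (G ** E) *v z - (G *v (C *v xhat) - A *v xhat)" for z
    by (simp add: matrix_vector_mul_assoc[symmetric] E_lower matrix_vector_mult_diff_distrib)
  have "(\<integral>\<^sup>+z. \<integral>\<^sup>+x. ennreal ((norm (g0 (vec_lower z)))\<^sup>2 * \<phi> z x * gauss_density xhat V x) \<partial>lborel \<partial>lborel)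
      = (\<integral>\<^sup>+z. ennreal (gauss_density m' K' z) * ennreal ((norm (g0 (vec_lower z)))\<^sup>2) \<partial>lborel)"
    by (rule mixture_AE_gauss[OF V ball_nonneg_measurable[OF \<phi>] K' ae zero_le_power2]) measurable
  also have "\<dots> < \<infinity>"
    unfolding g0 nn_integral_gauss_norm_squared[OF K'] by simp
  finally show "(\<integral>\<^sup>+z. \<integral>\<^sup>+x. ennreal ((norm (g0 (vec_lower z)))\<^sup>2 * \<phi> z x * gauss_density xhat V x) \<partial>lborel \<partial>lborel) < \<infinity>" .
qed

lemma loss_gauss:
  assumes \<phi>: "\<phi> \<in> \<B>" and K': "pos_def K'"
    and ae: "AE z in lborel. (LINT x|lborel. \<phi> z x * gauss_density xhat V x) = gauss_density m' K' z"
    and [measurable]: "g \<in> borel_measurable borel"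
  shows "loss xhat V \<phi> g = (\<integral>\<^sup>+z. ennreal (gauss_density m' K' z) * ennreal ((norm (vec_upper z - g (vec_lower z)))\<^sup>2) \<partial>lborel)"
  unfolding loss_def
  by (rule mixture_AE_gauss[OF V ball_nonneg_measurable[OF \<phi>] K' ae zero_le_power2]) measurable

lemma loss_g0:
  assumes \<phi>: "\<phi> \<in> \<B>" and K': "pos_def K'"
    and ae: "AE z in lborel. (LINT x|lborel. \<phi> z x * gauss_density xhat V x) = gauss_density m' K' z"
  shows "loss xhat V \<phi> g0 = ennreal (trace (W ** K' ** transpose W) + (norm (W *v m' - W *v m))\<^sup>2)"
proof -
  have "g0 \<in> borel_measurable borel" by measurable
  from loss_gauss[OF \<phi> K' ae this] show ?thesis
    unfolding W_residual[symmetric] matrix_vector_mult_diff_distrib[of W] nn_integral_gauss_norm_squared[OF K'] .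
qed

lemma \<phi>0_AE: "AE z in lborel. (LINT x|lborel. \<phi>0 z x * gauss_density xhat V x) = gauss_density m Kt z"
  using joint_density_\<phi>0 unfolding joint_density_def fun_eq_iff by simp

lemma loss_\<phi>0_g0: "loss xhat V \<phi>0 g0 = ennreal (trace V')"
  using loss_g0[OF \<phi>0_in_ball Kt_pos_def \<phi>0_AE] unfolding W_cov_W by simp

text \<open>Another estimator changes the residual by \<open>g0 y - g y\<close>, a function of the
  observation alone, which is the situation of \<open>residual_optimal\<close>.\<close>

lemma g0_optimal:
  assumes [measurable]: "g \<in> borel_measurable borel"
  shows "loss xhat V \<phi>0 g0 \<le> loss xhat V \<phi>0 g"
proof -
  have g0: "g0 \<in> borel_measurable borel" by measurable
  have "(\<lambda>y. g0 y - g y) \<in> borel_measurable borel" by measurable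
  from residual_optimal[OF V'_pos_def Ky_pos_def this, where m = "m"]
  have "(\<integral>\<^sup>+z. ennreal (gauss_density m Kt z) * ennreal ((norm (vec_upper z - g0 (vec_lower z)))\<^sup>2) \<partial>lborel)
    \<le> (\<integral>\<^sup>+z. ennreal (gauss_density m Kt z) * ennreal ((norm (vec_upper z - g0 (vec_lower z)
        + (g0 (vec_lower z) - g (vec_lower z))))\<^sup>2) \<partial>lborel)"
    unfolding W_residual E_lower .
  then show ?thesis
    unfolding loss_gauss[OF \<phi>0_in_ball Kt_pos_def \<phi>0_AE g0] loss_gauss[OF \<phi>0_in_ball Kt_pos_def \<phi>0_AE assms]
    by simp
qed

text \<open>Saddle point: \<open>\<phi>0\<close> is worst for \<open>g0\<close> and
  \<open>g0\<close> is best for \<open>\<phi>0\<close>. So the worst case of \<open>g0\<close> is at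
  most the loss of any \<open>g\<close> at \<open>\<phi>0\<close>, hence at most the worst case of
  \<open>g\<close>.\<close>

lemma minimax_solution: "is_minimax_solution xhat V \<B> g0 \<phi>0"
proof -
  have upper: "loss xhat V \<phi> g0 \<le> loss xhat V \<phi>0 g0" if \<phi>: "\<phi> \<in> \<B>" for \<phi>
  proof -
    obtain m' K' where K': "pos_def K'"
      and ae: "AE z in lborel. (LINT x|lborel. \<phi> z x * gauss_density xhat V x) = gauss_density m' K' z"
      and le: "trace (W ** K' ** transpose W) + (norm (W *v m' - W *v m))\<^sup>2 \<le> trace V'"
      using ball_gauss[OF \<phi>] by blast
    show ?thesis
      unfolding loss_g0[OF \<phi> K' ae] loss_\<phi>0_g0 by (rule ennreal_leI[OF le])
  qed
  have "(SUP \<phi>\<in>\<B>. loss xhat V \<phi> g0) \<le> (SUP \<phi>\<in>\<B>. loss xhat V \<phi> g)"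
    if "g \<in> estimators xhat V \<B>" for g
  proof -
    have "(SUP \<phi>\<in>\<B>. loss xhat V \<phi> g0) \<le> loss xhat V \<phi>0 g0" by (rule SUP_least) (rule upper)
    also have "\<dots> \<le> loss xhat V \<phi>0 g"
      using that by (intro g0_optimal) (simp add: estimators_def)
    also have "\<dots> \<le> (SUP \<phi>\<in>\<B>. loss xhat V \<phi> g)" by (rule SUP_upper[OF \<phi>0_in_ball])
    finally show ?thesis .
  qed
  then show ?thesis
    unfolding is_minimax_solution_def
    by (intro conjI ballI g0_in_estimators \<phi>0_in_ball upper)
qed

lemma \<phi>0_normalized: "(\<integral>\<^sup>+x. \<integral>\<^sup>+z. ennreal (\<phi>0 z x * gauss_density xhat V x) \<partial>lborel \<partial>lborel) = 1"
proof -
  have meas: "(\<lambda>(x, z). \<phi>0 z x) \<in> borel_measurable (borel \<Otimes>\<^sub>M borel)"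
    using measurable_compose[OF measurable_pair_swap' measurable_\<phi>0[folded borel_prod]]
    by (simp only: split_beta' fst_conv snd_conv)
  \<comment> \<open>Stated for a variable \<open>f\<close>, so that its measurability enters as a
    single hypothesis.\<close>
  have swap: "(\<integral>\<^sup>+x. \<integral>\<^sup>+z. ennreal (f z x * gauss_density xhat V x) \<partial>lborel \<partial>lborel)
      = (\<integral>\<^sup>+z. \<integral>\<^sup>+x. ennreal (f z x * gauss_density xhat V x) \<partial>lborel \<partial>lborel)"
    if [measurable]: "(\<lambda>(x, z). f z x) \<in> borel_measurable (borel \<Otimes>\<^sub>M borel)"
    for f :: "real^('n + 'p) \<Rightarrow> real^'n \<Rightarrow> real"
    by (rule nn_integral_lborel_swap) measurable
  have "(\<integral>\<^sup>+x. \<integral>\<^sup>+z. ennreal (\<phi>0 z x * gauss_density xhat V x) \<partial>lborel \<partial>lborel)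
      = (\<integral>\<^sup>+z. \<integral>\<^sup>+x. ennreal (\<phi>0 z x * gauss_density xhat V x) \<partial>lborel \<partial>lborel)"
    by (rule swap[OF meas])
  also have "\<dots> = (\<integral>\<^sup>+z. ennreal (gauss_density m Kt z) \<partial>lborel)"
    using mixture_AE_gauss[where r = "\<lambda>_. 1", OF V \<phi>0_nonneg measurable_\<phi>0 Kt_pos_def \<phi>0_AE zero_le_one]
    unfolding mult_1 ennreal_1 mult_1_right by simp
  finally show ?thesis by (simp only: nn_integral_gauss[OF Kt_pos_def])
qed

end

theorem mainTheorem1:
  fixes \<tau> c :: real
    and A :: "real^'n::finite^'n" and B :: "real^('n + 'p::finite)^'n"
    and C :: "real^'n^'p" and D :: "real^('n + 'p)^'p"
    and xhat :: "real^'n" and V P L :: "real^'n^'n" and G :: "real^'p^'n"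
  assumes "0 \<le> \<tau>" and "\<tau> \<le> 1" and "c > 0"
    and "invertible (mat_stack B D)"
    and "pos_def V"
    and "G = (A ** V ** transpose C + B ** transpose D)
               ** matrix_inv (C ** V ** transpose C + D ** transpose D)"
    and "P = A ** V ** transpose A
               - G ** (C ** V ** transpose C + D ** transpose D) ** transpose G
               + B ** transpose B"
    and "P = L ** transpose L"
  shows "(\<exists>!\<theta>. \<theta> > 0 \<and> inverse \<theta> > (1 - \<tau>) * spectral_norm P \<and> c = gamma_tau \<tau> P \<theta>) \<and>
    (\<forall>\<theta>. \<theta> > 0 \<and> inverse \<theta> > (1 - \<tau>) * spectral_norm P \<and> c = gamma_tau \<tau> P \<theta> \<longrightarrow>
      (let V' = (if \<tau> < 1
                 then L ** mat_powr (mat 1 - (\<theta> * (1 - \<tau>)) *\<^sub>R (transpose L ** L)) (1 / (\<tau> - 1))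
                        ** transpose L
                 else L ** mat_exp (\<theta> *\<^sub>R (transpose L ** L)) ** transpose L);
           \<phi> = nominal_density A B C D;
           \<B> = uncertainty_ball \<tau> c xhat V \<phi>;
           K = nominal_cov A B C D V;
           Kxy = (\<chi> i j. K $ Inl i $ Inr j);
           Kyx = (\<chi> i j. K $ Inr i $ Inl j);
           Ky = (\<chi> i j. K $ Inr i $ Inr j);
           g0 = (\<lambda>y. A *v xhat + G *v (y - C *v xhat));
           \<Phi> = matrix_inv P - matrix_inv V'
       in pos_def \<Phi> \<and>
          (\<exists>M>0.
            (let \<phi>0 = (\<lambda>z x. 1 / M * exp (1 / 2 * ((vec_upper z - g0 (vec_lower z))
                             \<bullet> (\<Phi> *v (vec_upper z - g0 (vec_lower z))))) * \<phi> z x);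
                 f0 = joint_density xhat V \<phi>0
             in (\<integral>\<^sup>+x. \<integral>\<^sup>+z. ennreal (\<phi>0 z x * gauss_density xhat V x) \<partial>lborel \<partial>lborel) = 1 \<and>
                is_minimax_solution xhat V \<B> g0 \<phi>0 \<and>
                f0 = gauss_density (mat_stack A C *v xhat)
                       (mat_blocks (V' + Kxy ** matrix_inv Ky ** Kyx) Kxy Kyx Ky) \<and>
                (\<forall>y. density_cov (cond_density f0 y) = V')))))"
proof -
  interpret ru: robust_update A B C D xhat V P G
    using assms by unfold_locales
  obtain Q p where Q: "orthogonal_matrix Q" and P_diag: "P = Q ** diag_mat p ** transpose Q" and p: "\<And>i. p $ i > 0"
    using pos_def_diagonalization[OF ru.P_pos_def] by blast
  have L: "invertible L"
    using pos_def_invertible[OF ru.P_pos_def] unfolding \<open>P = L ** transpose L\<close> by (rule invertible_transpose_mult)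
  have PL: "L ** transpose L = Q ** diag_mat p ** transpose Q"
    unfolding \<open>P = L ** transpose L\<close>[symmetric] by (rule P_diag)
  \<comment> \<open>Spectral norm and \<open>gamma_tau\<close> are translated to eigenvalues once;
    the uniqueness of \<theta> and the hypotheses of \<open>least_favorable\<close> are both read
    off from this.\<close>
  have iff: "(\<theta> > 0 \<and> inverse \<theta> > (1 - \<tau>) * spectral_norm P \<and> c = gamma_tau \<tau> P \<theta>)
      \<longleftrightarrow> (\<theta> > 0 \<and> (\<forall>i. (1 - \<tau>) * (\<theta> * p $ i) < 1) \<and> c = (\<Sum>i\<in>UNIV. tau_entropy \<tau> (tau_tilt \<tau> (\<theta> * p $ i))))" for \<theta>
  proof (cases "\<theta> > 0")
    case True
    have "inverse \<theta> > (1 - \<tau>) * spectral_norm P \<longleftrightarrow> (\<forall>i. (1 - \<tau>) * (\<theta> * p $ i) < 1)"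
      unfolding P_diag by (rule spectral_norm_less_iff[OF Q p True \<open>\<tau> \<le> 1\<close>])
    then show ?thesis
      using gamma_tau_eq[OF \<open>0 \<le> \<tau>\<close> \<open>\<tau> \<le> 1\<close> ru.P_pos_def Q P_diag, of \<theta>] by auto
  qed simp
  have unique: "\<exists>!\<theta>. \<theta> > 0 \<and> inverse \<theta> > (1 - \<tau>) * spectral_norm P \<and> c = gamma_tau \<tau> P \<theta>"
    unfolding iff by (rule tau_entropy_sum_unique_scale[OF \<open>0 \<le> \<tau>\<close> \<open>\<tau> \<le> 1\<close> \<open>c > 0\<close> p])
  show ?thesis
  proof (rule conjI[OF unique], intro allI impI, goal_cases)
    case (1 \<theta>)
    then have \<theta>: "\<theta> > 0" "\<And>i. (1 - \<tau>) * (\<theta> * p $ i) < 1"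
        "c = (\<Sum>i\<in>UNIV. tau_entropy \<tau> (tau_tilt \<tau> (\<theta> * p $ i)))"
      unfolding iff by blast+
    interpret lf: least_favorable A B C D xhat V P G \<tau> c \<theta> Q p
      by unfold_locales (fact \<open>0 \<le> \<tau>\<close> \<open>\<tau> \<le> 1\<close> Q P_diag \<theta>)+
    show ?case
      unfolding Let_def tilted_covariance[OF L Q PL, of \<tau> \<theta>] ru.least_favorable_cov_eq
      by (intro conjI lf.\<Phi>_pos_def exI[of _ lf.M] allI lf.M_pos lf.\<phi>0_normalized lf.minimax_solution lf.joint_density_\<phi>0)
        (simp only: lf.joint_density_\<phi>0 ru.cond_density_gauss[OF lf.V'_pos_def] density_cov_gauss[OF lf.V'_pos_def])
  qed
qed

end
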